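(* Let $\Omega\subseteq\mathbb R^N$ be a bounded connected open set with Lipschitz continuous boundary, let $f:\Omega\times\mathbb R^N\to\overline{\mathbb R}$ be a Borel function and let $F:W^{1,\infty}(\Omega)\to\overline{\mathbb R}$ be the supremal functional $F(u)=\operatorname{ess\,sup}_{x\in\Omega} f(x,Du(x))$. Assume that (1) $F$ is positively $1$-homogeneous, that is, $F(\lambda u)=\lambda F(u)$ for all $\lambda>0$ and all $u\in W^{1,\infty}(\Omega)$; (2) there exist $\alpha,\beta>0$ such that $\alpha|x-y|\le d^1_F(x,y)\le\beta|x-y|_\Omega$ for all $x,y\in\Omega$. Then, for every $\tau\in\{\tau_\infty,w^*,w^*_{seq}\}$, $\Gamma_\tau(F)=R_{d^1_F}$ on $W^{1,\infty}(\Omega)$.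
   Context: $\overline{\mathbb R}=[-\infty,+\infty]$. Functions in $W^{1,\infty}(\Omega)$ are identified with their continuous representatives. For $x,y\in\Omega$, $|x-y|_\Omega$ is the geodetic distance: the infimum of the Euclidean lengths of Lipschitz curves contained in $\Omega$ with end-points $x$ and $y$. The pseudo-distance $d^1_F$ is $d^1_F(x,y):=\sup\{u(x)-u(y): u\in W^{1,\infty}(\Omega),\ F(u)\le1\}$ for $x,y\in\Omega$, and the associated difference quotient functional is $R_{d^1_F}(u):=\sup\left\{\frac{u(x)-u(y)}{d^1_F(x,y)}: x,y\in\Omega,\ d^1_F(x,y)\ne0\right\}$. Topologies on $W^{1,\infty}(\Omega)$: $\tau_\infty$ is the topology induced by the $L^\infty(\Omega)$ norm (uniform convergence); $w^*$ is the topology induced by the embedding $u\mapsto(u,Du)$ into $L^\infty(\Omega)\times L^\infty(\Omega;\mathbb R^N)$ with its weak* topology; $w^*_{seq}$ is the topology whose closed sets are the sequentially $w^*$-closed sets. For a topology $\tau$, $\Gamma_\tau(F)$ is the $\tau$-lower semicontinuous envelope of $F$, i.e. the pointwise supremum of all $\tau$-lower semicontinuous $G:W^{1,\infty}(\Omega)\to\overline{\mathbb R}$ with $G\le F$ ($G$ is $\tau$-lower semicontinuous if $\{G\le\lambda\}$ is $\tau$-closed for every $\lambda\in\mathbb R$).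
   Formalization: The equality is stated for all u except constant u when F(0) = −∞; there the printed claim fails, since Γ_τ(F)(u) = −∞ while R(u) = 0 (e.g. f(x,ξ) = |ξ| for ξ ≠ 0, f(x,0) = −∞). *)

theory Defs
  imports "HOL-Probability.Essential_Supremum"
begin

section \<open>Domains\<close>

text \<open>
  Near each boundary point, up to a rigid motion, \<open>\<Omega>\<close> lies strictly above the graph of a
  Lipschitz function of \<open>N - 1\<close> variables. The last coordinate axis is the unit vector \<open>\<nu>\<close>, and
  \<open>\<real>\<^sup>N\<^sup>-\<^sup>1\<close> is the hyperplane orthogonal to \<open>\<nu>\<close>.
\<close>

definition lipschitz_boundary :: "(real ^ 'n) set \<Rightarrow> bool" where
  "lipschitz_boundary \<Omega> \<longleftrightarrow>
    (\<forall>x0 \<in> frontier \<Omega>. \<exists>r > 0. \<exists>\<nu> \<gamma> L. norm \<nu> = 1 \<and> L-lipschitz_on {y. y \<bullet> \<nu> = 0} \<gamma> \<and>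
      \<Omega> \<inter> ball x0 r = {x \<in> ball x0 r. \<gamma> (x - (x \<bullet> \<nu>) *\<^sub>R \<nu>) < x \<bullet> \<nu>})"

text \<open>Total variation over the partitions \<open>0 \<le> t 0 \<le> \<dots> \<le> t n \<le> 1\<close>.\<close>

definition curve_length :: "(real \<Rightarrow> 'a::metric_space) \<Rightarrow> ereal" where
  "curve_length c =
    (SUP (n, t) \<in> {(n :: nat, t :: nat \<Rightarrow> real). mono t \<and> range t \<subseteq> {0..1}}.
      ereal (\<Sum>i<n. dist (c (t i)) (c (t (Suc i)))))"

definition geodetic_dist :: "'a::metric_space set \<Rightarrow> 'a \<Rightarrow> 'a \<Rightarrow> ereal" where
  "geodetic_dist \<Omega> x y =
    (INF c \<in> {c. (\<exists>L. L-lipschitz_on {0..1} c) \<and> c ` {0..1} \<subseteq> \<Omega> \<and> c 0 = x \<and> c 1 = y}.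
      curve_length c)"


section \<open>The space \<open>W\<^sup>1\<^sup>,\<^sup>\<infinity>(\<Omega>)\<close>\<close>

definition partial_deriv :: "'n \<Rightarrow> (real ^ 'n \<Rightarrow> real) \<Rightarrow> real ^ 'n \<Rightarrow> real" where
  "partial_deriv i \<phi> x = frechet_derivative \<phi> (at x) (axis i 1)"

primrec C_k :: "nat \<Rightarrow> (real ^ 'n \<Rightarrow> real) \<Rightarrow> bool" where
  "C_k 0 \<phi> \<longleftrightarrow> continuous_on UNIV \<phi>"
| "C_k (Suc k) \<phi> \<longleftrightarrow> (\<forall>x. \<phi> differentiable (at x)) \<and> (\<forall>i. C_k k (partial_deriv i \<phi>))"

definition test_functions :: "(real ^ 'n) set \<Rightarrow> (real ^ 'n \<Rightarrow> real) set" where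
  "test_functions \<Omega> =
    {\<phi>. (\<forall>k. C_k k \<phi>) \<and> compact (closure {x. \<phi> x \<noteq> 0}) \<and> closure {x. \<phi> x \<noteq> 0} \<subseteq> \<Omega>}"

text \<open>Elements of \<open>L\<^sup>\<infinity>(\<Omega>)\<close> are functions here, not classes modulo null sets.\<close>

definition Linf :: "(real ^ 'n) set \<Rightarrow> (real ^ 'n \<Rightarrow> 'b::euclidean_space) set" where
  "Linf \<Omega> = {g \<in> borel_measurable (lebesgue_on \<Omega>). \<exists>C. AE x in lebesgue_on \<Omega>. norm (g x) \<le> C}"

definition Linf_norm :: "(real ^ 'n) set \<Rightarrow> (real ^ 'n \<Rightarrow> 'b::euclidean_space) \<Rightarrow> ereal" where
  "Linf_norm \<Omega> g = esssup (lebesgue_on \<Omega>) (\<lambda>x. ereal (norm (g x)))"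

definition has_Linf_weak_gradient ::
  "(real ^ 'n) set \<Rightarrow> (real ^ 'n \<Rightarrow> real) \<Rightarrow> (real ^ 'n \<Rightarrow> real ^ 'n) \<Rightarrow> bool" where
  "has_Linf_weak_gradient \<Omega> u g \<longleftrightarrow> g \<in> Linf \<Omega> \<and>
    (\<forall>\<phi> \<in> test_functions \<Omega>. \<forall>i.
      (LINT x|lebesgue_on \<Omega>. u x * partial_deriv i \<phi> x) = - (LINT x|lebesgue_on \<Omega>. g x $ i * \<phi> x))"

text \<open>
  Continuous representatives, extended by \<open>0\<close> outside \<open>\<Omega>\<close> so that an element of the space is
  determined by its values on \<open>\<Omega>\<close>.
\<close>

definition W1inf :: "(real ^ 'n) set \<Rightarrow> (real ^ 'n \<Rightarrow> real) set" where
  "W1inf \<Omega> = {u \<in> Linf \<Omega>. continuous_on \<Omega> u \<and> (\<forall>x. x \<notin> \<Omega> \<longrightarrow> u x = 0) \<and>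
    (\<exists>g. has_Linf_weak_gradient \<Omega> u g)}"

text \<open>The weak gradient is unique up to null sets; this picks a representative.\<close>

definition weak_gradient :: "(real ^ 'n) set \<Rightarrow> (real ^ 'n \<Rightarrow> real) \<Rightarrow> real ^ 'n \<Rightarrow> real ^ 'n" where
  "weak_gradient \<Omega> u = (SOME g. has_Linf_weak_gradient \<Omega> u g)"

lemma weak_gradient_in_Linf:
  assumes "u \<in> W1inf \<Omega>"
  shows "weak_gradient \<Omega> u \<in> Linf \<Omega>"
proof -
  obtain g where "has_Linf_weak_gradient \<Omega> u g"
    using assms by (auto simp: W1inf_def)
  then have "has_Linf_weak_gradient \<Omega> u (weak_gradient \<Omega> u)"
    unfolding weak_gradient_def by (rule someI[of "has_Linf_weak_gradient \<Omega> u"])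
  then show ?thesis
    by (simp add: has_Linf_weak_gradient_def)
qed


section \<open>Topologies on \<open>W\<^sup>1\<^sup>,\<^sup>\<infinity>(\<Omega>)\<close>\<close>

definition tau_inf :: "(real ^ 'n) set \<Rightarrow> (real ^ 'n \<Rightarrow> real) topology" where
  "tau_inf \<Omega> = topology_generated_by
    {{v \<in> W1inf \<Omega>. Linf_norm \<Omega> (\<lambda>x. v x - u x) < ereal e} | u e. u \<in> W1inf \<Omega> \<and> e > 0}"

text \<open>\<open>\<sigma>(L\<^sup>\<infinity>, L\<^sup>1)\<close>: the coarsest topology making every pairing with an integrable function continuous.\<close>

definition weak_star_Linf ::
  "(real ^ 'n) set \<Rightarrow> (real ^ 'n \<Rightarrow> 'b::euclidean_space) topology" where
  "weak_star_Linf \<Omega> = topology_generated_by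
    {{g \<in> Linf \<Omega>. (LINT x|lebesgue_on \<Omega>. g x \<bullet> h x) \<in> U} | h U.
      integrable (lebesgue_on \<Omega>) h \<and> open U}"

definition weak_star_W :: "(real ^ 'n) set \<Rightarrow> (real ^ 'n \<Rightarrow> real) topology" where
  "weak_star_W \<Omega> = pullback_topology (W1inf \<Omega>) (\<lambda>u. (u, weak_gradient \<Omega> u))
    (prod_topology (weak_star_Linf \<Omega>) (weak_star_Linf \<Omega>))"

definition seq_closedin :: "'a topology \<Rightarrow> 'a set \<Rightarrow> bool" where
  "seq_closedin X C \<longleftrightarrow> C \<subseteq> topspace X \<and>
    (\<forall>\<sigma> l. (\<forall>n. \<sigma> n \<in> C) \<and> limitin X \<sigma> l sequentially \<longrightarrow> l \<in> C)"

definition seq_topology :: "'a topology \<Rightarrow> 'a topology" where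
  "seq_topology X = topology (\<lambda>U. U \<subseteq> topspace X \<and> seq_closedin X (topspace X - U))"

lemma seq_closedin_Un:
  assumes "seq_closedin X C" "seq_closedin X D"
  shows "seq_closedin X (C \<union> D)"
  unfolding seq_closedin_def
proof (intro conjI allI impI)
  show "C \<union> D \<subseteq> topspace X"
    using assms by (auto simp: seq_closedin_def)
next
  fix \<sigma> l
  assume A: "(\<forall>n. \<sigma> n \<in> C \<union> D) \<and> limitin X \<sigma> l sequentially"
  have sub: "l \<in> E" if E: "seq_closedin X E" and inf: "infinite {n. \<sigma> n \<in> E}" for E
  proof -
    obtain r :: "nat \<Rightarrow> nat" where r: "strict_mono r" "\<And>n. r n \<in> {n. \<sigma> n \<in> E}"
      by (rule infinite_enumerate[OF inf, THEN exE]) auto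
    have "limitin X (\<sigma> \<circ> r) l sequentially"
      by (rule limitin_subsequence[OF r(1)]) (use A in blast)
    moreover have "\<forall>n. (\<sigma> \<circ> r) n \<in> E"
      using r(2) by simp
    ultimately show ?thesis
      using E unfolding seq_closedin_def by blast
  qed
  have "{n. \<sigma> n \<in> C} \<union> {n. \<sigma> n \<in> D} = UNIV"
    using A by auto
  then have "infinite {n. \<sigma> n \<in> C} \<or> infinite {n. \<sigma> n \<in> D}"
    by (metis finite_Un infinite_UNIV_nat)
  then show "l \<in> C \<union> D"
    using sub assms by blast
qed

lemma istopology_seq: "istopology (\<lambda>U. U \<subseteq> topspace X \<and> seq_closedin X (topspace X - U))"
  unfolding istopology_def
proof (intro conjI allI impI)
  fix S T
  assume "S \<subseteq> topspace X \<and> seq_closedin X (topspace X - S)"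
    and "T \<subseteq> topspace X \<and> seq_closedin X (topspace X - T)"
  then show "seq_closedin X (topspace X - S \<inter> T)"
    using seq_closedin_Un by (metis Diff_Int)
next
  fix K
  assume K: "\<forall>S\<in>K. S \<subseteq> topspace X \<and> seq_closedin X (topspace X - S)"
  show "seq_closedin X (topspace X - \<Union>K)"
    unfolding seq_closedin_def
  proof (intro conjI allI impI)
    fix \<sigma> l
    assume A: "(\<forall>n. \<sigma> n \<in> topspace X - \<Union>K) \<and> limitin X \<sigma> l sequentially"
    then have "l \<in> topspace X"
      by (elim conjE) (rule limitin_topspace)
    moreover have "l \<notin> S" if "S \<in> K" for S
    proof -
      have "\<forall>n. \<sigma> n \<in> topspace X - S"
        using A that by blast
      then show ?thesis
        using K that A unfolding seq_closedin_def by blast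
    qed
    ultimately show "l \<in> topspace X - \<Union>K"
      by blast
  qed auto
qed auto

lemma closedin_seq_topology: "closedin (seq_topology X) C \<longleftrightarrow> seq_closedin X C"
  and topspace_seq_topology: "topspace (seq_topology X) = topspace X"
proof -
  have op: "openin (seq_topology X) U \<longleftrightarrow> U \<subseteq> topspace X \<and> seq_closedin X (topspace X - U)" for U
    unfolding seq_topology_def by (simp add: topology_inverse'[OF istopology_seq])
  have "openin (seq_topology X) (topspace X)"
    by (simp add: op seq_closedin_def)
  then show top: "topspace (seq_topology X) = topspace X"
    by (metis op openin_subset openin_topspace subset_antisym)
  show "closedin (seq_topology X) C \<longleftrightarrow> seq_closedin X C"
    unfolding closedin_def op top
    by (metis Diff_subset double_diff seq_closedin_def subset_refl)
qed

lemma topspace_tau_inf: "topspace (tau_inf \<Omega>) = W1inf \<Omega>"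
proof -
  have "u \<in> {v \<in> W1inf \<Omega>. Linf_norm \<Omega> (\<lambda>x. v x - u x) < ereal 1}" if "u \<in> W1inf \<Omega>" for u
  proof -
    have "Linf_norm \<Omega> (\<lambda>x. u x - u x) \<le> 0"
      unfolding Linf_norm_def by (rule esssup_I) auto
    then show ?thesis
      using that by (auto intro: le_less_trans)
  qed
  then show ?thesis
    unfolding tau_inf_def topology_generated_by_topspace
    by (safe; blast intro: zero_less_one)
qed

lemma topspace_weak_star_Linf: "topspace (weak_star_Linf \<Omega>) = Linf \<Omega>"
proof -
  have "\<exists>h U. Linf \<Omega> = {g \<in> Linf \<Omega>. (LINT x|lebesgue_on \<Omega>. g x \<bullet> h x) \<in> U} \<and>
      integrable (lebesgue_on \<Omega>) h \<and> open U"
    by (rule exI[of _ "\<lambda>_. 0"], rule exI[of _ UNIV]) auto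
  then show ?thesis
    unfolding weak_star_Linf_def topology_generated_by_topspace by blast
qed

lemma topspace_weak_star_W: "topspace (weak_star_W \<Omega>) = W1inf \<Omega>"
proof -
  have "W1inf \<Omega> \<subseteq> Linf \<Omega>"
    by (auto simp: W1inf_def)
  then show ?thesis
    unfolding weak_star_W_def topspace_pullback_topology topspace_prod_topology
      topspace_weak_star_Linf
    using weak_gradient_in_Linf by fastforce
qed


section \<open>Semicontinuous envelopes and the functionals\<close>

definition lsc :: "'a topology \<Rightarrow> ('a \<Rightarrow> ereal) \<Rightarrow> bool" where
  "lsc \<tau> G \<longleftrightarrow> (\<forall>r::real. closedin \<tau> {u \<in> topspace \<tau>. G u \<le> ereal r})"

definition lsc_envelope :: "'a topology \<Rightarrow> ('a \<Rightarrow> ereal) \<Rightarrow> 'a \<Rightarrow> ereal" where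
  "lsc_envelope \<tau> F u = (SUP G \<in> {G. lsc \<tau> G \<and> (\<forall>v \<in> topspace \<tau>. G v \<le> F v)}. G u)"

definition supremal_functional ::
  "(real ^ 'n) set \<Rightarrow> ((real ^ 'n) \<times> (real ^ 'n) \<Rightarrow> ereal) \<Rightarrow> (real ^ 'n \<Rightarrow> real) \<Rightarrow> ereal" where
  "supremal_functional \<Omega> f u = esssup (lebesgue_on \<Omega>) (\<lambda>x. f (x, weak_gradient \<Omega> u x))"

definition d1 ::
  "(real ^ 'n) set \<Rightarrow> ((real ^ 'n \<Rightarrow> real) \<Rightarrow> ereal) \<Rightarrow> real ^ 'n \<Rightarrow> real ^ 'n \<Rightarrow> ereal" where
  "d1 \<Omega> F x y = (SUP u \<in> {u \<in> W1inf \<Omega>. F u \<le> 1}. ereal (u x - u y))"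

text \<open>Division is that of \<^typ>\<open>ereal\<close>, so a quotient with \<open>d x y = \<infinity>\<close> is \<open>0\<close>.\<close>

definition difference_quotient ::
  "'a set \<Rightarrow> ('a \<Rightarrow> 'a \<Rightarrow> ereal) \<Rightarrow> ('a \<Rightarrow> real) \<Rightarrow> ereal" where
  "difference_quotient \<Omega> d u =
    (SUP (x, y) \<in> {(x, y). x \<in> \<Omega> \<and> y \<in> \<Omega> \<and> d x y \<noteq> 0}. ereal (u x - u y) / d x y)"

end

theory Submission
  imports Defs
begin

text \<open>
  Write \<open>d\<close> for \<open>d\<^sup>1\<^sub>F\<close>, \<open>R\<close> for its difference quotient functional and \<open>K = {F \<le> 1}\<close>. By homogeneity
  \<open>F v \<le> l\<close> gives \<open>v x - v y \<le> l * d x y\<close>, so \<open>R \<le> F\<close>, and \<open>R\<close> is lower semicontinuous because on its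
  sublevels, whose elements are equi-Lipschitz on segments, point evaluations are approximated
  by averages over small balls.

  Conversely, let \<open>u x - u y \<le> d x y\<close> for all \<open>x\<close>, \<open>y\<close>. As \<open>F\<close> is supremal, \<open>K\<close> is closed under adding
  constants and under finite maxima and minima, and by the definition of \<open>d\<close> it contains for each
  pair \<open>p\<close>, \<open>q\<close> some \<open>w\<close> with \<open>w p = u p\<close> and \<open>w q \<le> u q + e\<close>. The Lipschitz boundary makes the domain
  totally bounded for the geodetic distance, so the lattice argument of Stone--Weierstrass yields
  elements of \<open>K\<close> converging to \<open>u\<close> uniformly. They have a common Lipschitz constant on segments, so
  the convergence also holds weakly-star for the gradients.

  Rademacher's theorem is not needed: weak gradients are reached by testing difference quotients
  against \<open>L\<^sup>1\<close> functions with compact support.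
\<close>

section \<open>Smooth functions with compact support\<close>

text \<open>The sublevel \<open>K\<close> may fail to be convex, so averaging and mollification do
  not stay inside it. What a bound \<open>F v \<le> 1\<close> does survive is gluing: it constrains
  the pair of \<open>x\<close> and the gradient at \<open>x\<close> almost everywhere. Hence the
  restriction to maxima and minima, and the work on their weak gradients.

  Lipschitz constants are never read off from gradients. The bound of \<open>d1\<close> by
  \<open>\<beta> * geodetic_dist\<close> hands the constant \<open>\<beta>\<close> on segments to
  every member of \<open>K\<close> and to every function with difference quotient at most 1. The
  bound by \<alpha> makes \<open>d1\<close> vanish only on the diagonal.

  The exception in the theorem is a genuine one. Homogeneity leaves \<open>F (\<lambda>x. 0)\<close>
  only the values 0, \<infinity> and -\<infinity>. If it is -\<infinity>, then \<open>F\<close>, and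
  with it every envelope, is -\<infinity> at all constants of the space, while \<open>R\<close> is 0
  there on a nonempty domain. Off the constants equality persists, but \<open>R\<close> is then no
  longer a minorant of \<open>F\<close> and has to be modified.\<close>

lemma C_k_coinduct:
  assumes "\<phi> \<in> S"
    and step: "\<And>\<psi> x. \<psi> \<in> S \<Longrightarrow> \<psi> differentiable (at x)" "\<And>\<psi> i. \<psi> \<in> S \<Longrightarrow> partial_deriv i \<psi> \<in> S"
  shows "C_k k \<phi>"
  using assms(1)
proof (induction k arbitrary: \<phi>)
  case 0
  then show ?case
    using step(1) by (auto intro!: continuous_at_imp_continuous_on differentiable_imp_continuous_within)
qed (use step in auto)

lemma partial_deriv_eq:
  assumes "(\<phi> has_derivative \<phi>') (at x)"
  shows "partial_deriv i \<phi> x = \<phi>' (axis i 1)"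
  using frechet_derivative_at[OF assms] by (simp add: partial_deriv_def)

text \<open>The derivatives of \<open>exp (- 1 / t)\<close>, cut off at \<open>t = 0\<close>, are combinations of these functions.\<close>

definition flat :: "nat \<Rightarrow> real \<Rightarrow> real" where
  "flat m t = (if t \<le> 0 then 0 else inverse t ^ m * exp (- inverse t))"

lemma tendsto_flat: "(flat m \<longlongrightarrow> 0) (at 0)"
proof (rule filterlim_split_at_real)
  have "(flat m \<longlongrightarrow> 0) (at_left 0) \<longleftrightarrow> ((\<lambda>_. 0::real) \<longlongrightarrow> 0) (at_left (0::real))"
    by (rule tendsto_cong) (auto simp: flat_def eventually_at_filter)
  then show "(flat m \<longlongrightarrow> 0) (at_left 0)"
    by simp
  have "((\<lambda>t. inverse t ^ m / exp (inverse t)) \<longlongrightarrow> (0::real)) (at_right 0)"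
    by (rule filterlim_compose[OF tendsto_power_div_exp_0 filterlim_inverse_at_top_right])
  moreover have "(flat m \<longlongrightarrow> 0) (at_right 0) \<longleftrightarrow>
      ((\<lambda>t. inverse t ^ m / exp (inverse t)) \<longlongrightarrow> (0::real)) (at_right 0)"
    by (rule tendsto_cong)
      (auto simp: flat_def eventually_at_filter exp_minus divide_inverse)
  ultimately show "(flat m \<longlongrightarrow> 0) (at_right 0)"
    by simp
qed

text \<open>At 0 the difference quotient of \<open>flat m\<close> is \<open>flat (m + 1)\<close>,
  which tends to 0, so the formula valid for positive \<open>t\<close> extends across the
  cut.\<close>

lemma flat_has_field_derivative:
  "(flat m has_field_derivative flat (m + 2) t - real m * flat (m + 1) t) (at t)"
proof -
  consider "t < 0" | "t = 0" | "t > 0" by linarith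
  then show ?thesis
  proof cases
    case 1
    have "((\<lambda>_. 0) has_field_derivative (flat (m + 2) t - real m * flat (m + 1) t)) (at t)"
      using 1 by (simp add: flat_def)
    then show ?thesis
      by (rule has_field_derivative_transform_within_open[of _ _ _ "{..<0}"])
        (use 1 in \<open>auto simp: flat_def\<close>)
  next
    case 2
    have "((\<lambda>h. (flat m (0 + h) - flat m 0) / h) \<longlongrightarrow> 0) (at 0) \<longleftrightarrow> (flat (m + 1) \<longlongrightarrow> 0) (at 0)"
      by (rule tendsto_cong) (auto simp: flat_def eventually_at_filter divide_inverse)
    then have "(flat m has_field_derivative 0) (at 0)"
      using tendsto_flat[of "m + 1"] by (simp add: DERIV_def)
    then show ?thesis
      using 2 by (simp add: flat_def)
  next
    case 3
    \<comment> \<open>For \<open>m = 0\<close> the truncated exponent \<open>m - 1\<close> does no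
      harm, since it is multiplied by \<open>real m\<close>.\<close>
    have "real m * inverse t ^ (m - 1) * (- (inverse t * inverse t)) * exp (- inverse t)
          + inverse t ^ m * (exp (- inverse t) * (inverse t * inverse t))
        = flat (m + 2) t - real m * flat (m + 1) t"
      using 3 by (cases m) (simp_all add: flat_def algebra_simps)
    moreover have "((\<lambda>t. inverse t ^ m * exp (- inverse t)) has_field_derivative
        (real m * inverse t ^ (m - 1) * (- (inverse t * inverse t)) * exp (- inverse t)
          + inverse t ^ m * (exp (- inverse t) * (inverse t * inverse t)))) (at t)"
      using 3 by (auto intro!: derivative_eq_intros)
    ultimately have "((\<lambda>t. inverse t ^ m * exp (- inverse t)) has_field_derivative
        (flat (m + 2) t - real m * flat (m + 1) t)) (at t)"
      by simp
    then show ?thesis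
      by (rule has_field_derivative_transform_within_open[of _ _ _ "{0<..}"])
        (use 3 in \<open>auto simp: flat_def\<close>)
  qed
qed

lemma flat_nonneg: "0 \<le> flat m t"
  by (simp add: flat_def)

text \<open>A syntactic algebra stable under partial derivatives, to which
  \<open>C_k_coinduct\<close> applies for all orders at once. All exponents \<open>m\<close> occur
  because differentiating \<open>flat m\<close> raises them; \<open>exp\<close> serves the
  saturation in \<open>bump_function_exists\<close>.\<close>

inductive_set smooth_closure :: "(real ^ 'n \<Rightarrow> real) set" where
  const: "(\<lambda>x. c) \<in> smooth_closure"
| coord: "(\<lambda>x. x $ i) \<in> smooth_closure"
| add: "p \<in> smooth_closure \<Longrightarrow> q \<in> smooth_closure \<Longrightarrow> (\<lambda>x. p x + q x) \<in> smooth_closure"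
| mult: "p \<in> smooth_closure \<Longrightarrow> q \<in> smooth_closure \<Longrightarrow> (\<lambda>x. p x * q x) \<in> smooth_closure"
| flat: "p \<in> smooth_closure \<Longrightarrow> (\<lambda>x. flat m (p x)) \<in> smooth_closure"
| exp: "p \<in> smooth_closure \<Longrightarrow> (\<lambda>x. exp (p x)) \<in> smooth_closure"

lemma smooth_closure_uminus: "p \<in> smooth_closure \<Longrightarrow> (\<lambda>x. - p x) \<in> smooth_closure"
  using mult[OF const[of "-1"]] by fastforce

lemma smooth_closure_diff:
  "p \<in> smooth_closure \<Longrightarrow> q \<in> smooth_closure \<Longrightarrow> (\<lambda>x. p x - q x) \<in> smooth_closure"
  using add[OF _ smooth_closure_uminus] by fastforce

lemma smooth_closure_sum:
  "(\<And>i. i \<in> I \<Longrightarrow> p i \<in> smooth_closure) \<Longrightarrow> (\<lambda>x. \<Sum>i\<in>I. p i x) \<in> smooth_closure"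
  by (induction I rule: infinite_finite_induct) (auto intro: smooth_closure.intros)

lemma smooth_closure_has_derivative:
  assumes "p \<in> smooth_closure"
  shows "\<exists>p'. (\<forall>x. (p has_derivative p' x) (at x)) \<and> (\<forall>v. (\<lambda>x. p' x v) \<in> smooth_closure)"
  using assms
proof induction
  case (const c)
  show ?case
    by (rule exI[of _ "\<lambda>x v. 0"]) (auto intro: smooth_closure.const)
next
  case (coord i)
  show ?case
    by (rule exI[of _ "\<lambda>x v. v $ i"])
      (auto intro!: smooth_closure.const bounded_linear.has_derivative[OF bounded_linear_vec_nth])
next
  case (add p q)
  then obtain p' q' where
    d: "\<And>x. (p has_derivative p' x) (at x)" "\<And>x. (q has_derivative q' x) (at x)"
    and s: "\<And>v. (\<lambda>x. p' x v) \<in> smooth_closure" "\<And>v. (\<lambda>x. q' x v) \<in> smooth_closure"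
    by metis
  show ?case
    by (rule exI[of _ "\<lambda>x v. p' x v + q' x v"])
      (auto intro!: smooth_closure.add s has_derivative_add d)
next
  case (mult p q)
  then obtain p' q' where
    d: "\<And>x. (p has_derivative p' x) (at x)" "\<And>x. (q has_derivative q' x) (at x)"
    and s: "\<And>v. (\<lambda>x. p' x v) \<in> smooth_closure" "\<And>v. (\<lambda>x. q' x v) \<in> smooth_closure"
    by metis
  show ?case
    by (rule exI[of _ "\<lambda>x v. p x * q' x v + p' x v * q x"])
      (auto intro!: smooth_closure.add smooth_closure.mult mult.hyps s has_derivative_mult d)
next
  case (flat p m)
  then obtain p' where
    d: "\<And>x. (p has_derivative p' x) (at x)" and s: "\<And>v. (\<lambda>x. p' x v) \<in> smooth_closure"
    by metis
  have "((\<lambda>x. flat m (p x)) has_derivative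
      (\<lambda>v. (flat (m + 2) (p x) - real m * flat (m + 1) (p x)) * p' x v)) (at x)" for x
    using has_derivative_compose[OF d[of x], of "flat m"] flat_has_field_derivative[of m "p x"]
    unfolding has_field_derivative_def by simp
  then show ?case
    by (intro exI[of _ "\<lambda>x v. (flat (m + 2) (p x) - real m * flat (m + 1) (p x)) * p' x v"])
      (auto intro!: smooth_closure.mult smooth_closure_diff smooth_closure.flat smooth_closure.const flat.hyps s)
next
  case (exp p)
  then obtain p' where
    d: "\<And>x. (p has_derivative p' x) (at x)" and s: "\<And>v. (\<lambda>x. p' x v) \<in> smooth_closure"
    by metis
  have "((\<lambda>x. exp (p x)) has_derivative (\<lambda>v. exp (p x) * p' x v)) (at x)" for x
    using has_derivative_compose[OF d[of x], of exp] DERIV_exp[of "p x"]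
    unfolding has_field_derivative_def by simp
  then show ?case
    by (intro exI[of _ "\<lambda>x v. exp (p x) * p' x v"])
      (auto intro!: smooth_closure.mult smooth_closure.exp exp.hyps s)
qed

lemma smooth_closure_C_k: "p \<in> smooth_closure \<Longrightarrow> C_k k p"
proof (erule C_k_coinduct)
  fix p :: "real ^ 'n \<Rightarrow> real" assume "p \<in> smooth_closure"
  then obtain p' where
    d: "\<And>x. (p has_derivative p' x) (at x)" and s: "\<And>v. (\<lambda>x. p' x v) \<in> smooth_closure"
    using smooth_closure_has_derivative by metis
  show "p differentiable (at x)" for x
    using d by (auto simp: differentiable_def)
  show "partial_deriv i p \<in> smooth_closure" for i
    using s[of "axis i 1"] partial_deriv_eq[OF d] by (simp add: partial_deriv_eq[OF d, abs_def])
qed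

section \<open>Support and linear structure of test functions\<close>

lemma test_functionsI:
  assumes "\<And>k. C_k k \<phi>" "compact S" "S \<subseteq> \<Omega>" "\<And>x. x \<notin> S \<Longrightarrow> \<phi> x = 0"
  shows "\<phi> \<in> test_functions \<Omega>"
proof -
  have "closure {x. \<phi> x \<noteq> 0} \<subseteq> S"
    using assms by (intro closure_minimal) (auto intro: compact_imp_closed)
  then show ?thesis
    using assms unfolding test_functions_def
    by (auto intro: bounded_subset simp: compact_eq_bounded_closed)
qed

lemma test_functionsE:
  assumes "\<phi> \<in> test_functions \<Omega>"
  obtains S where "compact S" "S \<subseteq> \<Omega>" "\<And>x. x \<notin> S \<Longrightarrow> \<phi> x = 0"
proof
  show "compact (closure {x. \<phi> x \<noteq> 0})" "closure {x. \<phi> x \<noteq> 0} \<subseteq> \<Omega>"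
    using assms by (auto simp: test_functions_def)
  show "\<phi> x = 0" if "x \<notin> closure {x. \<phi> x \<noteq> 0}" for x
    using that closure_subset[of "{x. \<phi> x \<noteq> 0}"] by auto
qed

lemma test_function_C_k: "\<phi> \<in> test_functions \<Omega> \<Longrightarrow> C_k k \<phi>"
  by (simp add: test_functions_def)

lemma test_function_differentiable: "\<phi> \<in> test_functions \<Omega> \<Longrightarrow> \<phi> differentiable (at x)"
  using test_function_C_k[of \<phi> \<Omega> "Suc 0"] by simp

lemma continuous_on_test_function: "\<phi> \<in> test_functions \<Omega> \<Longrightarrow> continuous_on S \<phi>"
  using test_function_C_k[of \<phi> \<Omega> 0] by (auto intro: continuous_on_subset)

lemma continuous_on_partial_deriv: "\<phi> \<in> test_functions \<Omega> \<Longrightarrow> continuous_on S (partial_deriv i \<phi>)"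
  using test_function_C_k[of \<phi> \<Omega> "Suc 0"] by (auto intro: continuous_on_subset)

lemma partial_deriv_lincomb:
  assumes "\<And>x. \<phi> differentiable (at x)" "\<And>x. \<psi> differentiable (at x)"
  shows "partial_deriv i (\<lambda>x. a * \<phi> x + b * \<psi> x) = (\<lambda>x. a * partial_deriv i \<phi> x + b * partial_deriv i \<psi> x)"
proof
  fix x
  have "((\<lambda>x. a * \<phi> x + b * \<psi> x) has_derivative
      (\<lambda>v. a * frechet_derivative \<phi> (at x) v + b * frechet_derivative \<psi> (at x) v)) (at x)"
    using assms frechet_derivative_works
    by (intro has_derivative_add has_derivative_mult_right) blast+
  then show "partial_deriv i (\<lambda>x. a * \<phi> x + b * \<psi> x) x = a * partial_deriv i \<phi> x + b * partial_deriv i \<psi> x"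
    by (simp add: partial_deriv_eq) (simp add: partial_deriv_def)
qed

lemma C_k_lincomb: "C_k k \<phi> \<Longrightarrow> C_k k \<psi> \<Longrightarrow> C_k k (\<lambda>x. a * \<phi> x + b * \<psi> x)"
proof (induction k arbitrary: \<phi> \<psi>)
  case 0
  then show ?case
    by (auto intro!: continuous_intros)
next
  case (Suc k)
  have "partial_deriv i (\<lambda>x. a * \<phi> x + b * \<psi> x)
      = (\<lambda>x. a * partial_deriv i \<phi> x + b * partial_deriv i \<psi> x)" for i
    by (rule partial_deriv_lincomb) (use Suc.prems in auto)
  then show ?case
    using Suc.prems Suc.IH by (simp add: differentiable_add differentiable_cmult_left_iff)
qed

lemma test_functions_lincomb:
  assumes "\<phi> \<in> test_functions \<Omega>" "\<psi> \<in> test_functions \<Omega>"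
  shows "(\<lambda>x. a * \<phi> x + b * \<psi> x) \<in> test_functions \<Omega>"
proof -
  obtain S where S: "compact S" "S \<subseteq> \<Omega>" "\<And>x. x \<notin> S \<Longrightarrow> \<phi> x = 0"
    using assms(1) by (metis test_functionsE)
  obtain T where T: "compact T" "T \<subseteq> \<Omega>" "\<And>x. x \<notin> T \<Longrightarrow> \<psi> x = 0"
    using assms(2) by (metis test_functionsE)
  show ?thesis
  proof (rule test_functionsI[of _ "S \<union> T"])
    show "C_k k (\<lambda>x. a * \<phi> x + b * \<psi> x)" for k
      using assms by (intro C_k_lincomb) (simp_all add: test_function_C_k)
  qed (use S T in auto)
qed

text \<open>A finite sum \<open>p\<close> of radial bumps is positive on \<open>K\<close> and
  vanishes off finitely many balls in \<open>U\<close>; \<open>1 - exp (- n * p)\<close> with large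
  \<open>n\<close> saturates it. Reaching \<open>1 - e\<close> in place of 1 avoids a division by
  \<open>p\<close> and is enough for density.\<close>

lemma bump_function_exists:
  assumes "compact K" "open U" "K \<subseteq> U" and "0 < e"
  shows "\<exists>\<phi> \<in> test_functions U. (\<forall>x. 0 \<le> \<phi> x \<and> \<phi> x \<le> 1) \<and> (\<forall>x \<in> K. 1 - e \<le> \<phi> x)"
proof -
  obtain r where r: "\<And>x. x \<in> K \<Longrightarrow> 0 < r x" "\<And>x. x \<in> K \<Longrightarrow> cball x (r x) \<subseteq> U"
    using assms by (metis open_contains_cball subsetD)
  have cov: "K \<subseteq> (\<Union>x\<in>K. ball x (r x))"
    using r by auto
  obtain P where P: "P \<subseteq> K" "finite P" "K \<subseteq> (\<Union>x\<in>P. ball x (r x))"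
    by (rule compactE_image[OF assms(1) _ cov]) auto
  define p where "p = (\<lambda>x. \<Sum>c\<in>P. flat 0 ((r c)\<^sup>2 - (\<Sum>i\<in>UNIV. (x $ i - c $ i) * (x $ i - c $ i))))"
  have n2: "(\<Sum>i\<in>UNIV. (x $ i - c $ i) * (x $ i - c $ i)) = (dist x c)\<^sup>2" for x c :: "real ^ 'n"
    by (simp add: dist_norm power2_norm_eq_inner inner_vec_def)
  have psm: "p \<in> smooth_closure"
    unfolding p_def by (intro smooth_closure_sum smooth_closure.flat smooth_closure_diff
        smooth_closure.const smooth_closure.mult smooth_closure.coord)
  have p0: "0 \<le> p x" for x
    unfolding p_def by (intro sum_nonneg flat_nonneg)
  have ppos: "0 < p x" if x: "x \<in> K" for x
  proof -
    obtain c where c: "c \<in> P" "dist x c < r c"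
      using P x by (auto simp: dist_commute)
    then have "(dist x c)\<^sup>2 < (r c)\<^sup>2"
      by (intro power_strict_mono) auto
    then have "0 < flat 0 ((r c)\<^sup>2 - (\<Sum>i\<in>UNIV. (x $ i - c $ i) * (x $ i - c $ i)))"
      by (simp add: n2 flat_def)
    also have "\<dots> \<le> p x"
      unfolding p_def by (intro member_le_sum c P flat_nonneg)
    finally show ?thesis .
  qed
  \<comment> \<open>Closed balls inside \<open>U\<close>, so that their finite union is a compact
    support.\<close>
  define S where "S = (\<Union>c\<in>P. cball c (r c))"
  have pS: "p x = 0" if "x \<notin> S" for x
  proof -
    have "flat 0 ((r c)\<^sup>2 - (dist x c)\<^sup>2) = 0" if c: "c \<in> P" for c
    proof -
      have "r c < dist x c"
        using \<open>x \<notin> S\<close> c by (auto simp: S_def dist_commute)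
      then have "(r c)\<^sup>2 \<le> (dist x c)\<^sup>2"
        using r(1)[of c] c P by (intro power_mono) auto
      then show ?thesis
        by (simp add: flat_def)
    qed
    then show ?thesis
      by (simp add: p_def n2)
  qed
  have contp: "continuous_on K p"
    using smooth_closure_C_k[OF psm, of 0] by (auto intro: continuous_on_subset)
  obtain m where m: "0 < m" "\<And>x. x \<in> K \<Longrightarrow> m \<le> p x"
  proof (cases "K = {}")
    case False
    obtain x where "x \<in> K" "\<And>y. y \<in> K \<Longrightarrow> p x \<le> p y"
      using continuous_attains_inf[OF assms(1) False contp] by metis
    then show ?thesis
      using that ppos by metis
  qed (use that[of 1] in auto)
  \<comment> \<open>With \<open>p x \<ge> m\<close> on \<open>K\<close>, the estimate
    \<open>exp t \<ge> t\<close> gives \<open>exp (- n * p x) \<le> 1 / (n * m) < e\<close>.\<close>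
  obtain n :: nat where n: "1 < real n * (m * e)"
    using ex_less_of_nat_mult[of "m * e" 1] m assms by (metis mult_pos_pos)
  define \<phi> where "\<phi> = (\<lambda>x. 1 - exp (- (real n * p x)))"
  have \<phi>sm: "\<phi> \<in> smooth_closure"
    unfolding \<phi>_def by (intro smooth_closure_diff smooth_closure.const smooth_closure.exp
        smooth_closure_uminus smooth_closure.mult psm)
  show ?thesis
  proof (intro bexI[of _ \<phi>] conjI allI ballI)
    show "0 \<le> \<phi> x" "\<phi> x \<le> 1" for x
      using p0[of x] by (auto simp: \<phi>_def)
    show "1 - e \<le> \<phi> x" if x: "x \<in> K" for x
    proof -
      have "1 \<le> n * (p x * e)"
        using n m(2)[OF x] assms
        by (meson less_imp_le mult_left_mono mult_right_mono of_nat_0_le_iff order_trans)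
      also have "\<dots> = (n * p x) * e"
        by simp
      also have "\<dots> \<le> exp (n * p x) * e"
        using assms(4) by (intro mult_right_mono order_trans[OF _ exp_ge_add_one_self]) auto
      finally have "exp (- (real n * p x)) \<le> e"
        by (simp add: exp_minus field_simps)
      then show ?thesis
        by (simp add: \<phi>_def)
    qed
    show "\<phi> \<in> test_functions U"
    proof (rule test_functionsI[of _ S])
      show "compact S"
        using P by (simp add: S_def compact_UN)
      show "S \<subseteq> U"
        using P(1) r(2) unfolding S_def by blast
      show "\<phi> x = 0" if "x \<notin> S" for x
        using pS[OF that] by (simp add: \<phi>_def)
    qed (use smooth_closure_C_k[OF \<phi>sm] in auto)
  qed
qed

section \<open>Density of test functions and uniqueness of weak gradients\<close>

lemma compact_support_bounded:
  fixes \<phi> :: "'a::topological_space \<Rightarrow> real"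
  assumes "compact S" "continuous_on S \<phi>" "\<And>x. x \<notin> S \<Longrightarrow> \<phi> x = 0"
  shows "\<exists>B\<ge>0. \<forall>x. \<bar>\<phi> x\<bar> \<le> B"
proof -
  obtain b where b: "\<And>x. x \<in> S \<Longrightarrow> norm (\<phi> x) \<le> b"
    using compact_imp_bounded[OF compact_continuous_image[OF assms(2,1)]] by (auto simp: bounded_iff)
  have "\<bar>\<phi> x\<bar> \<le> max 0 b" for x
    using b[of x] assms(3)[of x] by (cases "x \<in> S") auto
  then show ?thesis
    by (intro exI[of _ "max 0 b"]) auto
qed

lemma test_function_bounded: "\<phi> \<in> test_functions \<Omega> \<Longrightarrow> \<exists>B\<ge>0. \<forall>x. \<bar>\<phi> x\<bar> \<le> B"
  by (meson test_functionsE compact_support_bounded continuous_on_test_function)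

lemma partial_deriv_zero_outside:
  assumes "closed S" "\<And>x. x \<notin> S \<Longrightarrow> \<phi> x = 0" "x \<notin> S"
  shows "partial_deriv i \<phi> x = 0"
proof -
  have "(\<phi> has_derivative (\<lambda>v. 0)) (at x)"
    by (rule has_derivative_transform_within_open[of "\<lambda>_. 0" _ _ _ "- S"]) (use assms in auto)
  then show ?thesis
    by (simp add: partial_deriv_eq)
qed

lemma partial_deriv_bounded:
  assumes \<phi>: "\<phi> \<in> test_functions \<Omega>"
  shows "\<exists>B\<ge>0. \<forall>x. \<bar>partial_deriv i \<phi> x\<bar> \<le> B"
proof -
  obtain S where S: "compact S" "\<And>x. x \<notin> S \<Longrightarrow> \<phi> x = 0"
    using \<phi> by (metis test_functionsE)
  then have "partial_deriv i \<phi> x = 0" if "x \<notin> S" for x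
    using that by (intro partial_deriv_zero_outside[of S]) (auto intro: compact_imp_closed)
  then show ?thesis
    using S(1) \<phi> by (intro compact_support_bounded[of S] continuous_on_partial_deriv)
qed

lemma finite_measure_lebesgue_on_bounded:
  fixes \<Omega> :: "(real ^ 'n) set"
  assumes "bounded \<Omega>" "open \<Omega>"
  shows "finite_measure (lebesgue_on \<Omega>)"
  using assms by (intro finite_measure_lebesgue_on lmeasurable_open)

lemma borel_measurable_lebesgue_on_continuous:
  fixes \<phi> :: "real ^ 'n \<Rightarrow> 'b::euclidean_space"
  assumes "open \<Omega>" "continuous_on \<Omega> \<phi>"
  shows "\<phi> \<in> borel_measurable (lebesgue_on \<Omega>)"
  using assms by (intro continuous_imp_measurable_on_sets_lebesgue) auto

lemma integrable_lebesgue_on_const_bound: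
  fixes q :: "real ^ 'n \<Rightarrow> real"
  assumes "bounded \<Omega>" "open \<Omega>" "q \<in> borel_measurable (lebesgue_on \<Omega>)"
    "AE x in lebesgue_on \<Omega>. \<bar>q x\<bar> \<le> C"
  shows "integrable (lebesgue_on \<Omega>) q"
  using finite_measure.integrable_const_bound[OF finite_measure_lebesgue_on_bounded[OF assms(1,2)], of q C]
    assms(3,4) by simp

lemma integrable_test_function:
  assumes "bounded \<Omega>" "open \<Omega>" "\<phi> \<in> test_functions \<Omega>"
  shows "integrable (lebesgue_on \<Omega>) \<phi>"
proof -
  obtain B where "\<And>x. \<bar>\<phi> x\<bar> \<le> B"
    using test_function_bounded[OF assms(3)] by auto
  then show ?thesis
    by (intro integrable_lebesgue_on_const_bound assms borel_measurable_lebesgue_on_continuous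
        continuous_on_test_function[OF assms(3)]) auto
qed

lemma integrable_partial_deriv:
  assumes "bounded \<Omega>" "open \<Omega>" "\<phi> \<in> test_functions \<Omega>"
  shows "integrable (lebesgue_on \<Omega>) (partial_deriv i \<phi>)"
proof -
  obtain B where "\<And>x. \<bar>partial_deriv i \<phi> x\<bar> \<le> B"
    using partial_deriv_bounded[OF assms(3)] by blast
  then show ?thesis
    by (intro integrable_lebesgue_on_const_bound assms borel_measurable_lebesgue_on_continuous
        continuous_on_partial_deriv[OF assms(3)]) auto
qed

lemma integrable_mult_AE_bounded:
  fixes q h :: "'a \<Rightarrow> real"
  assumes "q \<in> borel_measurable M" "AE x in M. \<bar>q x\<bar> \<le> C" "integrable M h"
  shows "integrable M (\<lambda>x. q x * h x)"
proof (rule Bochner_Integration.integrable_bound)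
  show "integrable M (\<lambda>x. C * h x)"
    using assms(3) by simp
  show "AE x in M. norm (q x * h x) \<le> norm (C * h x)"
    using assms(2) by eventually_elim (auto simp: abs_mult intro!: mult_right_mono)
qed (use assms in measurable)

lemma abs_integral_mult_le:
  fixes q h :: "'a \<Rightarrow> real"
  assumes "q \<in> borel_measurable M" "AE x in M. \<bar>q x\<bar> \<le> C" "integrable M h"
  shows "\<bar>\<integral>x. q x * h x \<partial>M\<bar> \<le> C * (\<integral>x. \<bar>h x\<bar> \<partial>M)"
proof -
  have "\<bar>\<integral>x. q x * h x \<partial>M\<bar> \<le> (\<integral>x. \<bar>q x * h x\<bar> \<partial>M)"
    using integral_norm_bound[of M "\<lambda>x. q x * h x"] by simp
  also have "\<dots> \<le> (\<integral>x. C * \<bar>h x\<bar> \<partial>M)"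
  proof (rule integral_mono_AE)
    show "AE x in M. \<bar>q x * h x\<bar> \<le> C * \<bar>h x\<bar>"
      using assms(2) by eventually_elim (auto simp: abs_mult intro!: mult_right_mono)
  qed (use assms integrable_mult_AE_bounded[OF assms] in auto)
  finally show ?thesis
    by simp
qed

text \<open>Regularity squeezes \<open>A\<close> between a closed \<open>K\<close> and an open
  \<open>T\<close>. A bump for \<open>K\<close> supported in \<open>T \<inter> \<Omega>\<close> errs
  by at most 1 on \<open>T - A\<close> and on \<open>A - K\<close>, and by at most \<open>d\<close>
  on \<open>K\<close>: three contributions below \<open>e / 3\<close>.\<close>

lemma indicator_approx_test_function:
  fixes \<Omega> :: "(real ^ 'n) set"
  assumes \<Omega>: "bounded \<Omega>" "open \<Omega>" and A: "A \<in> sets lebesgue" "A \<subseteq> \<Omega>" and "0 < e"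
  shows "\<exists>\<phi> \<in> test_functions \<Omega>. (LINT x|lebesgue_on \<Omega>. \<bar>indicator A x - \<phi> x\<bar>) < e"
proof -
  interpret finite_measure "lebesgue_on \<Omega>"
    by (rule finite_measure_lebesgue_on_bounded[OF \<Omega>])
  have e3: "0 < e / 3"
    using assms by simp
  obtain T where T: "open T" "A \<subseteq> T" "T - A \<in> lmeasurable" "emeasure lebesgue (T - A) < ennreal (e / 3)"
    using sets_lebesgue_outer_open[OF A(1) e3] by metis
  obtain K where K: "closed K" "K \<subseteq> A" "A - K \<in> lmeasurable" "emeasure lebesgue (A - K) < ennreal (e / 3)"
    using sets_lebesgue_inner_closed[OF A(1) e3] by metis
  have "bounded K"
    using \<Omega> K A by (meson bounded_subset)
  then have cK: "compact K"
    using K by (simp add: compact_eq_bounded_closed)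
  define m where "m = measure lebesgue \<Omega>"
  \<comment> \<open>The summand 1 keeps the denominator positive when \<open>m\<close> is 0.\<close>
  define d where "d = e / (3 * (m + 1))"
  have m0: "0 \<le> m"
    by (simp add: m_def)
  then have d: "0 < d" "d * m < e / 3"
    using assms by (auto simp: d_def field_simps)
  obtain \<phi> where \<phi>: "\<phi> \<in> test_functions (T \<inter> \<Omega>)" "\<And>x. 0 \<le> \<phi> x" "\<And>x. \<phi> x \<le> 1" "\<And>x. x \<in> K \<Longrightarrow> 1 - d \<le> \<phi> x"
    using bump_function_exists[OF cK, of "T \<inter> \<Omega>" d] open_Int[OF T(1) \<Omega>(2)] K(2) T(2) A(2) d(1) by blast
  have \<phi>\<Omega>: "\<phi> \<in> test_functions \<Omega>"
    using \<phi>(1) by (auto simp: test_functions_def)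
  obtain S where S: "S \<subseteq> T \<inter> \<Omega>" "\<And>x. x \<notin> S \<Longrightarrow> \<phi> x = 0"
    using \<phi>(1) by (metis test_functionsE)
  then have \<phi>0: "\<phi> x = 0" if "x \<notin> T" for x
    using that by blast
  have sA[measurable]: "A \<in> sets (lebesgue_on \<Omega>)" "(T - A) \<inter> \<Omega> \<in> sets (lebesgue_on \<Omega>)" "A - K \<in> sets (lebesgue_on \<Omega>)"
    using A \<Omega> fmeasurableD[OF T(3)] fmeasurableD[OF K(3)] by (auto simp: sets_restrict_space_iff)
  have mT: "measure (lebesgue_on \<Omega>) ((T - A) \<inter> \<Omega>) < e / 3"
  proof -
    have "measure (lebesgue_on \<Omega>) ((T - A) \<inter> \<Omega>) = measure lebesgue ((T - A) \<inter> \<Omega>)"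
      using \<Omega> by (intro measure_restrict_space) auto
    also have "\<dots> \<le> measure lebesgue (T - A)"
      using \<Omega>(2) T(3) by (intro measure_mono_fmeasurable sets.Int) (simp_all add: fmeasurableD)
    also have "\<dots> < e / 3"
      using T(3,4) e3 by (simp add: emeasure_eq_measure2 ennreal_less_iff)
    finally show ?thesis .
  qed
  have mK: "measure (lebesgue_on \<Omega>) (A - K) < e / 3"
  proof -
    have "measure (lebesgue_on \<Omega>) (A - K) = measure lebesgue (A - K)"
      using \<Omega> A by (intro measure_restrict_space) auto
    also have "\<dots> < e / 3"
      using K(3,4) e3 by (simp add: emeasure_eq_measure2 ennreal_less_iff)
    finally show ?thesis .
  qed
  have m\<Omega>: "measure (lebesgue_on \<Omega>) \<Omega> = m"
    using \<Omega> unfolding m_def by (intro measure_restrict_space) auto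
  have int: "integrable (lebesgue_on \<Omega>) (indicator B :: _ \<Rightarrow> real)" if "B \<in> sets (lebesgue_on \<Omega>)" for B
    using that by (intro integrable_real_indicator) (simp_all add: less_top[symmetric] emeasure_finite)
  have [simp]: "space (lebesgue_on \<Omega>) = \<Omega>"
    by (simp add: space_restrict_space)
  have "(LINT x|lebesgue_on \<Omega>. \<bar>indicator A x - \<phi> x\<bar>) \<le>
      (LINT x|lebesgue_on \<Omega>. indicator ((T - A) \<inter> \<Omega>) x + indicator (A - K) x + d)"
  proof (rule integral_mono)
    show "integrable (lebesgue_on \<Omega>) (\<lambda>x. \<bar>indicator A x - \<phi> x\<bar>)"
      using integrable_test_function[OF \<Omega> \<phi>\<Omega>] by (intro integrable_abs Bochner_Integration.integrable_diff int sA)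
    show "\<bar>indicator A x - \<phi> x\<bar> \<le> indicator ((T - A) \<inter> \<Omega>) x + indicator (A - K) x + d"
      if "x \<in> space (lebesgue_on \<Omega>)" for x
      using that \<phi>(2-4)[of x] \<phi>0[of x] d K(2) A(2) T(2) by (auto simp: indicator_def)
  qed (intro Bochner_Integration.integrable_add integrable_const int sA)
  also have "\<dots> = measure (lebesgue_on \<Omega>) ((T - A) \<inter> \<Omega>) + measure (lebesgue_on \<Omega>) (A - K) + d * m"
    using int[OF sA(2)] int[OF sA(3)] sets.sets_into_space[OF sA(3)]
    by (simp add: m\<Omega> Int_absorb2)
  also have "\<dots> < e"
    using mT mK d by simp
  finally show ?thesis
    using \<phi>\<Omega> by blast
qed

lemma test_functions_dense:
  fixes h :: "real ^ 'n \<Rightarrow> real"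
  assumes \<Omega>: "bounded \<Omega>" "open \<Omega>" and "integrable (lebesgue_on \<Omega>) h" "0 < e"
  shows "\<exists>\<phi> \<in> test_functions \<Omega>. (LINT x|lebesgue_on \<Omega>. \<bar>h x - \<phi> x\<bar>) < e"
  using assms(3,4)
proof (induction h arbitrary: e rule: integrable_induct)
  case (base A c)
  have A: "A \<in> sets lebesgue" "A \<subseteq> \<Omega>"
    using base \<Omega> by (auto simp: sets_restrict_space_iff)
  obtain \<phi> where \<phi>: "\<phi> \<in> test_functions \<Omega>"
      "(LINT x|lebesgue_on \<Omega>. \<bar>indicator A x - \<phi> x\<bar>) < e / (\<bar>c\<bar> + 1)"
    using indicator_approx_test_function[OF \<Omega> A, of "e / (\<bar>c\<bar> + 1)"] base by auto
  have "(LINT x|lebesgue_on \<Omega>. \<bar>indicator A x *\<^sub>R c - (c * \<phi> x + 0 * \<phi> x)\<bar>)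
      = (LINT x|lebesgue_on \<Omega>. \<bar>c\<bar> * \<bar>indicator A x - \<phi> x\<bar>)"
    by (rule Bochner_Integration.integral_cong) (auto simp: abs_mult[symmetric] algebra_simps)
  also have "\<dots> = \<bar>c\<bar> * (LINT x|lebesgue_on \<Omega>. \<bar>indicator A x - \<phi> x\<bar>)"
    by simp
  also have "\<dots> \<le> \<bar>c\<bar> * (e / (\<bar>c\<bar> + 1))"
    using \<phi>(2) by (intro mult_left_mono) auto
  also have "\<dots> < e"
    using \<open>0 < e\<close> by (simp add: field_simps)
  finally show ?case
    using test_functions_lincomb[OF \<phi>(1) \<phi>(1), of c 0] by (rule bexI)
next
  case (add f g)
  then have "0 < e / 2"
    by simp
  then obtain \<phi> \<psi> where t: "\<phi> \<in> test_functions \<Omega>" "\<psi> \<in> test_functions \<Omega>"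
    and l: "(LINT x|lebesgue_on \<Omega>. \<bar>f x - \<phi> x\<bar>) < e / 2" "(LINT x|lebesgue_on \<Omega>. \<bar>g x - \<psi> x\<bar>) < e / 2"
    using add.IH(1)[of "e / 2"] add.IH(2)[of "e / 2"] by blast
  note i = integrable_test_function[OF \<Omega> t(1)] integrable_test_function[OF \<Omega> t(2)] add.hyps
  have "(LINT x|lebesgue_on \<Omega>. \<bar>(f x + g x) - (1 * \<phi> x + 1 * \<psi> x)\<bar>)
      \<le> (LINT x|lebesgue_on \<Omega>. \<bar>f x - \<phi> x\<bar> + \<bar>g x - \<psi> x\<bar>)"
    using i by (intro integral_mono) auto
  also have "\<dots> = (LINT x|lebesgue_on \<Omega>. \<bar>f x - \<phi> x\<bar>) + (LINT x|lebesgue_on \<Omega>. \<bar>g x - \<psi> x\<bar>)"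
    using i by (intro Bochner_Integration.integral_add) auto
  also have "\<dots> < e"
    using l by simp
  finally show ?case
    using test_functions_lincomb[OF t, of 1 1] by (rule bexI)
next
  case (lim f s)
  \<comment> \<open>The approximants supplied by the induction rule are bounded by
    \<open>2 * \<bar>f x\<bar>\<close>, whence the dominating function with factor 3.\<close>
  have "(\<lambda>i. LINT x|lebesgue_on \<Omega>. \<bar>f x - s i x\<bar>) \<longlonglongrightarrow> (LINT x|lebesgue_on \<Omega>. 0)"
  proof (rule integral_dominated_convergence[where w = "\<lambda>x. 3 * \<bar>f x\<bar>"])
    show "AE x in lebesgue_on \<Omega>. (\<lambda>i. \<bar>f x - s i x\<bar>) \<longlonglongrightarrow> 0"
    proof (rule AE_I2)
      fix x assume "x \<in> space (lebesgue_on \<Omega>)"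
      from tendsto_rabs[OF tendsto_diff[OF tendsto_const lim.hyps(2)[OF this]], of "f x"]
      show "(\<lambda>i. \<bar>f x - s i x\<bar>) \<longlonglongrightarrow> 0"
        by simp
    qed
    show "AE x in lebesgue_on \<Omega>. norm \<bar>f x - s i x\<bar> \<le> 3 * \<bar>f x\<bar>" for i
    proof (rule AE_I2)
      fix x assume "x \<in> space (lebesgue_on \<Omega>)"
      from lim.hyps(3)[OF this, of i] show "norm \<bar>f x - s i x\<bar> \<le> 3 * \<bar>f x\<bar>"
        by simp
    qed
  qed (use lim in auto)
  then have "\<forall>\<^sub>F i in sequentially. (LINT x|lebesgue_on \<Omega>. \<bar>f x - s i x\<bar>) < e / 2"
    using \<open>0 < e\<close> by (intro order_tendstoD) auto
  then obtain i where i: "(LINT x|lebesgue_on \<Omega>. \<bar>f x - s i x\<bar>) < e / 2"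
    by (auto simp: eventually_sequentially)
  obtain \<phi> where t: "\<phi> \<in> test_functions \<Omega>" and l: "(LINT x|lebesgue_on \<Omega>. \<bar>s i x - \<phi> x\<bar>) < e / 2"
    using lim.IH[of "e / 2" i] \<open>0 < e\<close> by auto
  note int = integrable_test_function[OF \<Omega> t] lim
  have "(LINT x|lebesgue_on \<Omega>. \<bar>f x - \<phi> x\<bar>)
      \<le> (LINT x|lebesgue_on \<Omega>. \<bar>f x - s i x\<bar> + \<bar>s i x - \<phi> x\<bar>)"
    using int by (intro integral_mono) auto
  also have "\<dots> = (LINT x|lebesgue_on \<Omega>. \<bar>f x - s i x\<bar>) + (LINT x|lebesgue_on \<Omega>. \<bar>s i x - \<phi> x\<bar>)"
    using int by (intro Bochner_Integration.integral_add) auto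
  also have "\<dots> < e"
    using i l by simp
  finally show ?case
    using t by blast
qed

text \<open>By density of test functions. The a priori bound \<open>C\<close> on \<open>q\<close>
  only multiplies the approximation error, so the constant \<open>B\<close>, possibly much smaller
  than \<open>C\<close>, survives in the limit.\<close>

lemma Linf_pairing_bound:
  fixes q h :: "real ^ 'n \<Rightarrow> real"
  assumes \<Omega>: "bounded \<Omega>" "open \<Omega>"
    and q: "q \<in> borel_measurable (lebesgue_on \<Omega>)" "AE x in lebesgue_on \<Omega>. \<bar>q x\<bar> \<le> C"
    and B: "\<And>\<phi>. \<phi> \<in> test_functions \<Omega> \<Longrightarrow>
      \<bar>LINT x|lebesgue_on \<Omega>. q x * \<phi> x\<bar> \<le> B * (LINT x|lebesgue_on \<Omega>. \<bar>\<phi> x\<bar>)" "0 \<le> B"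
    and h: "integrable (lebesgue_on \<Omega>) h"
  shows "\<bar>LINT x|lebesgue_on \<Omega>. q x * h x\<bar> \<le> B * (LINT x|lebesgue_on \<Omega>. \<bar>h x\<bar>)"
proof (rule field_le_epsilon)
  fix e :: real assume "0 < e"
  define d where "d = e / (B + \<bar>C\<bar> + 1)"
  have d: "0 < d" "(B + \<bar>C\<bar>) * d \<le> e"
    using \<open>0 < e\<close> B by (auto simp: d_def field_simps)
  obtain \<phi> where t: "\<phi> \<in> test_functions \<Omega>" and l: "(LINT x|lebesgue_on \<Omega>. \<bar>h x - \<phi> x\<bar>) < d"
    using test_functions_dense[OF \<Omega> h d(1)] by blast
  note i = integrable_test_function[OF \<Omega> t]
  have q': "AE x in lebesgue_on \<Omega>. \<bar>q x\<bar> \<le> \<bar>C\<bar>"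
    using q(2) by eventually_elim auto
  have "(LINT x|lebesgue_on \<Omega>. q x * h x) =
      (LINT x|lebesgue_on \<Omega>. q x * \<phi> x) + (LINT x|lebesgue_on \<Omega>. q x * (h x - \<phi> x))"
    using integrable_mult_AE_bounded[OF q i] integrable_mult_AE_bounded[OF q, of "\<lambda>x. h x - \<phi> x"] i h
    by (subst Bochner_Integration.integral_add[symmetric]) (auto simp: algebra_simps)
  moreover have "\<bar>LINT x|lebesgue_on \<Omega>. q x * (h x - \<phi> x)\<bar> \<le> \<bar>C\<bar> * d"
    using abs_integral_mult_le[OF q(1) q', of "\<lambda>x. h x - \<phi> x"] i h l
      mult_left_mono[OF less_imp_le[OF l], of "\<bar>C\<bar>"] by auto
  moreover have "(LINT x|lebesgue_on \<Omega>. \<bar>\<phi> x\<bar>) \<le> (LINT x|lebesgue_on \<Omega>. \<bar>h x\<bar>) + d"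
  proof -
    have "(LINT x|lebesgue_on \<Omega>. \<bar>\<phi> x\<bar>) \<le> (LINT x|lebesgue_on \<Omega>. \<bar>h x\<bar> + \<bar>h x - \<phi> x\<bar>)"
      using i h by (intro integral_mono) auto
    also have "\<dots> = (LINT x|lebesgue_on \<Omega>. \<bar>h x\<bar>) + (LINT x|lebesgue_on \<Omega>. \<bar>h x - \<phi> x\<bar>)"
      using i h by (intro Bochner_Integration.integral_add) auto
    finally show ?thesis
      using l by simp
  qed
  then have "B * (LINT x|lebesgue_on \<Omega>. \<bar>\<phi> x\<bar>) \<le> B * (LINT x|lebesgue_on \<Omega>. \<bar>h x\<bar>) + B * d"
    using mult_left_mono[OF _ B(2)] by (fastforce simp: distrib_left[symmetric])
  ultimately show "\<bar>LINT x|lebesgue_on \<Omega>. q x * h x\<bar> \<le> B * (LINT x|lebesgue_on \<Omega>. \<bar>h x\<bar>) + e"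
    using B(1)[OF t] d(2) by (simp add: distrib_right)
qed

text \<open>On a bounded domain \<open>q\<close> is itself integrable, so the pairing bound with
  \<open>B = 0\<close> may be tested with \<open>h = q\<close> and yields a vanishing integral of
  \<open>q x * q x\<close>.\<close>

lemma AE_zero_if_pairing_zero:
  fixes q :: "real ^ 'n \<Rightarrow> real"
  assumes \<Omega>: "bounded \<Omega>" "open \<Omega>"
    and q: "q \<in> borel_measurable (lebesgue_on \<Omega>)" "AE x in lebesgue_on \<Omega>. \<bar>q x\<bar> \<le> C"
    and 0: "\<And>\<phi>. \<phi> \<in> test_functions \<Omega> \<Longrightarrow> (LINT x|lebesgue_on \<Omega>. q x * \<phi> x) = 0"
  shows "AE x in lebesgue_on \<Omega>. q x = 0"
proof -
  have i: "integrable (lebesgue_on \<Omega>) q"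
    by (rule integrable_lebesgue_on_const_bound[OF \<Omega> q])
  have "(LINT x|lebesgue_on \<Omega>. q x * q x) = 0"
    using Linf_pairing_bound[OF \<Omega> q _ _ i, of 0] 0 by (simp add: order_antisym)
  then show ?thesis
    using integral_nonneg_eq_0_iff_AE[OF integrable_mult_AE_bounded[OF q i]] by simp
qed

lemma Linf_component:
  fixes g :: "real ^ 'n \<Rightarrow> real ^ 'm"
  assumes "g \<in> Linf \<Omega>"
  shows "\<exists>C\<ge>0. \<forall>i. (\<lambda>x. g x $ i) \<in> borel_measurable (lebesgue_on \<Omega>) \<and>
    (AE x in lebesgue_on \<Omega>. \<bar>g x $ i\<bar> \<le> C)"
proof -
  obtain C where m: "g \<in> borel_measurable (lebesgue_on \<Omega>)" and C: "AE x in lebesgue_on \<Omega>. norm (g x) \<le> C"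
    using assms by (auto simp: Linf_def)
  show ?thesis
  proof (intro exI[of _ "max 0 C"] conjI allI)
    show "(\<lambda>x. g x $ i) \<in> borel_measurable (lebesgue_on \<Omega>)" for i
      by (rule measurable_compose[OF m]) (intro borel_measurable_continuous_onI continuous_intros)
    show "AE x in lebesgue_on \<Omega>. \<bar>g x $ i\<bar> \<le> max 0 C" for i
      using C by eventually_elim (meson component_le_norm_cart max.coboundedI2 order_trans)
  qed simp
qed

text \<open>Since \<open>weak_gradient\<close> is an arbitrary choice, this is what lets a gradient
  computed by hand replace it under the essential supremum.\<close>

lemma has_Linf_weak_gradient_unique:
  fixes u :: "real ^ 'n \<Rightarrow> real"
  assumes \<Omega>: "bounded \<Omega>" "open \<Omega>"
    and g: "has_Linf_weak_gradient \<Omega> u g" and g': "has_Linf_weak_gradient \<Omega> u g'"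
  shows "AE x in lebesgue_on \<Omega>. g x = g' x"
proof -
  obtain C where C: "\<And>i. (\<lambda>x. g x $ i) \<in> borel_measurable (lebesgue_on \<Omega>)"
      "\<And>i. AE x in lebesgue_on \<Omega>. \<bar>g x $ i\<bar> \<le> C"
    using g Linf_component[of g \<Omega>] unfolding has_Linf_weak_gradient_def by blast
  obtain C' where C': "\<And>i. (\<lambda>x. g' x $ i) \<in> borel_measurable (lebesgue_on \<Omega>)"
      "\<And>i. AE x in lebesgue_on \<Omega>. \<bar>g' x $ i\<bar> \<le> C'"
    using g' Linf_component[of g' \<Omega>] unfolding has_Linf_weak_gradient_def by blast
  have "AE x in lebesgue_on \<Omega>. g x $ i - g' x $ i = 0" for i
  proof (rule AE_zero_if_pairing_zero[OF \<Omega>, where C = "C + C'"])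
    show "AE x in lebesgue_on \<Omega>. \<bar>g x $ i - g' x $ i\<bar> \<le> C + C'"
      using C(2)[of i] C'(2)[of i] by eventually_elim simp
    show "(LINT x|lebesgue_on \<Omega>. (g x $ i - g' x $ i) * \<phi> x) = 0" if t: "\<phi> \<in> test_functions \<Omega>" for \<phi>
      using g g' t integrable_mult_AE_bounded[OF C(1,2) integrable_test_function[OF \<Omega> t], of i]
        integrable_mult_AE_bounded[OF C'(1,2) integrable_test_function[OF \<Omega> t], of i]
      by (simp add: has_Linf_weak_gradient_def left_diff_distrib)
  qed (use C C' in auto)
  then have "AE x in lebesgue_on \<Omega>. \<forall>i. g x $ i - g' x $ i = 0"
    by (subst AE_finite_all[of UNIV, simplified]) auto
  then show ?thesis
    by eventually_elim (simp add: vec_eq_iff)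
qed

lemma weak_gradient_works:
  assumes "u \<in> W1inf \<Omega>"
  shows "has_Linf_weak_gradient \<Omega> u (weak_gradient \<Omega> u)"
proof -
  obtain g where "has_Linf_weak_gradient \<Omega> u g"
    using assms by (auto simp: W1inf_def)
  then show ?thesis
    unfolding weak_gradient_def by (rule someI[of "has_Linf_weak_gradient \<Omega> u"])
qed

section \<open>Difference quotients\<close>

text \<open>The regularity that a bound by the geodetic distance gives directly. It is local enough
  for difference quotients and still controls oscillation up to a Lipschitz boundary of a nonconvex
  domain.\<close>

definition lipschitz_on_segments :: "'a::real_normed_vector set \<Rightarrow> real \<Rightarrow> ('a \<Rightarrow> real) \<Rightarrow> bool" where
  "lipschitz_on_segments \<Omega> C u \<longleftrightarrow>
    (\<forall>x y. closed_segment x y \<subseteq> \<Omega> \<longrightarrow> \<bar>u x - u y\<bar> \<le> C * norm (x - y))"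

text \<open>The step may have either sign. The shifted point may leave the domain, where functions
  of the space take the default value 0; bounds therefore hold only where a ball of radius
  \<open>\<bar>s\<bar>\<close> stays inside.\<close>

definition difference_ratio :: "'n \<Rightarrow> real \<Rightarrow> (real ^ 'n \<Rightarrow> real) \<Rightarrow> real ^ 'n \<Rightarrow> real" where
  "difference_ratio i s u x = (u (x + s *\<^sub>R axis i 1) - u x) / s"

lemma borel_measurable_difference_ratio [measurable]:
  fixes u :: "real ^ 'n \<Rightarrow> real"
  assumes [measurable]: "u \<in> borel_measurable borel"
  shows "difference_ratio i s u \<in> borel_measurable borel"
proof -
  have [measurable]: "(\<lambda>x. x + s *\<^sub>R axis i (1::real)) \<in> borel_measurable borel"
    by (intro borel_measurable_continuous_onI continuous_intros)
  show ?thesis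
    unfolding difference_ratio_def by measurable
qed

text \<open>\<open>W1inf\<close> without its gradient clause, so that a maximum can be handled
  before its weak gradient is known.\<close>

definition continuous_Linf :: "(real ^ 'n) set \<Rightarrow> (real ^ 'n \<Rightarrow> real) set" where
  "continuous_Linf \<Omega> = {u \<in> Linf \<Omega>. continuous_on \<Omega> u \<and> (\<forall>x. x \<notin> \<Omega> \<longrightarrow> u x = 0)}"

lemma W1inf_iff: "u \<in> W1inf \<Omega> \<longleftrightarrow> u \<in> continuous_Linf \<Omega> \<and> (\<exists>g. has_Linf_weak_gradient \<Omega> u g)"
  by (auto simp: W1inf_def continuous_Linf_def)

lemma continuous_Linf_borel:
  fixes u :: "real ^ 'n \<Rightarrow> real"
  assumes "open \<Omega>" "u \<in> continuous_Linf \<Omega>"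
  shows "u \<in> borel_measurable borel"
proof -
  have "(\<lambda>x. indicator \<Omega> x *\<^sub>R u x) \<in> borel_measurable borel"
    using assms by (intro borel_measurable_continuous_on_indicator) (auto simp: continuous_Linf_def)
  moreover have "(\<lambda>x. indicator \<Omega> x *\<^sub>R u x) = u"
    using assms by (auto simp: continuous_Linf_def indicator_def fun_eq_iff)
  ultimately show ?thesis
    by simp
qed

lemma continuous_Linf_integrable:
  assumes "bounded \<Omega>" "open \<Omega>" "u \<in> continuous_Linf \<Omega>"
  shows "integrable (lebesgue_on \<Omega>) u"
proof -
  obtain C where "u \<in> borel_measurable (lebesgue_on \<Omega>)" "AE x in lebesgue_on \<Omega>. \<bar>u x\<bar> \<le> C"
    using assms by (auto simp: continuous_Linf_def Linf_def)
  then show ?thesis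
    by (rule integrable_lebesgue_on_const_bound[OF assms(1,2)])
qed

section \<open>Transfer to Lebesgue measure on the whole space\<close>

lemma borel_measurable_lebesgue_on:
  assumes "q \<in> borel_measurable borel"
  shows "q \<in> borel_measurable (lebesgue_on \<Omega>)"
  using assms by (intro measurable_restrict_space1 measurable_completion) simp

lemma integral_lebesgue_on_eq_lborel:
  fixes q :: "real ^ 'n \<Rightarrow> real"
  assumes "open \<Omega>" "q \<in> borel_measurable borel" "\<And>x. x \<notin> \<Omega> \<Longrightarrow> q x = 0"
  shows "(LINT x|lebesgue_on \<Omega>. q x) = (LINT x|lborel. q x)"
    and "integrable (lebesgue_on \<Omega>) q \<longleftrightarrow> integrable lborel q"
proof -
  have q: "(\<lambda>x. indicator \<Omega> x *\<^sub>R q x) = q"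
    using assms(3) by (auto simp: indicator_def fun_eq_iff)
  show "(LINT x|lebesgue_on \<Omega>. q x) = (LINT x|lborel. q x)"
    using assms(1,2) by (subst integral_restrict_space) (simp_all only: q, simp_all add: integral_completion)
  show "integrable (lebesgue_on \<Omega>) q \<longleftrightarrow> integrable lborel q"
    using assms(1,2) by (subst integrable_restrict_space) (simp_all only: q, simp_all add: integrable_completion)
qed

lemma lborel_translation:
  fixes q :: "real ^ 'n \<Rightarrow> real"
  assumes "q \<in> borel_measurable borel"
  shows "(LINT x|lborel. q (x + a)) = (LINT x|lborel. q x)"
    and "integrable lborel (\<lambda>x. q (x + a)) \<longleftrightarrow> integrable lborel q"
proof -
  have "(LINT x|distr lborel borel ((+) a). q x) = (LINT x|lborel. q (a + x))"
    using assms by (intro integral_distr) auto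
  then show "(LINT x|lborel. q (x + a)) = (LINT x|lborel. q x)"
    by (simp add: lborel_distr_plus add.commute)
  have "integrable (distr lborel borel ((+) a)) q \<longleftrightarrow> integrable lborel (\<lambda>x. q (a + x))"
    using assms by (intro integrable_distr_eq) auto
  then show "integrable lborel (\<lambda>x. q (x + a)) \<longleftrightarrow> integrable lborel q"
    by (simp add: lborel_distr_plus add.commute)
qed

lemma test_function_has_real_derivative:
  assumes "\<phi> \<in> test_functions \<Omega>"
  shows "((\<lambda>t. \<phi> (x + t *\<^sub>R axis i 1)) has_real_derivative partial_deriv i \<phi> (x + t *\<^sub>R axis i 1)) (at t)"
proof -
  have "((\<lambda>t. x + t *\<^sub>R axis i (1::real)) has_derivative (\<lambda>h. h *\<^sub>R axis i 1)) (at t)"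
    by (auto intro!: derivative_eq_intros)
  from has_derivative_compose[OF this frechet_derivative_works[THEN iffD1, OF test_function_differentiable[OF assms]]]
  have d: "((\<lambda>t. \<phi> (x + t *\<^sub>R axis i 1)) has_derivative
      (\<lambda>h. frechet_derivative \<phi> (at (x + t *\<^sub>R axis i 1)) (h *\<^sub>R axis i 1))) (at t)" .
  have "linear (frechet_derivative \<phi> (at (x + t *\<^sub>R axis i 1)))"
    using test_function_differentiable[OF assms] by (rule linear_frechet_derivative)
  then show ?thesis
    using d by (simp add: has_field_derivative_def partial_deriv_def linear_scale mult.commute[of _ "frechet_derivative _ _ _"])
qed

lemma difference_ratio_tendsto_partial_deriv:
  assumes "\<phi> \<in> test_functions \<Omega>" "X \<longlonglongrightarrow> 0" "\<And>n. X n \<noteq> 0"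
  shows "(\<lambda>n. difference_ratio i (X n) \<phi> x) \<longlonglongrightarrow> partial_deriv i \<phi> x"
proof -
  have "((\<lambda>s. difference_ratio i s \<phi> x) \<longlongrightarrow> partial_deriv i \<phi> x) (at 0)"
    using test_function_has_real_derivative[OF assms(1), of x i 0] by (simp add: DERIV_def difference_ratio_def)
  then show ?thesis
    by (rule filterlim_compose) (use assms in \<open>auto simp: filterlim_at\<close>)
qed

lemma difference_ratio_bounded:
  assumes "\<phi> \<in> test_functions \<Omega>" "\<And>x. \<bar>partial_deriv i \<phi> x\<bar> \<le> B" "s \<noteq> 0"
  shows "\<bar>difference_ratio i s \<phi> x\<bar> \<le> B"
proof -
  have "norm (\<phi> (x + s *\<^sub>R axis i 1) - \<phi> (x + 0 *\<^sub>R axis i 1)) \<le> B * norm (s - 0)"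
    by (rule field_differentiable_bound[of UNIV _ "\<lambda>t. partial_deriv i \<phi> (x + t *\<^sub>R axis i 1)"])
      (use assms test_function_has_real_derivative[OF assms(1)] in auto)
  then show ?thesis
    using assms(3) by (simp add: difference_ratio_def abs_divide divide_le_eq)
qed

text \<open>Discrete integration by parts. Extended by 0, both functions live on the whole space,
  where translation invariance moves the step from \<open>u\<close> to \<phi> with the opposite
  sign.\<close>

lemma integral_difference_ratio:
  fixes u :: "real ^ 'n \<Rightarrow> real"
  assumes \<Omega>: "bounded \<Omega>" "open \<Omega>" and u: "u \<in> continuous_Linf \<Omega>"
    and \<phi>: "\<phi> \<in> test_functions \<Omega>" and "s \<noteq> 0"
  shows "(LINT x|lebesgue_on \<Omega>. difference_ratio i s u x * \<phi> x) =
    - (LINT x|lebesgue_on \<Omega>. u x * difference_ratio i (- s) \<phi> x)"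
proof -
  define a where "a = s *\<^sub>R axis i (1::real)"
  note bu[measurable] = continuous_Linf_borel[OF \<Omega>(2) u]
  have b\<phi>[measurable]: "\<phi> \<in> borel_measurable borel"
    by (intro borel_measurable_continuous_onI continuous_on_test_function[OF \<phi>])
  obtain B where B: "\<And>x. \<bar>\<phi> x\<bar> \<le> B"
    using test_function_bounded[OF \<phi>] by auto
  have u0: "u x = 0" if "x \<notin> \<Omega>" for x
    using u that by (simp add: continuous_Linf_def)
  have \<phi>0: "\<phi> x = 0" if "x \<notin> \<Omega>" for x
    using \<phi> that by (metis test_functionsE subsetD)
  note iu = continuous_Linf_integrable[OF \<Omega> u]
  have i1: "integrable lborel (\<lambda>x. \<phi> (x - a) * u x)"
  proof (subst integral_lebesgue_on_eq_lborel(2)[OF \<Omega>(2), symmetric])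
    show "integrable (lebesgue_on \<Omega>) (\<lambda>x. \<phi> (x - a) * u x)"
      by (rule integrable_mult_AE_bounded[OF _ _ iu, of _ B]) (auto intro!: borel_measurable_lebesgue_on simp: B)
  qed (use u0 in auto)
  have i2: "integrable lborel (\<lambda>x. \<phi> x * u x)"
  proof (subst integral_lebesgue_on_eq_lborel(2)[OF \<Omega>(2), symmetric])
    show "integrable (lebesgue_on \<Omega>) (\<lambda>x. \<phi> x * u x)"
      by (rule integrable_mult_AE_bounded[OF _ _ iu, of _ B]) (auto intro!: borel_measurable_lebesgue_on simp: B)
  qed (use u0 in auto)
  have i3: "integrable lborel (\<lambda>x. \<phi> x * u (x + a))"
    using lborel_translation(2)[of "\<lambda>x. \<phi> (x - a) * u x" a] i1 by simp
  have e3: "(LINT x|lborel. \<phi> x * u (x + a)) = (LINT x|lborel. \<phi> (x - a) * u x)"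
    using lborel_translation(1)[of "\<lambda>x. \<phi> (x - a) * u x" a] by simp
  have "(LINT x|lebesgue_on \<Omega>. difference_ratio i s u x * \<phi> x) = (LINT x|lborel. difference_ratio i s u x * \<phi> x)"
    unfolding difference_ratio_def a_def[symmetric]
    by (rule integral_lebesgue_on_eq_lborel(1)[OF \<Omega>(2)]) (use \<phi>0 in auto)
  also have "\<dots> = (LINT x|lborel. (\<phi> x * u (x + a) - \<phi> x * u x) / s)"
    by (rule Bochner_Integration.integral_cong) (auto simp: difference_ratio_def a_def algebra_simps)
  also have "\<dots> = ((LINT x|lborel. \<phi> (x - a) * u x) - (LINT x|lborel. \<phi> x * u x)) / s"
    using i2 i3 e3 by simp
  also have "\<dots> = (LINT x|lborel. (\<phi> (x - a) * u x - \<phi> x * u x) / s)"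
    using i1 i2 by simp
  also have "\<dots> = (LINT x|lborel. - (u x * difference_ratio i (- s) \<phi> x))"
    using \<open>s \<noteq> 0\<close> by (intro Bochner_Integration.integral_cong) (auto simp: difference_ratio_def a_def field_simps)
  also have "\<dots> = (LINT x|lebesgue_on \<Omega>. - (u x * difference_ratio i (- s) \<phi> x))"
    unfolding difference_ratio_def
    by (rule integral_lebesgue_on_eq_lborel(1)[OF \<Omega>(2), symmetric]) (use u0 in auto)
  finally show ?thesis
    by simp
qed

text \<open>Once the quotient falls on \<phi>, it converges boundedly to the partial derivative, and
  an integrable \<open>u\<close> suffices for dominated convergence.\<close>

lemma integral_difference_ratio_tendsto:
  fixes u :: "real ^ 'n \<Rightarrow> real"
  assumes \<Omega>: "bounded \<Omega>" "open \<Omega>" and u: "u \<in> continuous_Linf \<Omega>"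
    and \<phi>: "\<phi> \<in> test_functions \<Omega>" and X: "X \<longlonglongrightarrow> 0" "\<And>n. X n \<noteq> 0"
  shows "(\<lambda>n. LINT x|lebesgue_on \<Omega>. difference_ratio i (X n) u x * \<phi> x)
    \<longlonglongrightarrow> - (LINT x|lebesgue_on \<Omega>. u x * partial_deriv i \<phi> x)"
proof -
  have nX: "(\<lambda>n. - X n) \<longlonglongrightarrow> 0"
    using tendsto_minus[OF X(1)] by simp
  have b\<phi>[measurable]: "\<phi> \<in> borel_measurable borel" "partial_deriv i \<phi> \<in> borel_measurable borel"
    by (intro borel_measurable_continuous_onI continuous_on_test_function[OF \<phi>] continuous_on_partial_deriv[OF \<phi>])+
  note bu[measurable] = continuous_Linf_borel[OF \<Omega>(2) u]
  obtain B where B: "\<And>x. \<bar>partial_deriv i \<phi> x\<bar> \<le> B"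
    using partial_deriv_bounded[OF \<phi>] by blast
  have "(\<lambda>n. LINT x|lebesgue_on \<Omega>. u x * difference_ratio i (- X n) \<phi> x)
    \<longlonglongrightarrow> (LINT x|lebesgue_on \<Omega>. u x * partial_deriv i \<phi> x)"
  proof (rule integral_dominated_convergence[where w = "\<lambda>x. B * \<bar>u x\<bar>"])
    show "integrable (lebesgue_on \<Omega>) (\<lambda>x. B * \<bar>u x\<bar>)"
      using continuous_Linf_integrable[OF \<Omega> u] by simp
    show "AE x in lebesgue_on \<Omega>. (\<lambda>n. u x * difference_ratio i (- X n) \<phi> x) \<longlonglongrightarrow> u x * partial_deriv i \<phi> x"
      by (intro AE_I2 tendsto_mult tendsto_const difference_ratio_tendsto_partial_deriv[OF \<phi> nX]) (use X in auto)
    show "AE x in lebesgue_on \<Omega>. norm (u x * difference_ratio i (- X n) \<phi> x) \<le> B * \<bar>u x\<bar>" for n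
    proof (rule AE_I2)
      fix x
      show "norm (u x * difference_ratio i (- X n) \<phi> x) \<le> B * \<bar>u x\<bar>"
        using mult_left_mono[OF difference_ratio_bounded[OF \<phi> B, of "- X n" x], of "\<bar>u x\<bar>"] X(2)[of n]
        by (simp add: abs_mult mult.commute)
    qed
  qed (auto intro!: borel_measurable_lebesgue_on simp: difference_ratio_def)
  then show ?thesis
    by (subst integral_difference_ratio[OF \<Omega> u \<phi> X(2)]) (rule tendsto_minus)
qed

lemma lipschitz_difference_ratio_le:
  fixes u :: "real ^ 'n \<Rightarrow> real"
  assumes "lipschitz_on_segments \<Omega> C u" "cball x d \<subseteq> \<Omega>" "\<bar>s\<bar> \<le> d" "s \<noteq> 0"
  shows "\<bar>difference_ratio i s u x\<bar> \<le> C"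
proof -
  have "closed_segment (x + s *\<^sub>R axis i 1) x \<subseteq> cball x d"
    using assms(3) by (intro closed_segment_subset) (auto simp: dist_norm)
  then have "\<bar>u (x + s *\<^sub>R axis i 1) - u x\<bar> \<le> C * \<bar>s\<bar>"
    using assms(1,2) unfolding lipschitz_on_segments_def by fastforce
  then show ?thesis
    using assms(4) by (simp add: difference_ratio_def abs_divide divide_le_eq)
qed

lemma lipschitz_on_segments_nonneg:
  fixes u :: "real ^ 'n \<Rightarrow> real"
  assumes "lipschitz_on_segments \<Omega> C u" "open \<Omega>" "\<Omega> \<noteq> {}"
  shows "0 \<le> C"
proof -
  obtain x d where "0 < d" "cball x d \<subseteq> \<Omega>"
    using assms(2,3) by (meson all_not_in_conv open_contains_cball)
  then have "\<bar>difference_ratio undefined d u x\<bar> \<le> C"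
    by (intro lipschitz_difference_ratio_le[OF assms(1)]) auto
  then show ?thesis
    by linarith
qed

text \<open>The compact support of \<open>h\<close> keeps the difference quotients bounded by \<open>C\<close> where they are tested.\<close>

lemma difference_ratio_weak_convergence:
  fixes u :: "real ^ 'n \<Rightarrow> real"
  assumes \<Omega>: "bounded \<Omega>" "open \<Omega>" and u: "u \<in> continuous_Linf \<Omega>"
    and lip: "lipschitz_on_segments \<Omega> C u" and g: "has_Linf_weak_gradient \<Omega> u g"
    and h: "integrable (lebesgue_on \<Omega>) h" and S: "compact S" "S \<subseteq> \<Omega>" "\<And>x. x \<notin> S \<Longrightarrow> h x = 0"
    and X: "X \<longlonglongrightarrow> 0" "\<And>n. X n \<noteq> 0"
  shows "(\<lambda>n. LINT x|lebesgue_on \<Omega>. difference_ratio i (X n) u x * h x)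
    \<longlonglongrightarrow> (LINT x|lebesgue_on \<Omega>. g x $ i * h x)"
proof (cases "\<Omega> = {}")
  case True
  then show ?thesis
    by (simp add: integral_restrict_space)
next
  case False
  then have C0: "0 \<le> C"
    using lipschitz_on_segments_nonneg lip \<Omega> by blast
  note bu[measurable] = continuous_Linf_borel[OF \<Omega>(2) u]
  obtain G where G0: "0 \<le> G" and gm: "(\<lambda>x. g x $ i) \<in> borel_measurable (lebesgue_on \<Omega>)"
    and gG: "AE x in lebesgue_on \<Omega>. \<bar>g x $ i\<bar> \<le> G"
    using g Linf_component[of g \<Omega>] unfolding has_Linf_weak_gradient_def by blast
  show ?thesis
  proof (rule LIMSEQ_I)
    fix e :: real assume "0 < e"
    \<comment> \<open>Replacing \<open>h\<close> by \<phi> costs \<open>C * d\<close> on the side of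
      the quotients and \<open>G * d\<close> on the side of the gradient, together less than
      \<open>e / 2\<close>.\<close>
    define d where "d = e / (2 * (C + G + 1))"
    have d: "0 < d" "(C + G) * d < e / 2"
      using \<open>0 < e\<close> C0 G0 by (auto simp: d_def field_simps)
    obtain \<phi> where \<phi>: "\<phi> \<in> test_functions \<Omega>" and l: "(LINT x|lebesgue_on \<Omega>. \<bar>h x - \<phi> x\<bar>) < d"
      using test_functions_dense[OF \<Omega> h d(1)] by blast
    note i\<phi> = integrable_test_function[OF \<Omega> \<phi>]
    obtain T where T: "compact T" "T \<subseteq> \<Omega>" "\<And>x. x \<notin> T \<Longrightarrow> \<phi> x = 0"
      using \<phi> by (metis test_functionsE)
    have ST: "compact (S \<union> T)" "S \<union> T \<subseteq> \<Omega>"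
      using S T by auto
    obtain \<delta> where \<delta>0: "0 < \<delta>" and "(\<Union>x\<in>S \<union> T. cball x \<delta>) \<subseteq> \<Omega>"
      by (rule compact_subset_open_imp_cball_epsilon_subset[OF ST(1) \<Omega>(2) ST(2)])
    then have \<delta>: "cball x \<delta> \<subseteq> \<Omega>" if "x \<in> S \<union> T" for x
      using that unfolding UN_subset_iff by blast
    have close: "\<forall>\<^sub>F n in sequentially. \<bar>X n\<bar> < \<delta>"
      using order_tendstoD(2)[OF tendsto_rabs[OF X(1)], of \<delta>] \<delta>0 by simp
    have "(\<lambda>n. LINT x|lebesgue_on \<Omega>. difference_ratio i (X n) u x * \<phi> x) \<longlonglongrightarrow> (LINT x|lebesgue_on \<Omega>. g x $ i * \<phi> x)"
      using integral_difference_ratio_tendsto[OF \<Omega> u \<phi> X, of i] g \<phi> by (simp add: has_Linf_weak_gradient_def)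
    then have "\<forall>\<^sub>F n in sequentially. norm ((LINT x|lebesgue_on \<Omega>. difference_ratio i (X n) u x * \<phi> x) -
        (LINT x|lebesgue_on \<Omega>. g x $ i * \<phi> x)) < e / 2"
      using \<open>0 < e\<close> by (simp only: tendsto_iff dist_norm half_gt_zero)
    with close have "\<forall>\<^sub>F n in sequentially. norm ((LINT x|lebesgue_on \<Omega>. difference_ratio i (X n) u x * h x) -
        (LINT x|lebesgue_on \<Omega>. g x $ i * h x)) < e"
    proof eventually_elim
      case (elim n)
      \<comment> \<open>Cutting the quotient off outside both supports changes neither product and
        makes it bounded by \<open>C\<close> everywhere.\<close>
      define q where "q x = indicator (S \<union> T) x * difference_ratio i (X n) u x" for x
      have qm: "q \<in> borel_measurable (lebesgue_on \<Omega>)"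
        unfolding q_def using borel_compact[OF ST(1)] bu
        by (intro borel_measurable_lebesgue_on borel_measurable_times borel_measurable_indicator
            borel_measurable_difference_ratio)
      have qC: "\<bar>q x\<bar> \<le> C" for x
        using lipschitz_difference_ratio_le[OF lip \<delta>, of x "X n" i] elim X(2)[of n] C0
        by (auto simp: q_def indicator_def)
      have qh: "difference_ratio i (X n) u x * h x = q x * h x"
        and q\<phi>: "difference_ratio i (X n) u x * \<phi> x = q x * \<phi> x" for x
        using S(3)[of x] T(3)[of x] by (auto simp: q_def indicator_def)
      have iqh: "integrable (lebesgue_on \<Omega>) (\<lambda>x. q x * h x)" "integrable (lebesgue_on \<Omega>) (\<lambda>x. q x * \<phi> x)"
        by (rule integrable_mult_AE_bounded[OF qm, of C]; use qC h i\<phi> in simp)+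
      have igh: "integrable (lebesgue_on \<Omega>) (\<lambda>x. g x $ i * h x)" "integrable (lebesgue_on \<Omega>) (\<lambda>x. g x $ i * \<phi> x)"
        by (rule integrable_mult_AE_bounded[OF gm gG]; use h i\<phi> in simp)+
      have "\<bar>LINT x|lebesgue_on \<Omega>. q x * (h x - \<phi> x)\<bar> \<le> C * (LINT x|lebesgue_on \<Omega>. \<bar>h x - \<phi> x\<bar>)"
        by (rule abs_integral_mult_le[OF qm]) (use qC h i\<phi> in auto)
      also have "\<dots> \<le> C * d"
        using l C0 by (intro mult_left_mono) auto
      finally have 1: "\<bar>(LINT x|lebesgue_on \<Omega>. q x * h x) - (LINT x|lebesgue_on \<Omega>. q x * \<phi> x)\<bar> \<le> C * d"
        using iqh by (simp add: right_diff_distrib)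
      have "\<bar>LINT x|lebesgue_on \<Omega>. g x $ i * (h x - \<phi> x)\<bar> \<le> G * (LINT x|lebesgue_on \<Omega>. \<bar>h x - \<phi> x\<bar>)"
        by (rule abs_integral_mult_le[OF gm gG]) (use h i\<phi> in auto)
      also have "\<dots> \<le> G * d"
        using l G0 by (intro mult_left_mono) auto
      finally have 2: "\<bar>(LINT x|lebesgue_on \<Omega>. g x $ i * h x) - (LINT x|lebesgue_on \<Omega>. g x $ i * \<phi> x)\<bar> \<le> G * d"
        using igh by (simp add: right_diff_distrib)
      show ?case
        using 1 2 elim(2) d(2) unfolding qh q\<phi> real_norm_def distrib_right by linarith
    qed
    then show "\<exists>no. \<forall>n\<ge>no. norm ((LINT x|lebesgue_on \<Omega>. difference_ratio i (X n) u x * h x) -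
        (LINT x|lebesgue_on \<Omega>. g x $ i * h x)) < e"
      by (simp add: eventually_sequentially)
  qed
qed

section \<open>Weak gradients of maxima\<close>

lemma continuous_Linf_max:
  assumes "open \<Omega>" "u \<in> continuous_Linf \<Omega>" "v \<in> continuous_Linf \<Omega>"
  shows "(\<lambda>x. max (u x) (v x)) \<in> continuous_Linf \<Omega>"
proof -
  obtain C D where C: "AE x in lebesgue_on \<Omega>. \<bar>u x\<bar> \<le> C" "AE x in lebesgue_on \<Omega>. \<bar>v x\<bar> \<le> D"
    using assms by (auto simp: continuous_Linf_def Linf_def)
  have "AE x in lebesgue_on \<Omega>. \<bar>max (u x) (v x)\<bar> \<le> max C D"
    using C by eventually_elim auto
  moreover have "continuous_on \<Omega> (\<lambda>x. max (u x) (v x))"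
    using assms by (intro continuous_intros) (auto simp: continuous_Linf_def)
  ultimately show ?thesis
    using assms by (auto simp: continuous_Linf_def Linf_def intro: borel_measurable_lebesgue_on_continuous)
qed

lemma lipschitz_on_segments_max:
  "lipschitz_on_segments \<Omega> C u \<Longrightarrow> lipschitz_on_segments \<Omega> C v \<Longrightarrow>
    lipschitz_on_segments \<Omega> C (\<lambda>x. max (u x) (v x))"
  unfolding lipschitz_on_segments_def by (smt (verit, best))

lemma has_Linf_weak_gradient_lincomb:
  fixes u v :: "real ^ 'n \<Rightarrow> real"
  assumes \<Omega>: "bounded \<Omega>" "open \<Omega>" and uv: "u \<in> continuous_Linf \<Omega>" "v \<in> continuous_Linf \<Omega>"
    and g: "has_Linf_weak_gradient \<Omega> u g" and g': "has_Linf_weak_gradient \<Omega> v g'"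
  shows "has_Linf_weak_gradient \<Omega> (\<lambda>x. a * u x + b * v x) (\<lambda>x. a *\<^sub>R g x + b *\<^sub>R g' x)"
  unfolding has_Linf_weak_gradient_def
proof (intro conjI ballI allI)
  obtain C D where "AE x in lebesgue_on \<Omega>. norm (g x) \<le> C" "AE x in lebesgue_on \<Omega>. norm (g' x) \<le> D"
    using g g' by (auto simp: has_Linf_weak_gradient_def Linf_def)
  then have "AE x in lebesgue_on \<Omega>. norm (a *\<^sub>R g x + b *\<^sub>R g' x) \<le> \<bar>a\<bar> * C + \<bar>b\<bar> * D"
    by eventually_elim (auto intro!: norm_triangle_le add_mono mult_left_mono)
  then show "(\<lambda>x. a *\<^sub>R g x + b *\<^sub>R g' x) \<in> Linf \<Omega>"
    using g g' by (auto simp: has_Linf_weak_gradient_def Linf_def)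
next
  fix \<phi> i assume \<phi>: "\<phi> \<in> test_functions \<Omega>"
  obtain B where B: "\<And>x. \<bar>partial_deriv i \<phi> x\<bar> \<le> B"
    using partial_deriv_bounded[OF \<phi>] by blast
  have int: "integrable (lebesgue_on \<Omega>) (\<lambda>x. w x * partial_deriv i \<phi> x)" if w: "w \<in> continuous_Linf \<Omega>" for w
    using integrable_mult_AE_bounded[OF borel_measurable_lebesgue_on_continuous[OF \<Omega>(2) continuous_on_partial_deriv[OF \<phi>]]
        _ continuous_Linf_integrable[OF \<Omega> w], of i B] B by (simp add: mult.commute)
  have intg: "integrable (lebesgue_on \<Omega>) (\<lambda>x. f x $ i * \<phi> x)" if "f \<in> Linf \<Omega>" for f :: "real ^ 'n \<Rightarrow> real ^ 'n"
    using integrable_mult_AE_bounded[OF _ _ integrable_test_function[OF \<Omega> \<phi>]] Linf_component[OF that] by blast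
  have "(LINT x|lebesgue_on \<Omega>. (a * u x + b * v x) * partial_deriv i \<phi> x)
      = (LINT x|lebesgue_on \<Omega>. a * (u x * partial_deriv i \<phi> x) + b * (v x * partial_deriv i \<phi> x))"
    by (simp add: algebra_simps)
  also have "\<dots> = a * (LINT x|lebesgue_on \<Omega>. u x * partial_deriv i \<phi> x) + b * (LINT x|lebesgue_on \<Omega>. v x * partial_deriv i \<phi> x)"
    using int uv by simp
  also have "\<dots> = - (a * (LINT x|lebesgue_on \<Omega>. g x $ i * \<phi> x) + b * (LINT x|lebesgue_on \<Omega>. g' x $ i * \<phi> x))"
    using g g' \<phi> by (simp add: has_Linf_weak_gradient_def)
  also have "\<dots> = - (LINT x|lebesgue_on \<Omega>. a * (g x $ i * \<phi> x) + b * (g' x $ i * \<phi> x))"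
    using intg[of g] intg[of g'] g g' by (simp add: has_Linf_weak_gradient_def)
  also have "\<dots> = - (LINT x|lebesgue_on \<Omega>. (a *\<^sub>R g x + b *\<^sub>R g' x) $ i * \<phi> x)"
    by (simp add: algebra_simps)
  finally show "(LINT x|lebesgue_on \<Omega>. (a * u x + b * v x) * partial_deriv i \<phi> x)
      = - (LINT x|lebesgue_on \<Omega>. (a *\<^sub>R g x + b *\<^sub>R g' x) $ i * \<phi> x)" .
qed

text \<open>
  On \<open>{u > v}\<close> and \<open>{u < v}\<close> the difference quotients of \<open>max u v\<close> agree eventually with those of
  \<open>u\<close> or \<open>v\<close>. On \<open>{u = v}\<close> the difference between those of \<open>max u v\<close> and \<open>u\<close> has the sign of the
  step, so the common limit of its integrals along positive and negative steps is \<open>0\<close>.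
\<close>

lemma max_weak_gradient_nonneg_test:
  fixes u v :: "real ^ 'n \<Rightarrow> real"
  assumes \<Omega>: "bounded \<Omega>" "open \<Omega>" and uv: "u \<in> continuous_Linf \<Omega>" "v \<in> continuous_Linf \<Omega>"
    and lip: "lipschitz_on_segments \<Omega> C u" "lipschitz_on_segments \<Omega> C v"
    and g: "has_Linf_weak_gradient \<Omega> u g" and g': "has_Linf_weak_gradient \<Omega> v g'"
    and \<phi>: "\<phi> \<in> test_functions \<Omega>" "\<And>x. 0 \<le> \<phi> x"
  shows "(LINT x|lebesgue_on \<Omega>. max (u x) (v x) * partial_deriv i \<phi> x) =
    - (LINT x|lebesgue_on \<Omega>. (if u x \<ge> v x then g x else g' x) $ i * \<phi> x)"
proof (cases "\<Omega> = {}")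
  case True
  then show ?thesis
    by (simp add: integral_restrict_space)
next
  case False
  then have C0: "0 \<le> C"
    using lipschitz_on_segments_nonneg lip \<Omega> by blast
  define m where "m = (\<lambda>x. max (u x) (v x))"
  have m: "m \<in> continuous_Linf \<Omega>" "lipschitz_on_segments \<Omega> C m"
    unfolding m_def using continuous_Linf_max[OF \<Omega>(2) uv] lipschitz_on_segments_max[OF lip] by auto
  note [measurable] = continuous_Linf_borel[OF \<Omega>(2) uv(1)] continuous_Linf_borel[OF \<Omega>(2) uv(2)] continuous_Linf_borel[OF \<Omega>(2) m(1)]
  have [measurable]: "\<phi> \<in> borel_measurable borel"
    by (intro borel_measurable_continuous_onI continuous_on_test_function[OF \<phi>(1)])
  note i\<phi> = integrable_test_function[OF \<Omega> \<phi>(1)]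
  obtain S where S: "compact S" "S \<subseteq> \<Omega>" "\<And>x. x \<notin> S \<Longrightarrow> \<phi> x = 0"
    using \<phi>(1) by (metis test_functionsE)
  obtain \<delta> where \<delta>0: "0 < \<delta>" and "(\<Union>x\<in>S. cball x \<delta>) \<subseteq> \<Omega>"
    by (rule compact_subset_open_imp_cball_epsilon_subset[OF S(1) \<Omega>(2) S(2)])
  then have \<delta>: "cball x \<delta> \<subseteq> \<Omega>" if "x \<in> S" for x
    using that unfolding UN_subset_iff by blast
  \<comment> \<open>Cutting \<phi> along the sign of \<open>u - v\<close> destroys its continuity.
    This is why the weak convergence of difference quotients was proved against integrable functions
    with compact support.\<close>
  define h where "h = (\<lambda>x. if u x \<ge> v x then \<phi> x else 0)"
  define h' where "h' = (\<lambda>x. if u x \<ge> v x then 0 else \<phi> x)"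
  have hb[measurable]: "h \<in> borel_measurable borel" "h' \<in> borel_measurable borel"
    unfolding h_def h'_def by measurable
  have ih: "integrable (lebesgue_on \<Omega>) h" "integrable (lebesgue_on \<Omega>) h'"
    by (rule Bochner_Integration.integrable_bound[OF i\<phi>]; auto intro: borel_measurable_lebesgue_on simp: h_def h'_def)+
  have hS: "h x = 0" "h' x = 0" if "x \<notin> S" for x
    using S(3)[OF that] by (auto simp: h_def h'_def)
  obtain G where gm: "(\<lambda>x. g x $ i) \<in> borel_measurable (lebesgue_on \<Omega>)" "AE x in lebesgue_on \<Omega>. \<bar>g x $ i\<bar> \<le> G"
    using g Linf_component[of g \<Omega>] unfolding has_Linf_weak_gradient_def by blast
  obtain G' where gm': "(\<lambda>x. g' x $ i) \<in> borel_measurable (lebesgue_on \<Omega>)" "AE x in lebesgue_on \<Omega>. \<bar>g' x $ i\<bar> \<le> G'"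
    using g' Linf_component[of g' \<Omega>] unfolding has_Linf_weak_gradient_def by blast
  \<comment> \<open>The defect of the claimed identity, to be squeezed to 0.\<close>
  define \<kappa> where "\<kappa> = - (LINT x|lebesgue_on \<Omega>. m x * partial_deriv i \<phi> x)
      - (LINT x|lebesgue_on \<Omega>. g x $ i * h x) - (LINT x|lebesgue_on \<Omega>. g' x $ i * h' x)"
  \<comment> \<open>\<open>P\<close> carries the contact set \<open>{u = v}\<close> and
    \<open>Q\<close> its complement; their sum has integrals tending to \<kappa>, and those of
    \<open>Q\<close> tend to 0.\<close>
  define P where "P = (\<lambda>s x. if u x = v x then (difference_ratio i s m x - difference_ratio i s u x) * \<phi> x else 0)"
  define Q where "Q = (\<lambda>s x. if u x = v x then 0 else
      difference_ratio i s m x * \<phi> x - difference_ratio i s u x * h x - difference_ratio i s v x * h' x)"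
  have lim: "(\<lambda>n. LINT x|lebesgue_on \<Omega>. P (X n) x) \<longlonglongrightarrow> \<kappa>"
    if X: "X \<longlonglongrightarrow> 0" "\<And>n. X n \<noteq> 0" "\<And>n. \<bar>X n\<bar> \<le> \<delta>" for X
  proof -
    have dC: "\<bar>difference_ratio i (X n) w x * k x\<bar> \<le> C * \<bar>\<phi> x\<bar>"
      if "lipschitz_on_segments \<Omega> C w" "x \<notin> S \<Longrightarrow> k x = 0" "\<bar>k x\<bar> \<le> \<bar>\<phi> x\<bar>" for n w x and k :: "real ^ 'n \<Rightarrow> real"
    proof (cases "x \<in> S")
      case True
      then show ?thesis
        using lipschitz_difference_ratio_le[OF that(1) \<delta>[OF True] X(3,2)] that(3) C0
        by (simp add: abs_mult mult_mono)
    qed (use that C0 in auto)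
    have i1: "integrable (lebesgue_on \<Omega>) (\<lambda>x. difference_ratio i (X n) w x * k x)"
      if "lipschitz_on_segments \<Omega> C w" "\<And>x. x \<notin> S \<Longrightarrow> k x = 0" "\<And>x. \<bar>k x\<bar> \<le> \<bar>\<phi> x\<bar>"
        "w \<in> borel_measurable borel" "k \<in> borel_measurable borel" for n w k
    proof (rule Bochner_Integration.integrable_bound[where f = "\<lambda>x. C * \<phi> x"])
      show "(\<lambda>x. difference_ratio i (X n) w x * k x) \<in> borel_measurable (lebesgue_on \<Omega>)"
        using that(4,5) by (intro borel_measurable_lebesgue_on borel_measurable_times borel_measurable_difference_ratio)
      show "AE x in lebesgue_on \<Omega>. norm (difference_ratio i (X n) w x * k x) \<le> norm (C * \<phi> x)"
        using dC[of w _ k n] that(1-3) C0 by (simp add: abs_mult)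
    qed (use i\<phi> in simp)
    have hle: "\<bar>h x\<bar> \<le> \<bar>\<phi> x\<bar>" "\<bar>h' x\<bar> \<le> \<bar>\<phi> x\<bar>" for x
      by (auto simp: h_def h'_def)
    have ii: "integrable (lebesgue_on \<Omega>) (\<lambda>x. difference_ratio i (X n) m x * \<phi> x)"
      "integrable (lebesgue_on \<Omega>) (\<lambda>x. difference_ratio i (X n) u x * h x)"
      "integrable (lebesgue_on \<Omega>) (\<lambda>x. difference_ratio i (X n) v x * h' x)" for n
      by (rule i1; use S hS hle lip m in simp)+
    have Qb: "\<bar>Q (X n) x\<bar> \<le> 3 * (C * \<bar>\<phi> x\<bar>)" for n x
    proof (cases "u x = v x")
      case True
      then show ?thesis
        using C0 by (simp add: Q_def)
    next
      case False
      then have "Q (X n) x = difference_ratio i (X n) m x * \<phi> x - difference_ratio i (X n) u x * h x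
          - difference_ratio i (X n) v x * h' x"
        by (simp add: Q_def)
      moreover have "\<bar>difference_ratio i (X n) m x * \<phi> x\<bar> \<le> C * \<bar>\<phi> x\<bar>"
        by (intro dC m(2) S(3)) auto
      moreover have "\<bar>difference_ratio i (X n) u x * h x\<bar> \<le> C * \<bar>\<phi> x\<bar>"
        by (intro dC lip(1) hS(1) hle)
      moreover have "\<bar>difference_ratio i (X n) v x * h' x\<bar> \<le> C * \<bar>\<phi> x\<bar>"
        by (intro dC lip(2) hS(2) hle)
      ultimately show ?thesis
        by linarith
    qed
    have iQ: "integrable (lebesgue_on \<Omega>) (Q (X n))" for n
    proof (rule Bochner_Integration.integrable_bound[where f = "\<lambda>x. 3 * (C * \<phi> x)"])
      show "Q (X n) \<in> borel_measurable (lebesgue_on \<Omega>)"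
        unfolding Q_def by (intro borel_measurable_lebesgue_on) measurable
      show "AE x in lebesgue_on \<Omega>. norm (Q (X n) x) \<le> norm (3 * (C * \<phi> x))"
        using Qb C0 by (simp add: abs_mult)
    qed (use i\<phi> in simp)
    have PQ: "P (X n) x = difference_ratio i (X n) m x * \<phi> x - difference_ratio i (X n) u x * h x
        - difference_ratio i (X n) v x * h' x - Q (X n) x" for n x
      by (auto simp: P_def Q_def h_def h'_def algebra_simps)
    have "(LINT x|lebesgue_on \<Omega>. P (X n) x) = (LINT x|lebesgue_on \<Omega>. difference_ratio i (X n) m x * \<phi> x)
        - (LINT x|lebesgue_on \<Omega>. difference_ratio i (X n) u x * h x)
        - (LINT x|lebesgue_on \<Omega>. difference_ratio i (X n) v x * h' x) - (LINT x|lebesgue_on \<Omega>. Q (X n) x)" for n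
      unfolding PQ using ii iQ by simp
    moreover have "(\<lambda>n. LINT x|lebesgue_on \<Omega>. Q (X n) x) \<longlonglongrightarrow> (LINT x|lebesgue_on \<Omega>. 0)"
    proof (rule integral_dominated_convergence[where w = "\<lambda>x. 3 * (C * \<bar>\<phi> x\<bar>)"])
      show "AE x in lebesgue_on \<Omega>. (\<lambda>n. Q (X n) x) \<longlonglongrightarrow> 0"
      proof (rule AE_I2)
        fix x assume "x \<in> space (lebesgue_on \<Omega>)"
        then have x: "x \<in> \<Omega>"
          by (simp add: space_restrict_space)
        have mv: "(\<lambda>n. w (x + X n *\<^sub>R axis i 1)) \<longlonglongrightarrow> w x" if "w \<in> continuous_Linf \<Omega>" for w
        proof (rule isCont_tendsto_compose[of x w])
          show "isCont w x"
            using that x \<Omega>(2) by (auto simp: continuous_Linf_def continuous_on_eq_continuous_at)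
          have "(\<lambda>n. x + X n *\<^sub>R axis i (1::real)) \<longlonglongrightarrow> x + 0 *\<^sub>R axis i 1"
            by (intro tendsto_intros X)
          then show "(\<lambda>n. x + X n *\<^sub>R axis i (1::real)) \<longlonglongrightarrow> x"
            by simp
        qed
        have "\<forall>\<^sub>F n in sequentially. Q (X n) x = 0"
        proof -
          consider "u x = v x" | "u x < v x" | "v x < u x"
            by linarith
          then show ?thesis
          proof cases
            case 1
            then show ?thesis
              by (simp add: Q_def)
          next
            case 2
            have "\<forall>\<^sub>F n in sequentially. 0 < v (x + X n *\<^sub>R axis i 1) - u (x + X n *\<^sub>R axis i 1)"
              by (rule order_tendstoD(1)[OF tendsto_diff[OF mv[OF uv(2)] mv[OF uv(1)]]]) (use 2 in simp)
            then show ?thesis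
              using 2 by (auto elim!: eventually_mono simp: Q_def h_def h'_def m_def difference_ratio_def max_def)
          next
            case 3
            have "\<forall>\<^sub>F n in sequentially. 0 < u (x + X n *\<^sub>R axis i 1) - v (x + X n *\<^sub>R axis i 1)"
              by (rule order_tendstoD(1)[OF tendsto_diff[OF mv[OF uv(1)] mv[OF uv(2)]]]) (use 3 in simp)
            then show ?thesis
              using 3 by (auto elim!: eventually_mono simp: Q_def h_def h'_def m_def difference_ratio_def max_def)
          qed
        qed
        then show "(\<lambda>n. Q (X n) x) \<longlonglongrightarrow> 0"
          by (rule tendsto_eventually)
      qed
    qed (use iQ Qb i\<phi> in auto)
    moreover note integral_difference_ratio_tendsto[OF \<Omega> m(1) \<phi>(1) X(1,2), of i]
    moreover note difference_ratio_weak_convergence[OF \<Omega> uv(1) lip(1) g ih(1) S(1,2) hS(1) X(1,2), of i]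
    moreover note difference_ratio_weak_convergence[OF \<Omega> uv(2) lip(2) g' ih(2) S(1,2) hS(2) X(1,2), of i]
    ultimately show ?thesis
      unfolding \<kappa>_def by (auto intro!: tendsto_eq_intros)
  qed
  define X where "X n = \<delta> * inverse (real (Suc n))" for n
  have X0: "X \<longlonglongrightarrow> 0"
    unfolding X_def using tendsto_mult[OF tendsto_const[of \<delta>] LIMSEQ_inverse_real_of_nat] by simp
  have X: "0 < X n" "\<bar>X n\<bar> \<le> \<delta>" "X n \<noteq> 0" for n
    using \<delta>0 by (auto simp: X_def field_simps)
  have "0 \<le> \<kappa>"
  proof (rule LIMSEQ_le_const)
    show "(\<lambda>n. LINT x|lebesgue_on \<Omega>. P (X n) x) \<longlonglongrightarrow> \<kappa>"
      by (rule lim[OF X0 X(3,2)])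
    show "\<exists>N. \<forall>n\<ge>N. 0 \<le> (LINT x|lebesgue_on \<Omega>. P (X n) x)"
      using X(1) \<phi>(2) by (auto simp: P_def m_def difference_ratio_def divide_right_mono less_imp_le intro!: Bochner_Integration.integral_nonneg mult_nonneg_nonneg)
  qed
  moreover have "\<kappa> \<le> 0"
  proof (rule LIMSEQ_le_const2)
    show "(\<lambda>n. LINT x|lebesgue_on \<Omega>. P (- X n) x) \<longlonglongrightarrow> \<kappa>"
      by (rule lim) (use tendsto_minus[OF X0] X in auto)
    have "P (- X n) x \<le> 0" for n x
      using X(1)[of n] \<phi>(2)[of x]
      by (auto simp: P_def m_def difference_ratio_def divide_right_mono less_imp_le intro!: mult_nonpos_nonneg)
    then have "(LINT x|lebesgue_on \<Omega>. P (- X n) x) \<le> 0" for n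
      using Bochner_Integration.integral_nonneg[of "lebesgue_on \<Omega>" "\<lambda>x. - P (- X n) x"] by simp
    then show "\<exists>N. \<forall>n\<ge>N. (LINT x|lebesgue_on \<Omega>. P (- X n) x) \<le> 0"
      by blast
  qed
  ultimately have "(LINT x|lebesgue_on \<Omega>. m x * partial_deriv i \<phi> x) =
      - ((LINT x|lebesgue_on \<Omega>. g x $ i * h x) + (LINT x|lebesgue_on \<Omega>. g' x $ i * h' x))"
    by (simp add: \<kappa>_def)
  also have "\<dots> = - (LINT x|lebesgue_on \<Omega>. g x $ i * h x + g' x $ i * h' x)"
    using integrable_mult_AE_bounded[OF gm ih(1)] integrable_mult_AE_bounded[OF gm' ih(2)] by simp
  also have "\<dots> = - (LINT x|lebesgue_on \<Omega>. (if u x \<ge> v x then g x else g' x) $ i * \<phi> x)"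
    by (intro arg_cong[of _ _ uminus] Bochner_Integration.integral_cong) (auto simp: h_def h'_def)
  finally show ?thesis
    by (simp add: m_def)
qed

text \<open>Only the sign condition on the test function remains to be removed. The identity is
  linear in it, and any \<phi> becomes nonnegative after adding a nonnegative \<psi> that dominates
  its absolute value.\<close>

lemma has_Linf_weak_gradient_max:
  fixes u v :: "real ^ 'n \<Rightarrow> real"
  assumes \<Omega>: "bounded \<Omega>" "open \<Omega>" and uv: "u \<in> continuous_Linf \<Omega>" "v \<in> continuous_Linf \<Omega>"
    and lip: "lipschitz_on_segments \<Omega> C u" "lipschitz_on_segments \<Omega> C v"
    and g: "has_Linf_weak_gradient \<Omega> u g" and g': "has_Linf_weak_gradient \<Omega> v g'"
  shows "has_Linf_weak_gradient \<Omega> (\<lambda>x. max (u x) (v x)) (\<lambda>x. if u x \<ge> v x then g x else g' x)"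
    (is "has_Linf_weak_gradient \<Omega> ?m ?G")
  unfolding has_Linf_weak_gradient_def
proof (intro conjI ballI allI)
  note [measurable] = continuous_Linf_borel[OF \<Omega>(2) uv(1), THEN borel_measurable_lebesgue_on, of \<Omega>]
    continuous_Linf_borel[OF \<Omega>(2) uv(2), THEN borel_measurable_lebesgue_on, of \<Omega>]
  have [measurable]: "g \<in> borel_measurable (lebesgue_on \<Omega>)" "g' \<in> borel_measurable (lebesgue_on \<Omega>)"
    using g g' by (auto simp: has_Linf_weak_gradient_def Linf_def)
  obtain D E where "AE x in lebesgue_on \<Omega>. norm (g x) \<le> D" "AE x in lebesgue_on \<Omega>. norm (g' x) \<le> E"
    using g g' by (auto simp: has_Linf_weak_gradient_def Linf_def)
  then have "AE x in lebesgue_on \<Omega>. norm (?G x) \<le> max D E"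
    by eventually_elim auto
  moreover have "?G \<in> borel_measurable (lebesgue_on \<Omega>)"
    by measurable
  ultimately show G: "?G \<in> Linf \<Omega>"
    unfolding Linf_def by blast
  fix \<phi> i assume \<phi>: "\<phi> \<in> test_functions \<Omega>"
  obtain S where S: "compact S" "S \<subseteq> \<Omega>" "\<And>x. x \<notin> S \<Longrightarrow> \<phi> x = 0"
    using \<phi> by (metis test_functionsE)
  obtain B where B: "0 \<le> B" "\<And>x. \<bar>\<phi> x\<bar> \<le> B"
    using test_function_bounded[OF \<phi>] by auto
  obtain \<zeta> where \<zeta>: "\<zeta> \<in> test_functions \<Omega>" "\<And>x. 0 \<le> \<zeta> x" "\<And>x. x \<in> S \<Longrightarrow> 1 / 2 \<le> \<zeta> x"
    using bump_function_exists[OF S(1) \<Omega>(2) S(2), of "1 / 2"] by auto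
  \<comment> \<open>As \<zeta> is at least 1/2 on the support of \<phi>, this is at least
    \<open>B\<close> there. The term \<open>0 * \<zeta> x\<close> only fits the shape of
    \<open>test_functions_lincomb\<close>.\<close>
  define \<psi> where "\<psi> = (\<lambda>x. 2 * B * \<zeta> x + 0 * \<zeta> x)"
  define \<eta> where "\<eta> = (\<lambda>x. 1 * \<phi> x + 1 * \<psi> x)"
  have \<psi>: "\<psi> \<in> test_functions \<Omega>"
    unfolding \<psi>_def by (rule test_functions_lincomb[OF \<zeta>(1) \<zeta>(1)])
  have \<eta>: "\<eta> \<in> test_functions \<Omega>"
    unfolding \<eta>_def by (rule test_functions_lincomb[OF \<phi> \<psi>])
  have \<psi>0: "0 \<le> \<psi> x" for x
    using B(1) \<zeta>(2)[of x] by (simp add: \<psi>_def)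
  have \<eta>0: "0 \<le> \<eta> x" for x
  proof (cases "x \<in> S")
    case True
    have "B * 1 \<le> B * (2 * \<zeta> x)"
      using B(1) \<zeta>(3)[OF True] by (intro mult_left_mono) auto
    then show ?thesis
      using B(2)[of x] by (simp add: \<eta>_def \<psi>_def)
  qed (use S(3) \<psi>0 in \<open>simp add: \<eta>_def\<close>)
  have pd: "partial_deriv i \<eta> = (\<lambda>x. 1 * partial_deriv i \<phi> x + 1 * partial_deriv i \<psi> x)"
    unfolding \<eta>_def by (rule partial_deriv_lincomb test_function_differentiable \<phi> \<psi>)+
  have int: "integrable (lebesgue_on \<Omega>) (\<lambda>x. ?m x * partial_deriv i \<theta> x)" if \<theta>: "\<theta> \<in> test_functions \<Omega>" for \<theta>
  proof -
    obtain B where B: "\<And>x. \<bar>partial_deriv i \<theta> x\<bar> \<le> B"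
      using partial_deriv_bounded[OF \<theta>] by blast
    show ?thesis
      using integrable_mult_AE_bounded[OF borel_measurable_lebesgue_on_continuous[OF \<Omega>(2) continuous_on_partial_deriv[OF \<theta>]]
        _ continuous_Linf_integrable[OF \<Omega> continuous_Linf_max[OF \<Omega>(2) uv]], of i B] B by (simp add: mult.commute)
  qed
  have intG: "integrable (lebesgue_on \<Omega>) (\<lambda>x. ?G x $ i * \<theta> x)" if \<theta>: "\<theta> \<in> test_functions \<Omega>" for \<theta>
    using integrable_mult_AE_bounded[OF _ _ integrable_test_function[OF \<Omega> \<theta>]] Linf_component[OF G] by blast
  have "(LINT x|lebesgue_on \<Omega>. ?m x * partial_deriv i \<eta> x)
      = (LINT x|lebesgue_on \<Omega>. ?m x * partial_deriv i \<phi> x) + (LINT x|lebesgue_on \<Omega>. ?m x * partial_deriv i \<psi> x)"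
    unfolding pd using int[OF \<phi>] int[OF \<psi>] by (simp add: distrib_left)
  moreover have "(LINT x|lebesgue_on \<Omega>. ?G x $ i * \<eta> x)
      = (LINT x|lebesgue_on \<Omega>. ?G x $ i * \<phi> x) + (LINT x|lebesgue_on \<Omega>. ?G x $ i * \<psi> x)"
    unfolding \<eta>_def using intG[OF \<phi>] intG[OF \<psi>] by (simp only: distrib_left mult_1_left Bochner_Integration.integral_add)
  ultimately show "(LINT x|lebesgue_on \<Omega>. ?m x * partial_deriv i \<phi> x) = - (LINT x|lebesgue_on \<Omega>. ?G x $ i * \<phi> x)"
    using max_weak_gradient_nonneg_test[OF \<Omega> uv lip g g' \<psi> \<psi>0, of i]
      max_weak_gradient_nonneg_test[OF \<Omega> uv lip g g' \<eta> \<eta>0, of i] by linarith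
qed

section \<open>Convergence in the three topologies\<close>

text \<open>The dual form of \<open>\<bar>g x $ i\<bar> \<le> C\<close> almost everywhere.
  Difference quotients obey the bound on compact supports, it passes to the limit for test
  functions, and \<open>Linf_pairing_bound\<close> carries it to all integrable
  \<open>h\<close>.\<close>

lemma weak_gradient_pairing_bound:
  fixes u :: "real ^ 'n \<Rightarrow> real"
  assumes \<Omega>: "bounded \<Omega>" "open \<Omega>" and u: "u \<in> continuous_Linf \<Omega>"
    and lip: "lipschitz_on_segments \<Omega> C u" and g: "has_Linf_weak_gradient \<Omega> u g"
    and h: "integrable (lebesgue_on \<Omega>) h"
  shows "\<bar>LINT x|lebesgue_on \<Omega>. g x $ i * h x\<bar> \<le> C * (LINT x|lebesgue_on \<Omega>. \<bar>h x\<bar>)"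
proof (cases "\<Omega> = {}")
  case True
  then show ?thesis
    by (simp add: integral_restrict_space)
next
  case False
  then have C0: "0 \<le> C"
    using lipschitz_on_segments_nonneg lip \<Omega> by blast
  obtain G where gm: "(\<lambda>x. g x $ i) \<in> borel_measurable (lebesgue_on \<Omega>)" "AE x in lebesgue_on \<Omega>. \<bar>g x $ i\<bar> \<le> G"
    using g Linf_component[of g \<Omega>] unfolding has_Linf_weak_gradient_def by blast
  show ?thesis
  proof (rule Linf_pairing_bound[OF \<Omega> gm _ C0 h])
    fix \<phi> assume \<phi>: "\<phi> \<in> test_functions \<Omega>"
    obtain S where S: "compact S" "S \<subseteq> \<Omega>" "\<And>x. x \<notin> S \<Longrightarrow> \<phi> x = 0"
      using \<phi> by (metis test_functionsE)
    obtain \<delta> where \<delta>0: "0 < \<delta>" and "(\<Union>x\<in>S. cball x \<delta>) \<subseteq> \<Omega>"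
      by (rule compact_subset_open_imp_cball_epsilon_subset[OF S(1) \<Omega>(2) S(2)])
    then have \<delta>: "cball x \<delta> \<subseteq> \<Omega>" if "x \<in> S" for x
      using that unfolding UN_subset_iff by blast
    define X where "X n = \<delta> * inverse (real (Suc n))" for n
    have X0: "X \<longlonglongrightarrow> 0"
      unfolding X_def using tendsto_mult[OF tendsto_const[of \<delta>] LIMSEQ_inverse_real_of_nat] by simp
    have X: "\<bar>X n\<bar> \<le> \<delta>" "X n \<noteq> 0" for n
      using \<delta>0 by (auto simp: X_def field_simps)
    have "(\<lambda>n. \<bar>LINT x|lebesgue_on \<Omega>. difference_ratio i (X n) u x * \<phi> x\<bar>)
        \<longlonglongrightarrow> \<bar>LINT x|lebesgue_on \<Omega>. g x $ i * \<phi> x\<bar>"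
      using difference_ratio_weak_convergence[OF \<Omega> u lip g integrable_test_function[OF \<Omega> \<phi>] S X0 X(2), of i]
      by (rule tendsto_rabs)
    then show "\<bar>LINT x|lebesgue_on \<Omega>. g x $ i * \<phi> x\<bar> \<le> C * (LINT x|lebesgue_on \<Omega>. \<bar>\<phi> x\<bar>)"
    proof (rule LIMSEQ_le_const2, intro exI allI impI)
      fix n
      define q where "q x = indicator S x * difference_ratio i (X n) u x" for x
      have qC: "\<bar>q x\<bar> \<le> C" for x
        using lipschitz_difference_ratio_le[OF lip \<delta> X(1,2), of x i] C0 by (auto simp: q_def indicator_def)
      have "q \<in> borel_measurable (lebesgue_on \<Omega>)"
        unfolding q_def using borel_compact[OF S(1)] continuous_Linf_borel[OF \<Omega>(2) u]
        by (intro borel_measurable_lebesgue_on borel_measurable_times borel_measurable_indicator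
            borel_measurable_difference_ratio)
      then have "\<bar>LINT x|lebesgue_on \<Omega>. q x * \<phi> x\<bar> \<le> C * (LINT x|lebesgue_on \<Omega>. \<bar>\<phi> x\<bar>)"
        by (rule abs_integral_mult_le) (use qC integrable_test_function[OF \<Omega> \<phi>] in auto)
      moreover have "difference_ratio i (X n) u x * \<phi> x = q x * \<phi> x" for x
        by (cases "x \<in> S") (simp_all add: q_def S(3))
      ultimately show "\<bar>LINT x|lebesgue_on \<Omega>. difference_ratio i (X n) u x * \<phi> x\<bar>
          \<le> C * (LINT x|lebesgue_on \<Omega>. \<bar>\<phi> x\<bar>)"
        by (simp only:)
    qed
  qed
qed

lemma abs_integral_le_sup:
  fixes w h :: "real ^ 'n \<Rightarrow> real"
  assumes "integrable (lebesgue_on \<Omega>) h" "w \<in> borel_measurable (lebesgue_on \<Omega>)" "\<And>x. x \<in> \<Omega> \<Longrightarrow> \<bar>w x\<bar> \<le> c"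
  shows "\<bar>LINT x|lebesgue_on \<Omega>. w x * h x\<bar> \<le> c * (LINT x|lebesgue_on \<Omega>. \<bar>h x\<bar>)"
  using assms by (intro abs_integral_mult_le AE_I2) (auto simp: space_restrict_space)

lemma uniform_limit_pairing:
  fixes u :: "nat \<Rightarrow> real ^ 'n \<Rightarrow> real"
  assumes \<Omega>: "bounded \<Omega>" "open \<Omega>" and u: "\<And>n. u n \<in> continuous_Linf \<Omega>" and l: "l \<in> continuous_Linf \<Omega>"
    and unif: "uniform_limit \<Omega> u l sequentially"
    and h: "integrable (lebesgue_on \<Omega>) h"
  shows "(\<lambda>n. LINT x|lebesgue_on \<Omega>. u n x * h x) \<longlonglongrightarrow> (LINT x|lebesgue_on \<Omega>. l x * h x)"
proof (rule LIMSEQ_I)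
  fix e :: real assume "0 < e"
  define H where "H = (LINT x|lebesgue_on \<Omega>. \<bar>h x\<bar>)"
  have H0: "0 \<le> H"
    unfolding H_def by simp
  define d where "d = e / (H + 1)"
  have d: "0 < d" "d * H < e"
    using \<open>0 < e\<close> H0 by (auto simp: d_def field_simps)
  have int: "integrable (lebesgue_on \<Omega>) (\<lambda>x. w x * h x)" if "w \<in> continuous_Linf \<Omega>" for w
  proof -
    obtain D where "w \<in> borel_measurable (lebesgue_on \<Omega>)" "AE x in lebesgue_on \<Omega>. \<bar>w x\<bar> \<le> D"
      using \<open>w \<in> _\<close> by (auto simp: continuous_Linf_def Linf_def)
    then show ?thesis
      by (rule integrable_mult_AE_bounded[OF _ _ h])
  qed
  have m: "w \<in> borel_measurable (lebesgue_on \<Omega>)" if "w \<in> continuous_Linf \<Omega>" for w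
    using that by (simp add: continuous_Linf_def Linf_def)
  obtain N where N: "\<And>n x. n \<ge> N \<Longrightarrow> x \<in> \<Omega> \<Longrightarrow> dist (u n x) (l x) < d"
    using uniform_limitD[OF unif d(1)] by (auto simp: eventually_sequentially)
  have "norm ((LINT x|lebesgue_on \<Omega>. u n x * h x) - (LINT x|lebesgue_on \<Omega>. l x * h x)) < e" if "n \<ge> N" for n
  proof -
    have "(LINT x|lebesgue_on \<Omega>. u n x * h x) - (LINT x|lebesgue_on \<Omega>. l x * h x)
        = (LINT x|lebesgue_on \<Omega>. (u n x - l x) * h x)"
      using int[OF u] int[OF l] by (simp add: left_diff_distrib)
    moreover have "\<bar>LINT x|lebesgue_on \<Omega>. (u n x - l x) * h x\<bar> \<le> d * H"
      unfolding H_def using N[OF that] m[OF u] m[OF l] h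
      by (intro abs_integral_le_sup) (auto simp: dist_real_def less_imp_le)
    ultimately show ?thesis
      using d(2) by simp
  qed
  then show "\<exists>no. \<forall>n\<ge>no. norm ((LINT x|lebesgue_on \<Omega>. u n x * h x) - (LINT x|lebesgue_on \<Omega>. l x * h x)) < e"
    by blast
qed

text \<open>Against a test function the gradient moves onto \<phi>, and uniform convergence
  suffices. General \<open>h\<close> are reached by density, where the common constant
  \<open>C\<close> makes the error independent of \<open>n\<close>.\<close>

lemma uniform_limit_weak_gradient_pairing:
  fixes u :: "nat \<Rightarrow> real ^ 'n \<Rightarrow> real"
  assumes \<Omega>: "bounded \<Omega>" "open \<Omega>" and u: "\<And>n. u n \<in> continuous_Linf \<Omega>" and l: "l \<in> continuous_Linf \<Omega>"
    and lip: "\<And>n. lipschitz_on_segments \<Omega> C (u n)" "lipschitz_on_segments \<Omega> C l"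
    and g: "\<And>n. has_Linf_weak_gradient \<Omega> (u n) (g n)" "has_Linf_weak_gradient \<Omega> l k"
    and unif: "uniform_limit \<Omega> u l sequentially"
    and h: "integrable (lebesgue_on \<Omega>) h"
  shows "(\<lambda>n. LINT x|lebesgue_on \<Omega>. g n x $ i * h x) \<longlonglongrightarrow> (LINT x|lebesgue_on \<Omega>. k x $ i * h x)"
proof (cases "\<Omega> = {}")
  case True
  then show ?thesis
    by (simp add: integral_restrict_space)
next
  case False
  then have C0: "0 \<le> C"
    using lipschitz_on_segments_nonneg lip \<Omega> by blast
  show ?thesis
  proof (rule LIMSEQ_I)
    fix e :: real assume "0 < e"
    define d where "d = e / (3 * (C + 1))"
    have d: "0 < d" "C * d < e / 3"
      using \<open>0 < e\<close> C0 by (auto simp: d_def field_simps)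
    obtain \<phi> where \<phi>: "\<phi> \<in> test_functions \<Omega>" and hd: "(LINT x|lebesgue_on \<Omega>. \<bar>h x - \<phi> x\<bar>) < d"
      using test_functions_dense[OF \<Omega> h d(1)] by blast
    note i\<phi> = integrable_test_function[OF \<Omega> \<phi>]
    have ig: "integrable (lebesgue_on \<Omega>) (\<lambda>x. f x $ i * \<theta> x)"
      if "f \<in> Linf \<Omega>" "integrable (lebesgue_on \<Omega>) \<theta>" for f :: "real ^ 'n \<Rightarrow> real ^ 'n" and \<theta>
      using integrable_mult_AE_bounded[OF _ _ that(2)] Linf_component[OF that(1)] by blast
    have close: "\<bar>(LINT x|lebesgue_on \<Omega>. f x $ i * h x) - (LINT x|lebesgue_on \<Omega>. f x $ i * \<phi> x)\<bar> < e / 3"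
      if "w \<in> continuous_Linf \<Omega>" "lipschitz_on_segments \<Omega> C w" "has_Linf_weak_gradient \<Omega> w f" for w f
    proof -
      have "f \<in> Linf \<Omega>"
        using that by (simp add: has_Linf_weak_gradient_def)
      then have "(LINT x|lebesgue_on \<Omega>. f x $ i * h x) - (LINT x|lebesgue_on \<Omega>. f x $ i * \<phi> x)
          = (LINT x|lebesgue_on \<Omega>. f x $ i * (h x - \<phi> x))"
        using ig h i\<phi> by (simp add: right_diff_distrib)
      moreover have "\<bar>LINT x|lebesgue_on \<Omega>. f x $ i * (h x - \<phi> x)\<bar> \<le> C * (LINT x|lebesgue_on \<Omega>. \<bar>h x - \<phi> x\<bar>)"
        by (rule weak_gradient_pairing_bound[OF \<Omega> that]) (use h i\<phi> in simp)
      moreover have "\<dots> \<le> C * d"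
        using hd C0 by (intro mult_left_mono) auto
      ultimately show ?thesis
        using d(2) by linarith
    qed
    have "(\<lambda>n. LINT x|lebesgue_on \<Omega>. u n x * partial_deriv i \<phi> x) \<longlonglongrightarrow> (LINT x|lebesgue_on \<Omega>. l x * partial_deriv i \<phi> x)"
      by (rule uniform_limit_pairing[OF \<Omega> u l unif integrable_partial_deriv[OF \<Omega> \<phi>]])
    then have "(\<lambda>n. LINT x|lebesgue_on \<Omega>. g n x $ i * \<phi> x) \<longlonglongrightarrow> (LINT x|lebesgue_on \<Omega>. k x $ i * \<phi> x)"
      using g \<phi> by (simp add: has_Linf_weak_gradient_def tendsto_minus_cancel_left)
    then obtain N where N: "\<And>n. n \<ge> N \<Longrightarrow>
        norm ((LINT x|lebesgue_on \<Omega>. g n x $ i * \<phi> x) - (LINT x|lebesgue_on \<Omega>. k x $ i * \<phi> x)) < e / 3"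
      using LIMSEQ_D[of _ _ "e / 3"] \<open>0 < e\<close> by force
    have "norm ((LINT x|lebesgue_on \<Omega>. g n x $ i * h x) - (LINT x|lebesgue_on \<Omega>. k x $ i * h x)) < e" if "n \<ge> N" for n
      using N[OF that] close[OF u lip(1) g(1), of n] close[OF l lip(2) g(2)] unfolding real_norm_def by linarith
    then show "\<exists>no. \<forall>n\<ge>no. norm ((LINT x|lebesgue_on \<Omega>. g n x $ i * h x) - (LINT x|lebesgue_on \<Omega>. k x $ i * h x)) < e"
      by blast
  qed
qed

section \<open>Sequential limits in the topologies\<close>

lemma limitin_topology_generated_by:
  assumes "l \<in> \<Union>\<S>" and "\<And>U. U \<in> \<S> \<Longrightarrow> l \<in> U \<Longrightarrow> \<forall>\<^sub>F x in F. \<sigma> x \<in> U"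
  shows "limitin (topology_generated_by \<S>) \<sigma> l F"
proof -
  have "\<forall>\<^sub>F x in F. \<sigma> x \<in> U" if "generate_topology_on \<S> U" "l \<in> U" for U
    using that
  proof induction
    case (UN K)
    then obtain k where "k \<in> K" "l \<in> k"
      by blast
    then show ?case
      using UN.IH[of k] by (auto elim!: eventually_mono)
  qed (use assms in \<open>auto simp: eventually_conj_iff\<close>)
  then show ?thesis
    using assms by (simp add: limitin_def openin_topology_generated_by_iff)
qed

lemma limitin_pullback_topology:
  assumes "l \<in> A" "\<And>n. \<sigma> n \<in> A" "limitin T (\<lambda>n. f (\<sigma> n)) (f l) F"
  shows "limitin (pullback_topology A f T) \<sigma> l F"
  using assms unfolding limitin_def topspace_pullback_topology openin_pullback_topology
  by (auto elim!: eventually_mono)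

lemma limitin_weak_star_Linf:
  fixes l :: "real ^ 'n \<Rightarrow> 'b::euclidean_space"
  assumes "l \<in> Linf \<Omega>" "\<And>n. \<sigma> n \<in> Linf \<Omega>"
    and "\<And>h. integrable (lebesgue_on \<Omega>) h \<Longrightarrow>
      (\<lambda>n. LINT x|lebesgue_on \<Omega>. \<sigma> n x \<bullet> h x) \<longlonglongrightarrow> (LINT x|lebesgue_on \<Omega>. l x \<bullet> h x)"
  shows "limitin (weak_star_Linf \<Omega>) \<sigma> l sequentially"
  unfolding weak_star_Linf_def
proof (rule limitin_topology_generated_by)
  show "l \<in> \<Union>{{g \<in> Linf \<Omega>. (LINT x|lebesgue_on \<Omega>. g x \<bullet> h x) \<in> U} |h U. integrable (lebesgue_on \<Omega>) h \<and> open U}"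
    using assms(1) topspace_weak_star_Linf[of \<Omega>, where ?'b = 'b]
    unfolding weak_star_Linf_def topology_generated_by_topspace by simp
next
  fix U assume "U \<in> {{g \<in> Linf \<Omega>. (LINT x|lebesgue_on \<Omega>. g x \<bullet> h x) \<in> U} |h U. integrable (lebesgue_on \<Omega>) h \<and> open U}"
    and "l \<in> U"
  then obtain h V where hV: "integrable (lebesgue_on \<Omega>) h" "open V" "(LINT x|lebesgue_on \<Omega>. l x \<bullet> h x) \<in> V"
    and U: "U = {g \<in> Linf \<Omega>. (LINT x|lebesgue_on \<Omega>. g x \<bullet> h x) \<in> V}"
    by blast
  show "\<forall>\<^sub>F n in sequentially. \<sigma> n \<in> U"
    using topological_tendstoD[OF assms(3)[OF hV(1)] hV(2,3)] assms(2) by (simp add: U)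
qed

lemma limitin_weak_star_W:
  fixes u :: "nat \<Rightarrow> real ^ 'n \<Rightarrow> real"
  assumes \<Omega>: "bounded \<Omega>" "open \<Omega>" and u: "\<And>n. u n \<in> W1inf \<Omega>" and l: "l \<in> W1inf \<Omega>"
    and lip: "\<And>n. lipschitz_on_segments \<Omega> C (u n)" "lipschitz_on_segments \<Omega> C l"
    and unif: "uniform_limit \<Omega> u l sequentially"
  shows "limitin (weak_star_W \<Omega>) u l sequentially"
  unfolding weak_star_W_def
proof (rule limitin_pullback_topology[OF l u])
  have cL: "u n \<in> continuous_Linf \<Omega>" "l \<in> continuous_Linf \<Omega>" for n
    using u l by (auto simp: W1inf_iff)
  have L: "u n \<in> Linf \<Omega>" "l \<in> Linf \<Omega>" for n
    using cL by (auto simp: continuous_Linf_def)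
  have "limitin (weak_star_Linf \<Omega>) u l sequentially"
    using uniform_limit_pairing[OF \<Omega> cL unif] by (intro limitin_weak_star_Linf L) simp
  moreover have "limitin (weak_star_Linf \<Omega>) (\<lambda>n. weak_gradient \<Omega> (u n)) (weak_gradient \<Omega> l) sequentially"
  proof (intro limitin_weak_star_Linf weak_gradient_in_Linf u l)
    fix h :: "real ^ 'n \<Rightarrow> real ^ 'n" assume h: "integrable (lebesgue_on \<Omega>) h"
    have hi: "integrable (lebesgue_on \<Omega>) (\<lambda>x. h x $ i)" for i
      using integrable_bounded_linear[OF bounded_linear_vec_nth h] .
    have int: "integrable (lebesgue_on \<Omega>) (\<lambda>x. f x $ i * h x $ i)" if "f \<in> Linf \<Omega>" for f :: "real ^ 'n \<Rightarrow> real ^ 'n" and i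
      using integrable_mult_AE_bounded[OF _ _ hi] Linf_component[OF that] by blast
    have eq: "(LINT x|lebesgue_on \<Omega>. f x \<bullet> h x) = (\<Sum>i\<in>UNIV. LINT x|lebesgue_on \<Omega>. f x $ i * h x $ i)"
      if "f \<in> Linf \<Omega>" for f :: "real ^ 'n \<Rightarrow> real ^ 'n"
      using int[OF that] by (simp add: inner_vec_def)
    show "(\<lambda>n. LINT x|lebesgue_on \<Omega>. weak_gradient \<Omega> (u n) x \<bullet> h x)
        \<longlonglongrightarrow> (LINT x|lebesgue_on \<Omega>. weak_gradient \<Omega> l x \<bullet> h x)"
      unfolding eq[OF weak_gradient_in_Linf[OF u]] eq[OF weak_gradient_in_Linf[OF l]]
      by (intro tendsto_sum uniform_limit_weak_gradient_pairing[OF \<Omega> cL lip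
            weak_gradient_works[OF u] weak_gradient_works[OF l] unif hi])
  qed
  ultimately show "limitin (prod_topology (weak_star_Linf \<Omega>) (weak_star_Linf \<Omega>))
      (\<lambda>n. (u n, weak_gradient \<Omega> (u n))) (l, weak_gradient \<Omega> l) sequentially"
    by (simp add: limitin_pairwise comp_def)
qed

lemma AE_Linf_norm:
  fixes w :: "real ^ 'n \<Rightarrow> 'b::euclidean_space"
  assumes "Linf_norm \<Omega> w < ereal c"
  shows "AE x in lebesgue_on \<Omega>. norm (w x) \<le> c"
proof -
  have "AE x in lebesgue_on \<Omega>. ereal (norm (w x)) \<le> Linf_norm \<Omega> w"
    unfolding Linf_norm_def by (rule esssup_AE)
  then show ?thesis
    by eventually_elim (metis assms ereal_less_eq(3) less_imp_le order_trans)
qed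

lemma limitin_tau_inf:
  fixes u :: "nat \<Rightarrow> real ^ 'n \<Rightarrow> real"
  assumes u: "\<And>n. u n \<in> W1inf \<Omega>" and l: "l \<in> W1inf \<Omega>"
    and unif: "uniform_limit \<Omega> u l sequentially"
  shows "limitin (tau_inf \<Omega>) u l sequentially"
  unfolding tau_inf_def
proof (rule limitin_topology_generated_by)
  show "l \<in> \<Union>{{v \<in> W1inf \<Omega>. Linf_norm \<Omega> (\<lambda>x. v x - u x) < ereal e} |u e. u \<in> W1inf \<Omega> \<and> e > 0}"
    using l topspace_tau_inf[of \<Omega>] unfolding tau_inf_def topology_generated_by_topspace by simp
next
  have m: "w \<in> borel_measurable (lebesgue_on \<Omega>)" if "w \<in> W1inf \<Omega>" for w
    using that by (simp add: W1inf_def Linf_def)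
  fix U assume "U \<in> {{v \<in> W1inf \<Omega>. Linf_norm \<Omega> (\<lambda>x. v x - u x) < ereal e} |u e. u \<in> W1inf \<Omega> \<and> e > 0}"
    and "l \<in> U"
  then obtain w e where w: "w \<in> W1inf \<Omega>" "Linf_norm \<Omega> (\<lambda>x. l x - w x) < ereal e"
    and U: "U = {v \<in> W1inf \<Omega>. Linf_norm \<Omega> (\<lambda>x. v x - w x) < ereal e}"
    by blast
  \<comment> \<open>The subbasic ball is centred at \<open>w\<close> and not at the limit
    \<open>l\<close>, so room has to be left between the norm of \<open>l - w\<close> and
    \<open>e\<close>.\<close>
  obtain c where c: "Linf_norm \<Omega> (\<lambda>x. l x - w x) < ereal c" "c < e"
    using ereal_dense2[OF w(2)] by auto
  define d where "d = (e - c) / 2"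
  have d: "0 < d" "c + d < e"
    using c(2) by (auto simp: d_def field_simps)
  obtain N where N: "\<And>n x. n \<ge> N \<Longrightarrow> x \<in> \<Omega> \<Longrightarrow> dist (u n x) (l x) < d"
    using uniform_limitD[OF unif d(1)] by (auto simp: eventually_sequentially)
  have "Linf_norm \<Omega> (\<lambda>x. u n x - w x) < ereal e" if "n \<ge> N" for n
  proof -
    have "AE x in lebesgue_on \<Omega>. norm (u n x - l x) \<le> d"
      using N[OF that] by (intro AE_I2) (auto simp: space_restrict_space dist_norm less_imp_le)
    then have "AE x in lebesgue_on \<Omega>. ereal (norm (u n x - w x)) \<le> ereal (c + d)"
      using AE_Linf_norm[OF c(1)] by eventually_elim auto
    then have "Linf_norm \<Omega> (\<lambda>x. u n x - w x) \<le> ereal (c + d)"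
      unfolding Linf_norm_def using m[OF u] m[OF w(1)] by (intro esssup_I) auto
    then show ?thesis
      using d(2) by (auto elim: le_less_trans)
  qed
  then show "\<forall>\<^sub>F n in sequentially. u n \<in> U"
    using u by (auto simp: U eventually_sequentially)
qed

lemma seq_closedin_if_closedin: "closedin X C \<Longrightarrow> seq_closedin X C"
  unfolding seq_closedin_def
  by (auto dest: closedin_subset intro: limitin_closedin[OF _ _ always_eventually])

text \<open>One sequence serves all three topologies: closed sets of the two weak ones are
  sequentially weakly-star closed, and those of \<open>tau_inf\<close> contain uniform
  limits.\<close>

lemma closedin_uniform_limit:
  fixes u :: "nat \<Rightarrow> real ^ 'n \<Rightarrow> real"
  assumes \<Omega>: "bounded \<Omega>" "open \<Omega>"
    and \<tau>: "\<tau> \<in> {tau_inf \<Omega>, weak_star_W \<Omega>, seq_topology (weak_star_W \<Omega>)}"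
    and D: "closedin \<tau> D" "\<And>n. u n \<in> D"
    and u: "\<And>n. u n \<in> W1inf \<Omega>" and l: "l \<in> W1inf \<Omega>"
    and lip: "\<And>n. lipschitz_on_segments \<Omega> C (u n)" "lipschitz_on_segments \<Omega> C l"
    and unif: "uniform_limit \<Omega> u l sequentially"
  shows "l \<in> D"
proof -
  have w: "limitin (weak_star_W \<Omega>) u l sequentially"
    by (rule limitin_weak_star_W[OF \<Omega> u l lip unif])
  have "seq_closedin (weak_star_W \<Omega>) D \<or> closedin (tau_inf \<Omega>) D"
    using \<tau> D(1) by (auto simp: closedin_seq_topology seq_closedin_if_closedin)
  then show ?thesis
  proof
    assume "seq_closedin (weak_star_W \<Omega>) D"
    then show ?thesis
      using w D(2) unfolding seq_closedin_def by blast
  next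
    assume "closedin (tau_inf \<Omega>) D"
    then show ?thesis
      using limitin_closedin[OF limitin_tau_inf[OF u l unif]] D(2) by auto
  qed
qed

section \<open>Open half-spaces and closed sublevels\<close>

lemma openin_seq_topology: "openin X U \<Longrightarrow> openin (seq_topology X) U"
  by (simp add: openin_closedin_eq closedin_seq_topology topspace_seq_topology seq_closedin_if_closedin)

text \<open>These half-spaces will separate a function from a sublevel. For the weak-star topology
  they come from a subbasic set, for \<open>tau_inf\<close> from the L1 bound of the pairing, and
  the sequential topology is finer than the weak-star one.\<close>

lemma openin_pairing_greater:
  fixes h :: "real ^ 'n \<Rightarrow> real"
  assumes \<Omega>: "bounded \<Omega>" "open \<Omega>"
    and \<tau>: "\<tau> \<in> {tau_inf \<Omega>, weak_star_W \<Omega>, seq_topology (weak_star_W \<Omega>)}"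
    and h: "integrable (lebesgue_on \<Omega>) h"
  shows "openin \<tau> {v \<in> W1inf \<Omega>. c < (LINT x|lebesgue_on \<Omega>. v x * h x)}" (is "openin \<tau> ?U")
proof -
  have W: "openin (weak_star_W \<Omega>) ?U"
  proof -
    have "openin (weak_star_Linf \<Omega>) {v \<in> Linf \<Omega>. (LINT x|lebesgue_on \<Omega>. v x \<bullet> h x) \<in> {c<..}}"
      unfolding weak_star_Linf_def using h
      by (intro topology_generated_by_Basis CollectI exI[of _ h] exI[of _ "{c<..}"] conjI refl) auto
    moreover have "openin (weak_star_Linf \<Omega> :: (real ^ 'n \<Rightarrow> real ^ 'n) topology) (Linf \<Omega>)"
      using openin_topspace[of "weak_star_Linf \<Omega> :: (real ^ 'n \<Rightarrow> real ^ 'n) topology"]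
      by (simp only: topspace_weak_star_Linf)
    ultimately have "openin (prod_topology (weak_star_Linf \<Omega>) (weak_star_Linf \<Omega> :: (real ^ 'n \<Rightarrow> real ^ 'n) topology))
        ({v \<in> Linf \<Omega>. (LINT x|lebesgue_on \<Omega>. v x \<bullet> h x) \<in> {c<..}} \<times> Linf \<Omega>)"
      by (simp only: openin_prod_Times_iff) simp
    moreover have "?U = (\<lambda>u. (u, weak_gradient \<Omega> u)) -`
        ({v \<in> Linf \<Omega>. (LINT x|lebesgue_on \<Omega>. v x \<bullet> h x) \<in> {c<..}} \<times> Linf \<Omega>) \<inter> W1inf \<Omega>"
      using weak_gradient_in_Linf by (auto simp: W1inf_def)
    ultimately show ?thesis
      unfolding weak_star_W_def openin_pullback_topology by blast
  qed
  have T: "openin (tau_inf \<Omega>) ?U"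
  proof (subst openin_subopen, intro ballI)
    fix u assume u: "u \<in> ?U"
    define H where "H = (LINT x|lebesgue_on \<Omega>. \<bar>h x\<bar>)"
    have H0: "0 \<le> H"
      unfolding H_def by simp
    \<comment> \<open>On the sup-norm ball of radius \<open>e\<close> the pairing changes by at most
      \<open>e * H\<close>, less than its excess over \<open>c\<close> at \<open>u\<close>.\<close>
    define e where "e = ((LINT x|lebesgue_on \<Omega>. u x * h x) - c) / (H + 1)"
    have e: "0 < e" "e * H < (LINT x|lebesgue_on \<Omega>. u x * h x) - c"
      using u H0 by (auto simp: e_def field_simps)
    define V where "V = {v \<in> W1inf \<Omega>. Linf_norm \<Omega> (\<lambda>x. v x - u x) < ereal e}"
    have "openin (tau_inf \<Omega>) V"
      unfolding tau_inf_def V_def using u e(1)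
      by (intro topology_generated_by_Basis CollectI exI[of _ u] exI[of _ e] conjI refl) auto
    moreover have "u \<in> V"
    proof -
      have "Linf_norm \<Omega> (\<lambda>x. u x - u x) \<le> 0"
        unfolding Linf_norm_def by (rule esssup_I) auto
      then show ?thesis
        using u e(1) by (auto simp: V_def intro: le_less_trans)
    qed
    moreover have "V \<subseteq> ?U"
    proof
      fix v assume v: "v \<in> V"
      have m: "w \<in> borel_measurable (lebesgue_on \<Omega>) \<and> integrable (lebesgue_on \<Omega>) (\<lambda>x. w x * h x)"
        if "w \<in> W1inf \<Omega>" for w
        using that integrable_mult_AE_bounded[OF _ _ h, of w] by (auto simp: W1inf_def Linf_def)
      have "AE x in lebesgue_on \<Omega>. \<bar>v x - u x\<bar> \<le> e"
        using v AE_Linf_norm[of \<Omega> "\<lambda>x. v x - u x" e] by (simp add: V_def)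
      then have "\<bar>LINT x|lebesgue_on \<Omega>. (v x - u x) * h x\<bar> \<le> e * H"
        unfolding H_def using m[of u] m[of v] u v h
        by (intro abs_integral_mult_le borel_measurable_diff) (auto simp: V_def)
      moreover have "(LINT x|lebesgue_on \<Omega>. (v x - u x) * h x)
          = (LINT x|lebesgue_on \<Omega>. v x * h x) - (LINT x|lebesgue_on \<Omega>. u x * h x)"
        using m u v by (simp add: V_def left_diff_distrib)
      ultimately show "v \<in> ?U"
        using v e(2) by (simp add: V_def)
    qed
    ultimately show "\<exists>T. openin (tau_inf \<Omega>) T \<and> u \<in> T \<and> T \<subseteq> ?U"
      by blast
  qed
  show ?thesis
    using \<tau> T W openin_seq_topology[OF W] by auto
qed

lemma ball_average_bounds:
  fixes v :: "real ^ 'n \<Rightarrow> real"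
  assumes \<Omega>: "bounded \<Omega>" "open \<Omega>" and v: "v \<in> continuous_Linf \<Omega>"
    and b: "0 < e" "ball x e \<subseteq> \<Omega>" "\<And>z. z \<in> ball x e \<Longrightarrow> a \<le> v z \<and> v z \<le> b"
  defines "h \<equiv> \<lambda>z. indicator (ball x e) z / measure lebesgue (ball x e)"
  shows "integrable (lebesgue_on \<Omega>) h"
    "integrable (lebesgue_on \<Omega>) (\<lambda>z. v z * h z)"
    "a \<le> (LINT z|lebesgue_on \<Omega>. v z * h z)" "(LINT z|lebesgue_on \<Omega>. v z * h z) \<le> b"
proof -
  interpret finite_measure "lebesgue_on \<Omega>"
    by (rule finite_measure_lebesgue_on_bounded[OF \<Omega>])
  have bs: "ball x e \<in> sets (lebesgue_on \<Omega>)"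
    using b(2) \<Omega>(2) by (auto simp: sets_restrict_space_iff)
  have mb: "measure (lebesgue_on \<Omega>) (ball x e) = measure lebesgue (ball x e)"
    using \<Omega>(2) b(2) by (intro measure_restrict_space) auto
  have pos: "0 < measure lebesgue (ball x e)"
    using content_ball_pos[OF b(1), of x] by (simp add: measure_completion)
  have ii: "integrable (lebesgue_on \<Omega>) (indicator (ball x e) :: _ \<Rightarrow> real)"
    using bs by (intro integrable_real_indicator) (simp_all add: less_top[symmetric] emeasure_finite)
  then show ih: "integrable (lebesgue_on \<Omega>) h"
    unfolding h_def by simp
  obtain D where "v \<in> borel_measurable (lebesgue_on \<Omega>)" "AE x in lebesgue_on \<Omega>. \<bar>v x\<bar> \<le> D"
    using v by (auto simp: continuous_Linf_def Linf_def)
  then show iv: "integrable (lebesgue_on \<Omega>) (\<lambda>z. v z * h z)"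
    by (rule integrable_mult_AE_bounded[OF _ _ ih])
  have ic: "integrable (lebesgue_on \<Omega>) (\<lambda>z. c * h z)" for c
    using ih by simp
  have "(LINT z|lebesgue_on \<Omega>. h z) = 1"
    using ii pos bs sets.sets_into_space[OF bs] by (simp add: h_def mb Int_absorb2)
  then have one: "(LINT z|lebesgue_on \<Omega>. c * h z) = c" for c
    by simp
  have "(LINT z|lebesgue_on \<Omega>. a * h z) \<le> (LINT z|lebesgue_on \<Omega>. v z * h z)"
    using b(3) pos by (intro integral_mono ic iv) (auto simp: h_def indicator_def divide_right_mono)
  then show "a \<le> (LINT z|lebesgue_on \<Omega>. v z * h z)"
    by (simp only: one)
  have "(LINT z|lebesgue_on \<Omega>. v z * h z) \<le> (LINT z|lebesgue_on \<Omega>. b * h z)"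
    using b(3) pos by (intro integral_mono ic iv) (auto simp: h_def indicator_def divide_right_mono)
  then show "(LINT z|lebesgue_on \<Omega>. v z * h z) \<le> b"
    by (simp only: one)
qed

text \<open>
  Point evaluations are replaced by averages over small balls, which are continuous in all three
  topologies; the error is controlled by the common Lipschitz constant of the sublevel.
\<close>

lemma closedin_difference_sublevel:
  fixes D :: "real ^ 'n \<Rightarrow> real ^ 'n \<Rightarrow> real"
  assumes \<Omega>: "bounded \<Omega>" "open \<Omega>"
    and \<tau>: "\<tau> \<in> {tau_inf \<Omega>, weak_star_W \<Omega>, seq_topology (weak_star_W \<Omega>)}"
    and lip: "\<And>v. (\<And>x y. x \<in> \<Omega> \<Longrightarrow> y \<in> \<Omega> \<Longrightarrow> v x - v y \<le> D x y) \<Longrightarrow> lipschitz_on_segments \<Omega> C v"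
  shows "closedin \<tau> {v \<in> W1inf \<Omega>. \<forall>x\<in>\<Omega>. \<forall>y\<in>\<Omega>. v x - v y \<le> D x y}" (is "closedin \<tau> ?S")
proof -
  have top: "topspace \<tau> = W1inf \<Omega>"
    using \<tau> by (auto simp: topspace_tau_inf topspace_weak_star_W topspace_seq_topology)
  have "openin \<tau> (W1inf \<Omega> - ?S)"
  proof (subst openin_subopen, intro ballI)
    fix u assume u: "u \<in> W1inf \<Omega> - ?S"
    then obtain x y where xy: "x \<in> \<Omega>" "y \<in> \<Omega>" "D x y < u x - u y"
      by auto
    have uc: "u \<in> continuous_Linf \<Omega>"
      using u by (simp add: W1inf_iff)
    \<comment> \<open>A quarter of the excess: averaging \<open>u\<close> costs \<eta> at each of
      the two points, and averaging a member of the sublevel less than \<eta> at each.\<close>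
    define \<eta> where "\<eta> = (u x - u y - D x y) / 4"
    have \<eta>: "0 < \<eta>" "D x y + 4 * \<eta> = u x - u y"
      using xy by (simp_all add: \<eta>_def field_simps)
    have "\<exists>d>0. ball x d \<subseteq> \<Omega> \<and> (\<forall>z\<in>ball x d. u x - \<eta> \<le> u z \<and> u z \<le> u x + \<eta>)" if x: "x \<in> \<Omega>" for x
    proof -
      have "isCont u x"
        using uc x \<Omega>(2) by (auto simp: continuous_Linf_def continuous_on_eq_continuous_at)
      then obtain d1 where d1: "0 < d1" "\<And>z. dist z x < d1 \<Longrightarrow> dist (u z) (u x) < \<eta>"
        using \<eta>(1) by (auto simp: continuous_at_eps_delta)
      obtain d2 where d2: "0 < d2" "ball x d2 \<subseteq> \<Omega>"
        using \<Omega>(2) x by (auto simp: open_contains_ball)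
      have "u x - \<eta> \<le> u z \<and> u z \<le> u x + \<eta>" if "z \<in> ball x (min d1 d2)" for z
        using d1(2)[of z] that by (auto simp: dist_commute dist_real_def)
      then show ?thesis
        using d1 d2 by (intro exI[of _ "min d1 d2"]) auto
    qed
    then obtain d1 d2 where d1: "0 < d1" "ball x d1 \<subseteq> \<Omega>" "\<And>z. z \<in> ball x d1 \<Longrightarrow> u x - \<eta> \<le> u z \<and> u z \<le> u x + \<eta>"
      and d2: "0 < d2" "ball y d2 \<subseteq> \<Omega>" "\<And>z. z \<in> ball y d2 \<Longrightarrow> u y - \<eta> \<le> u z \<and> u z \<le> u y + \<eta>"
      using xy by meson
    define e where "e = Min {d1, d2, \<eta> / (2 * (\<bar>C\<bar> + 1))}"
    have e: "0 < e" "e \<le> d1" "e \<le> d2" "\<bar>C\<bar> * e < \<eta>"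
    proof -
      show "0 < e" "e \<le> d1" "e \<le> d2"
        using d1 d2 \<eta> by (auto simp: e_def)
      have "\<bar>C\<bar> * e \<le> \<bar>C\<bar> * (\<eta> / (2 * (\<bar>C\<bar> + 1)))"
        by (intro mult_left_mono) (auto simp: e_def)
      also have "\<dots> < \<eta>"
        using \<eta>(1) by (simp add: field_simps add_strict_increasing2)
      finally show "\<bar>C\<bar> * e < \<eta>" .
    qed
    have sub: "ball x e \<subseteq> \<Omega>" "ball y e \<subseteq> \<Omega>"
      using e d1(2) d2(2) by (meson order_trans subset_ball)+
    define h where "h c z = indicator (ball c e) z / measure lebesgue (ball c e)" for c z :: "real ^ 'n"
    note avg = ball_average_bounds[OF \<Omega> _ e(1), folded h_def]
    have split: "(LINT z|lebesgue_on \<Omega>. v z * (h x z - h y z))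
        = (LINT z|lebesgue_on \<Omega>. v z * h x z) - (LINT z|lebesgue_on \<Omega>. v z * h y z)"
      if "integrable (lebesgue_on \<Omega>) (\<lambda>z. v z * h x z)" "integrable (lebesgue_on \<Omega>) (\<lambda>z. v z * h y z)" for v
      using that by (simp add: right_diff_distrib)
    have ux: "u x - \<eta> \<le> u z \<and> u z \<le> u x + \<eta>" if "z \<in> ball x e" for z
      using d1(3) that e(2) by auto
    have uy: "u y - \<eta> \<le> u z \<and> u z \<le> u y + \<eta>" if "z \<in> ball y e" for z
      using d2(3) that e(3) by auto
    note ax = avg[OF uc sub(1) ux] and ay = avg[OF uc sub(2) uy]
    \<comment> \<open>An upper bound for the difference of averages of any \<open>v\<close> in the
      sublevel: \<open>v x - v y \<le> D x y\<close>, and each average is within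
      \<open>\<bar>C\<bar> * e\<close> of the value at the centre. By the choice of \<open>e\<close>
      it is below \<open>D x y + 2 * \<eta>\<close>, hence below the difference for
      \<open>u\<close>.\<close>
    define c where "c = D x y + 2 * (\<bar>C\<bar> * e)"
    define U where "U = {v \<in> W1inf \<Omega>. c < (LINT z|lebesgue_on \<Omega>. v z * (h x z - h y z))}"
    have "openin \<tau> U"
      unfolding U_def using ax(1) ay(1) by (intro openin_pairing_greater[OF \<Omega> \<tau>]) simp
    moreover have "u \<in> U"
    proof -
      have "c < (LINT z|lebesgue_on \<Omega>. u z * (h x z - h y z))"
        using split[OF ax(2) ay(2)] ax(3) ay(4) \<eta> e(4) unfolding c_def by linarith
      then show ?thesis
        using u by (simp add: U_def)
    qed
    moreover have "U \<subseteq> W1inf \<Omega> - ?S"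
    proof
      fix v assume v: "v \<in> U"
      have "\<not> (\<forall>x\<in>\<Omega>. \<forall>y\<in>\<Omega>. v x - v y \<le> D x y)"
      proof
        assume S: "\<forall>x\<in>\<Omega>. \<forall>y\<in>\<Omega>. v x - v y \<le> D x y"
        then have L: "lipschitz_on_segments \<Omega> C v"
          by (intro lip) blast
        have near: "v p - \<bar>C\<bar> * e \<le> v z \<and> v z \<le> v p + \<bar>C\<bar> * e" if "ball p e \<subseteq> \<Omega>" "z \<in> ball p e" for p z
        proof -
          have "closed_segment p z \<subseteq> ball p e"
            using that e(1) by (intro closed_segment_subset) auto
          then have "\<bar>v p - v z\<bar> \<le> C * norm (p - z)"
            using L that(1) unfolding lipschitz_on_segments_def by blast
          also have "\<dots> \<le> \<bar>C\<bar> * e"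
            using that(2) by (intro mult_mono) (auto simp: dist_norm)
          finally show ?thesis
            by (auto simp: abs_le_iff)
        qed
        have vc: "v \<in> continuous_Linf \<Omega>"
          using v by (simp add: U_def W1inf_iff)
        note bx = avg[OF vc sub(1) near[OF sub(1)]] and by' = avg[OF vc sub(2) near[OF sub(2)]]
        have "c < (LINT z|lebesgue_on \<Omega>. v z * h x z) - (LINT z|lebesgue_on \<Omega>. v z * h y z)"
          using v split[OF bx(2) by'(2)] by (simp add: U_def)
        then have "c < v x - v y + 2 * (\<bar>C\<bar> * e)"
          using bx(4) by'(3) by linarith
        then show False
          using S xy by (force simp: c_def)
      qed
      then show "v \<in> W1inf \<Omega> - ?S"
        using v by (auto simp: U_def)
    qed
    ultimately show "\<exists>T. openin \<tau> T \<and> u \<in> T \<and> T \<subseteq> W1inf \<Omega> - ?S"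
      by blast
  qed
  then show ?thesis
    by (auto simp: closedin_def top)
qed

section \<open>Functions that are Lipschitz on segments\<close>

text \<open>The straight path competes in the infimum, and its variation telescopes over every
  partition. Through it the upper bound on \<open>d1\<close> becomes a Lipschitz bound on
  segments.\<close>

lemma geodetic_dist_le_segment:
  fixes x y :: "'a::real_normed_vector"
  assumes "closed_segment x y \<subseteq> \<Omega>"
  shows "geodetic_dist \<Omega> x y \<le> ereal (norm (x - y))"
proof -
  have d: "dist (linepath x y s) (linepath x y t) = \<bar>s - t\<bar> * norm (x - y)" for s t
  proof -
    have "linepath x y s - linepath x y t = (t - s) *\<^sub>R (x - y)"
      by (simp add: linepath_def algebra_simps)
    then show ?thesis
      by (simp add: dist_norm abs_minus_commute)
  qed
  have "(norm (x - y))-lipschitz_on {0..1} (linepath x y)"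
    by (rule lipschitz_onI) (auto simp: d dist_real_def mult.commute)
  then have "geodetic_dist \<Omega> x y \<le> curve_length (linepath x y)"
    unfolding geodetic_dist_def using assms
    by (intro INF_lower) (auto simp: linepath_image_01 linepath_0' linepath_1')
  also have "\<dots> \<le> ereal (norm (x - y))"
    unfolding curve_length_def
  proof (intro SUP_least, clarify)
    fix n and t :: "nat \<Rightarrow> real" assume t: "mono t" "range t \<subseteq> {0..1}"
    have "(\<Sum>i<n. dist (linepath x y (t i)) (linepath x y (t (Suc i)))) = (\<Sum>i<n. (t (Suc i) - t i) * norm (x - y))"
      using monoD[OF t(1), of _ "Suc _"] by (intro sum.cong) (auto simp: d)
    also have "\<dots> = (t n - t 0) * norm (x - y)"
      by (simp add: sum_distrib_right[symmetric] sum_lessThan_telescope)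
    also have "\<dots> \<le> 1 * norm (x - y)"
    proof (intro mult_right_mono)
      have "t n \<in> {0..1}" "t 0 \<in> {0..1}"
        using t(2) by blast+
      then show "t n - t 0 \<le> 1"
        by simp
    qed simp
    finally show "ereal (\<Sum>i<n. dist (linepath x y (t i)) (linepath x y (t (Suc i)))) \<le> ereal (norm (x - y))"
      by simp
  qed
  finally show ?thesis .
qed

text \<open>
  Near a boundary point, two points \<open>x\<close>, \<open>y\<close> above the graph are joined inside the domain by
  lifting both by \<open>L * norm (x - y)\<close>: the lifted segment stays above the \<open>L\<close>-Lipschitz graph.
\<close>

lemma lipschitz_boundary_local_bound:
  fixes \<Omega> :: "(real ^ 'n) set"
  assumes "open \<Omega>" and bd: "lipschitz_boundary \<Omega>" and x0: "x0 \<in> frontier \<Omega>"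
  shows "\<exists>r>0. \<exists>L\<ge>0. \<forall>d x y v. (2 * L + 1) * d \<le> r \<longrightarrow> x \<in> \<Omega> \<inter> ball x0 d \<longrightarrow> y \<in> \<Omega> \<inter> ball x0 d \<longrightarrow>
    lipschitz_on_segments \<Omega> C v \<longrightarrow> \<bar>v x - v y\<bar> \<le> C * ((2 * L + 1) * norm (x - y))"
proof -
  obtain r \<nu> \<gamma> L where r: "0 < r" and \<nu>: "norm \<nu> = 1" and \<gamma>: "L-lipschitz_on {y. y \<bullet> \<nu> = 0} \<gamma>"
    and graph: "\<Omega> \<inter> ball x0 r = {x \<in> ball x0 r. \<gamma> (x - (x \<bullet> \<nu>) *\<^sub>R \<nu>) < x \<bullet> \<nu>}"
    using bd x0 unfolding lipschitz_boundary_def by blast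
  have L: "0 \<le> L"
    using \<gamma> by (rule lipschitz_on_nonneg)
  \<comment> \<open>The orthogonal projection onto the hyperplane on which \<gamma> is given. It
    does not increase distances, so \<gamma> after \<open>P\<close> is still
    \<open>L\<close>-Lipschitz.\<close>
  define P where "P x = x - (x \<bullet> \<nu>) *\<^sub>R \<nu>" for x
  have \<nu>1: "\<nu> \<bullet> \<nu> = 1"
    using \<nu> by (simp add: norm_eq_1)
  have P0: "P x \<bullet> \<nu> = 0" for x
    by (simp add: P_def inner_diff_left \<nu>1)
  have Pdiff: "norm (P x - P y) \<le> norm (x - y)" for x y
  proof -
    have "(w - (w \<bullet> \<nu>) *\<^sub>R \<nu>) \<bullet> (w - (w \<bullet> \<nu>) *\<^sub>R \<nu>) = w \<bullet> w - (w \<bullet> \<nu>)\<^sup>2" for w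
      by (simp add: inner_diff_left inner_diff_right \<nu>1 inner_commute power2_eq_square)
    moreover have "P x - P y = (x - y) - ((x - y) \<bullet> \<nu>) *\<^sub>R \<nu>"
      by (simp add: P_def inner_diff_left algebra_simps)
    ultimately have "(P x - P y) \<bullet> (P x - P y) = (x - y) \<bullet> (x - y) - ((x - y) \<bullet> \<nu>)\<^sup>2"
      by (simp only:)
    then show ?thesis
      by (simp add: norm_le)
  qed
  have \<gamma>P: "\<gamma> (P z) \<le> \<gamma> (P x) + L * norm (z - x)" for x z
  proof -
    have "dist (\<gamma> (P z)) (\<gamma> (P x)) \<le> L * dist (P z) (P x)"
      using lipschitz_onD[OF \<gamma>] P0 by simp
    also have "\<dots> \<le> L * norm (z - x)"
      using Pdiff L by (simp add: dist_norm mult_left_mono)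
    finally show ?thesis
      by (simp add: dist_real_def abs_le_iff)
  qed
  have mem: "z \<in> \<Omega>" if "z \<in> ball x0 r" "\<gamma> (P z) < z \<bullet> \<nu>" for z
    using graph that unfolding P_def by blast
  have above: "\<gamma> (P z) < z \<bullet> \<nu>" if "z \<in> \<Omega>" "z \<in> ball x0 r" for z
    using graph that unfolding P_def by blast
  have main: "\<bar>v x - v y\<bar> \<le> C * ((2 * L + 1) * norm (x - y))"
    if d: "(2 * L + 1) * d \<le> r" and x: "x \<in> \<Omega>" "x \<in> ball x0 d" and y: "y \<in> \<Omega>" "y \<in> ball x0 d"
      and lip: "lipschitz_on_segments \<Omega> C v" for d x y v
  proof -
    define h where "h = L * norm (x - y)"
    have h0: "0 \<le> h"
      using L by (simp add: h_def)
    have d0: "0 < d"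
      using x(2) by (metis mem_ball zero_le_dist le_less_trans)
    have M: "norm (x - y) \<le> 2 * d"
      using dist_triangle2[of x y x0] x(2) y(2) by (simp add: dist_norm norm_minus_commute)
    \<comment> \<open>The lift is at most \<open>2 * L * d\<close>, so a point of the ball of radius
      \<open>d\<close> stays within \<open>(2 * L + 1) * d \<le> r\<close> of \<open>x0\<close>,
      where the graph description holds.\<close>
    have "h \<le> L * (2 * d)"
      unfolding h_def using M L by (intro mult_left_mono)
    then have dh: "d + h \<le> r" "d \<le> r"
      using d h0 by (auto simp: algebra_simps)
    have lift: "z + s *\<^sub>R \<nu> \<in> ball x0 r" if "z \<in> ball x0 d" "0 \<le> s" "s \<le> h" for z s
      using norm_triangle_ineq[of "z - x0" "s *\<^sub>R \<nu>"] that dh \<nu>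
      by (simp add: dist_norm norm_minus_commute[of x0] algebra_simps)
    have Plift: "P (z + s *\<^sub>R \<nu>) = P z" for z s
      by (simp add: P_def inner_add_left \<nu>1 algebra_simps)
    have vert: "closed_segment z (z + h *\<^sub>R \<nu>) \<subseteq> \<Omega>" if z: "z \<in> \<Omega>" "z \<in> ball x0 d" for z
    proof
      fix w assume "w \<in> closed_segment z (z + h *\<^sub>R \<nu>)"
      then obtain s where s: "0 \<le> s" "s \<le> 1" "w = (1 - s) *\<^sub>R z + s *\<^sub>R (z + h *\<^sub>R \<nu>)"
        by (auto simp: in_segment)
      have w: "w = z + (s * h) *\<^sub>R \<nu>"
        by (simp add: s(3) algebra_simps)
      have sh: "0 \<le> s * h" "s * h \<le> h"
        using s h0 by (simp_all add: mult_left_le_one_le)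
      have "\<gamma> (P z) < z \<bullet> \<nu>"
        using above z lift[OF z(2), of 0] h0 by simp
      then have "\<gamma> (P w) < w \<bullet> \<nu>"
        using sh by (simp add: w Plift inner_add_left \<nu>1)
      then show "w \<in> \<Omega>"
        using lift[OF z(2) sh] by (intro mem) (simp_all add: w)
    qed
    have horiz: "closed_segment (x + h *\<^sub>R \<nu>) (y + h *\<^sub>R \<nu>) \<subseteq> \<Omega>"
    proof
      fix w assume "w \<in> closed_segment (x + h *\<^sub>R \<nu>) (y + h *\<^sub>R \<nu>)"
      then obtain s where s: "0 \<le> s" "s \<le> 1" "w = (1 - s) *\<^sub>R (x + h *\<^sub>R \<nu>) + s *\<^sub>R (y + h *\<^sub>R \<nu>)"
        by (auto simp: in_segment)
      define z where "z = (1 - s) *\<^sub>R x + s *\<^sub>R y"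
      have w: "w = z + h *\<^sub>R \<nu>"
        by (simp add: s(3) z_def algebra_simps)
      have zb: "z \<in> ball x0 d"
        unfolding z_def using convexD_alt[OF convex_ball x(2) y(2)] s by simp
      have nx: "norm (z - x) = s * norm (x - y)"
      proof -
        have "z - x = s *\<^sub>R (y - x)"
          by (simp add: z_def algebra_simps)
        then show ?thesis
          using s by (simp add: norm_minus_commute)
      qed
      have ny: "norm (z - y) = (1 - s) * norm (x - y)"
      proof -
        have "z - y = (1 - s) *\<^sub>R (x - y)"
          by (simp add: z_def algebra_simps)
        then show ?thesis
          using s by simp
      qed
      have xr: "x \<in> ball x0 r" "y \<in> ball x0 r"
        using lift[OF x(2), of 0] lift[OF y(2), of 0] h0 by simp_all
      have gx: "\<gamma> (P z) < x \<bullet> \<nu> + s * h"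
        using \<gamma>P[of z x] above[OF x(1) xr(1)] nx by (simp add: h_def algebra_simps)
      have gy: "\<gamma> (P z) < y \<bullet> \<nu> + (1 - s) * h"
        using \<gamma>P[of z y] above[OF y(1) xr(2)] ny by (simp add: h_def algebra_simps)
      \<comment> \<open>The graph at \<open>z\<close> is estimated from \<open>x\<close> with error
        \<open>s * h\<close> and from \<open>y\<close> with error \<open>(1 - s) * h\<close>.
        Weighting these by \<open>1 - s\<close> and \<open>s\<close> leaves the error
        \<open>2 * s * (1 - s) * h\<close>, at most \<open>h\<close>. Strictness comes from the
        first estimate, whose weight vanishes at \<open>s = 1\<close>.\<close>
      have "\<gamma> (P z) < (1 - s) * (x \<bullet> \<nu>) + s * (y \<bullet> \<nu>) + h"
      proof (cases "s = 1")
        case True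
        then show ?thesis
          using gy h0 by simp
      next
        case False
        have "(1 - s) * \<gamma> (P z) < (1 - s) * (x \<bullet> \<nu> + s * h)"
          using gx s False by (intro mult_strict_left_mono) auto
        moreover have "s * \<gamma> (P z) \<le> s * (y \<bullet> \<nu> + (1 - s) * h)"
          using gy s by (intro mult_left_mono) auto
        ultimately have "\<gamma> (P z) < (1 - s) * (x \<bullet> \<nu>) + s * (y \<bullet> \<nu>) + (2 * (s * (1 - s))) * h"
          by (simp add: algebra_simps)
        also have "(2 * (s * (1 - s))) * h \<le> 1 * h"
        proof (rule mult_right_mono[OF _ h0])
          have "0 \<le> (s - (1 - s))\<^sup>2 + s\<^sup>2 + (1 - s)\<^sup>2"
            by simp
          moreover have "0 \<le> s * s" "0 \<le> (1 - s) * (1 - s)"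
            using s by simp_all
          ultimately show "2 * (s * (1 - s)) \<le> 1"
            by (simp add: power2_eq_square algebra_simps)
        qed
        finally show ?thesis
          by simp
      qed
      then have "\<gamma> (P w) < w \<bullet> \<nu>"
        by (simp add: w Plift inner_add_left \<nu>1 z_def)
      then show "w \<in> \<Omega>"
        using lift[OF zb h0] by (intro mem) (simp_all add: w)
    qed
    have "\<bar>v x - v (x + h *\<^sub>R \<nu>)\<bar> \<le> C * h" "\<bar>v y - v (y + h *\<^sub>R \<nu>)\<bar> \<le> C * h"
      using lip vert[OF x] vert[OF y] h0 \<nu> unfolding lipschitz_on_segments_def by fastforce+
    moreover have "\<bar>v (x + h *\<^sub>R \<nu>) - v (y + h *\<^sub>R \<nu>)\<bar> \<le> C * norm (x - y)"
      using lip horiz unfolding lipschitz_on_segments_def by fastforce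
    ultimately have "\<bar>v x - v y\<bar> \<le> C * h + C * norm (x - y) + C * h"
      by linarith
    then show ?thesis
      by (simp add: h_def algebra_simps)
  qed
  show ?thesis
    by (intro exI[of _ r] exI[of _ L] conjI r L allI impI main) auto
qed

text \<open>Equicontinuity up to the boundary, with \<open>d\<close> chosen before \<open>v\<close>.
  Interior points obey the boundary estimate with \<open>L = 0\<close>, so one computation covers
  both cases.\<close>

lemma segment_lipschitz_local_bound:
  fixes \<Omega> :: "(real ^ 'n) set"
  assumes "open \<Omega>" "lipschitz_boundary \<Omega>" "x0 \<in> closure \<Omega>" "0 < e"
  shows "\<exists>d>0. \<forall>x\<in>\<Omega> \<inter> ball x0 d. \<forall>y\<in>\<Omega> \<inter> ball x0 d. \<forall>v.
    lipschitz_on_segments \<Omega> C v \<longrightarrow> \<bar>v x - v y\<bar> \<le> e"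
proof -
  have "\<exists>r>0. \<exists>L\<ge>0. \<forall>d x y v. (2 * L + 1) * d \<le> r \<longrightarrow> x \<in> \<Omega> \<inter> ball x0 d \<longrightarrow> y \<in> \<Omega> \<inter> ball x0 d \<longrightarrow>
    lipschitz_on_segments \<Omega> C v \<longrightarrow> \<bar>v x - v y\<bar> \<le> C * ((2 * L + 1) * norm (x - y))"
  proof (cases "x0 \<in> \<Omega>")
    case True
    then obtain r where r: "0 < r" "ball x0 r \<subseteq> \<Omega>"
      using assms(1) by (auto simp: open_contains_ball)
    have "closed_segment x y \<subseteq> \<Omega>" if "d \<le> r" "x \<in> ball x0 d" "y \<in> ball x0 d" for d x y
      using r that closed_segment_subset[OF that(2,3) convex_ball] subset_ball[OF that(1)] by blast
    then show ?thesis
      using r(1) by (intro exI[of _ r] conjI exI[of _ 0]) (auto simp: lipschitz_on_segments_def)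
  next
    case False
    then have "x0 \<in> frontier \<Omega>"
      using assms(1,3) by (simp add: frontier_def interior_open)
    then show ?thesis
      by (rule lipschitz_boundary_local_bound[OF assms(1,2)])
  qed
  then obtain r L where r: "0 < r" and L: "0 \<le> L"
    and b: "\<And>d x y v. (2 * L + 1) * d \<le> r \<Longrightarrow> x \<in> \<Omega> \<inter> ball x0 d \<Longrightarrow> y \<in> \<Omega> \<inter> ball x0 d \<Longrightarrow>
      lipschitz_on_segments \<Omega> C v \<Longrightarrow> \<bar>v x - v y\<bar> \<le> C * ((2 * L + 1) * norm (x - y))"
    by blast
  \<comment> \<open>Two points of the ball are at most \<open>2 * d\<close> apart, whence the factor
    2; \<open>\<bar>C\<bar> + 1\<close> is positive for every \<open>C\<close>.\<close>
  define d where "d = min (r / (2 * L + 1)) (e / (2 * (\<bar>C\<bar> + 1) * (2 * L + 1)))"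
  have d0: "0 < d"
    using r L assms(4) by (auto simp: d_def)
  have "d \<le> r / (2 * L + 1)"
    by (simp add: d_def)
  then have d1: "(2 * L + 1) * d \<le> r"
    using L by (simp add: pos_le_divide_eq mult.commute)
  have "d \<le> e / (2 * (\<bar>C\<bar> + 1) * (2 * L + 1))"
    by (simp add: d_def)
  moreover have "0 < 2 * (\<bar>C\<bar> + 1) * (2 * L + 1)"
    using L by (intro mult_pos_pos) auto
  ultimately have "d * (2 * (\<bar>C\<bar> + 1) * (2 * L + 1)) \<le> e"
    by (simp only: pos_le_divide_eq)
  then have d2: "(\<bar>C\<bar> + 1) * ((2 * L + 1) * (2 * d)) \<le> e"
    by (simp add: algebra_simps)
  have "\<bar>v x - v y\<bar> \<le> e"
    if xy: "x \<in> \<Omega> \<inter> ball x0 d" "y \<in> \<Omega> \<inter> ball x0 d" and lip: "lipschitz_on_segments \<Omega> C v" for x y v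
  proof -
    have "norm (x - y) \<le> 2 * d"
      using dist_triangle2[of x y x0] xy by (simp add: dist_norm norm_minus_commute)
    then have "C * ((2 * L + 1) * norm (x - y)) \<le> (\<bar>C\<bar> + 1) * ((2 * L + 1) * (2 * d))"
      using L d0 by (intro mult_mono mult_nonneg_nonneg) auto
    then show ?thesis
      using b[OF d1 xy lip] d2 by linarith
  qed
  then show ?thesis
    using d0 by blast
qed

text \<open>Total boundedness expressed through the functions themselves: one net serves every
  \<open>v\<close> with the constant \<open>C\<close>, hence the target and all its approximants at
  once. It comes from a finite cover of the compact closure.\<close>

lemma segment_lipschitz_finite_net:
  fixes \<Omega> :: "(real ^ 'n) set"
  assumes "bounded \<Omega>" "open \<Omega>" "lipschitz_boundary \<Omega>" "0 < e"
  shows "\<exists>P\<subseteq>\<Omega>. finite P \<and> (\<forall>x\<in>\<Omega>. \<exists>p\<in>P. \<forall>v. lipschitz_on_segments \<Omega> C v \<longrightarrow> \<bar>v x - v p\<bar> \<le> e)"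
proof -
  obtain d where d: "\<And>x0. x0 \<in> closure \<Omega> \<Longrightarrow> 0 < d x0"
    "\<And>x0 x y v. x0 \<in> closure \<Omega> \<Longrightarrow> x \<in> \<Omega> \<inter> ball x0 (d x0) \<Longrightarrow> y \<in> \<Omega> \<inter> ball x0 (d x0) \<Longrightarrow>
      lipschitz_on_segments \<Omega> C v \<Longrightarrow> \<bar>v x - v y\<bar> \<le> e"
    using segment_lipschitz_local_bound[OF assms(2,3) _ assms(4), of _ C] by metis
  have c: "compact (closure \<Omega>)"
    using assms(1) by (simp add: compact_closure)
  have "closure \<Omega> \<subseteq> (\<Union>x\<in>closure \<Omega>. ball x (d x))"
    using d(1) by force
  then obtain Q where Q: "Q \<subseteq> closure \<Omega>" "finite Q" "closure \<Omega> \<subseteq> (\<Union>x\<in>Q. ball x (d x))"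
    by (rule compactE_image[OF c, rotated]) auto
  \<comment> \<open>A centre may lie on the boundary. Any point of the domain in the same ball can
    replace it, because the local bound compares arbitrary pairs of that ball.\<close>
  have "\<exists>p. p \<in> \<Omega> \<inter> ball q (d q)" if "q \<in> Q" for q
  proof -
    have "q \<in> closure \<Omega>"
      using that Q by blast
    then obtain p where "p \<in> \<Omega>" "dist p q < d q"
      using d(1)[of q] by (auto simp: closure_approachable)
    then show ?thesis
      by (auto simp: dist_commute)
  qed
  then obtain p where p: "\<And>q. q \<in> Q \<Longrightarrow> p q \<in> \<Omega> \<inter> ball q (d q)"
    by metis
  have "\<exists>q\<in>Q. \<forall>v. lipschitz_on_segments \<Omega> C v \<longrightarrow> \<bar>v x - v (p q)\<bar> \<le> e" if x: "x \<in> \<Omega>" for x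
  proof -
    have "x \<in> (\<Union>x\<in>Q. ball x (d x))"
      using Q(3) x closure_subset by blast
    then obtain q where q: "q \<in> Q" "x \<in> ball q (d q)"
      by blast
    then show ?thesis
      using d(2)[of q x "p q"] x p Q(1) by blast
  qed
  then show ?thesis
    using p Q(2) by (intro exI[of _ "p ` Q"]) auto
qed

text \<open>Being comparable by a bound uniform in \<open>v\<close> is an equivalence relation with
  open classes, so connectedness leaves a single class. This is the source of the finiteness of
  \<open>d1\<close>.\<close>

lemma segment_lipschitz_connected_bound:
  fixes \<Omega> :: "(real ^ 'n) set"
  assumes "open \<Omega>" "connected \<Omega>" "x \<in> \<Omega>" "y \<in> \<Omega>"
  shows "\<exists>M. \<forall>v. lipschitz_on_segments \<Omega> C v \<longrightarrow> \<bar>v x - v y\<bar> \<le> M"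
proof (rule connected_equivalence_relation[OF assms(2-4),
      where R = "\<lambda>x y. \<exists>M. \<forall>v. lipschitz_on_segments \<Omega> C v \<longrightarrow> \<bar>v x - v y\<bar> \<le> M"])
  fix x y assume "\<exists>M. \<forall>v. lipschitz_on_segments \<Omega> C v \<longrightarrow> \<bar>v x - v y\<bar> \<le> M"
  then show "\<exists>M. \<forall>v. lipschitz_on_segments \<Omega> C v \<longrightarrow> \<bar>v y - v x\<bar> \<le> M"
    by (simp add: abs_minus_commute)
next
  fix x y z
  assume "\<exists>M. \<forall>v. lipschitz_on_segments \<Omega> C v \<longrightarrow> \<bar>v x - v y\<bar> \<le> M"
    and "\<exists>M. \<forall>v. lipschitz_on_segments \<Omega> C v \<longrightarrow> \<bar>v y - v z\<bar> \<le> M"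
  then obtain M N where "\<And>v. lipschitz_on_segments \<Omega> C v \<Longrightarrow> \<bar>v x - v y\<bar> \<le> M"
      "\<And>v. lipschitz_on_segments \<Omega> C v \<Longrightarrow> \<bar>v y - v z\<bar> \<le> N"
    by blast
  then have "\<forall>v. lipschitz_on_segments \<Omega> C v \<longrightarrow> \<bar>v x - v z\<bar> \<le> M + N"
    by (smt (verit))
  then show "\<exists>M. \<forall>v. lipschitz_on_segments \<Omega> C v \<longrightarrow> \<bar>v x - v z\<bar> \<le> M"
    by blast
next
  fix x assume "x \<in> \<Omega>"
  then obtain r where r: "0 < r" "ball x r \<subseteq> \<Omega>"
    using assms(1) by (auto simp: open_contains_ball)
  have "\<exists>M. \<forall>v. lipschitz_on_segments \<Omega> C v \<longrightarrow> \<bar>v x - v y\<bar> \<le> M" if "y \<in> ball x r" for y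
  proof -
    have "closed_segment x y \<subseteq> \<Omega>"
      using closed_segment_subset[of x "ball x r" y] that r by auto
    then show ?thesis
      by (auto simp: lipschitz_on_segments_def)
  qed
  then show "\<exists>T. openin (top_of_set \<Omega>) T \<and> x \<in> T \<and>
      (\<forall>y\<in>T. \<exists>M. \<forall>v. lipschitz_on_segments \<Omega> C v \<longrightarrow> \<bar>v x - v y\<bar> \<le> M)"
    using r assms(1) by (intro exI[of _ "ball x r"]) (auto simp: openin_open_eq)
qed

section \<open>Envelopes of homogeneous supremal functionals\<close>

lemma continuous_Linf_lincomb:
  assumes "u \<in> continuous_Linf \<Omega>" "v \<in> continuous_Linf \<Omega>"
  shows "(\<lambda>x. a * u x + b * v x) \<in> continuous_Linf \<Omega>"
proof -
  obtain C D where "AE x in lebesgue_on \<Omega>. \<bar>u x\<bar> \<le> C" "AE x in lebesgue_on \<Omega>. \<bar>v x\<bar> \<le> D"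
    using assms by (auto simp: continuous_Linf_def Linf_def)
  then have "AE x in lebesgue_on \<Omega>. \<bar>a * u x + b * v x\<bar> \<le> \<bar>a\<bar> * C + \<bar>b\<bar> * D"
  proof eventually_elim
    case (elim x)
    have "\<bar>a * u x + b * v x\<bar> \<le> \<bar>a\<bar> * \<bar>u x\<bar> + \<bar>b\<bar> * \<bar>v x\<bar>"
      by (metis abs_mult abs_triangle_ineq)
    also have "\<dots> \<le> \<bar>a\<bar> * C + \<bar>b\<bar> * D"
      using elim by (intro add_mono mult_left_mono) auto
    finally show ?case .
  qed
  then show ?thesis
    using assms by (auto simp: continuous_Linf_def Linf_def intro!: continuous_intros)
qed

lemma W1inf_lincomb:
  assumes "bounded \<Omega>" "open \<Omega>" "u \<in> W1inf \<Omega>" "v \<in> W1inf \<Omega>"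
  shows "(\<lambda>x. a * u x + b * v x) \<in> W1inf \<Omega>"
  using assms continuous_Linf_lincomb has_Linf_weak_gradient_lincomb unfolding W1inf_iff by blast

text \<open>The weak gradient of a constant is 0: the indicator of the domain has zero difference
  quotients on the support of \<phi> for small steps, and discrete integration by parts passes to
  the limit.\<close>

lemma integral_partial_deriv_test_function:
  fixes \<Omega> :: "(real ^ 'n) set"
  assumes \<Omega>: "bounded \<Omega>" "open \<Omega>" and \<phi>: "\<phi> \<in> test_functions \<Omega>"
  shows "(LINT x|lebesgue_on \<Omega>. partial_deriv i \<phi> x) = 0"
proof -
  define w :: "real ^ 'n \<Rightarrow> real" where "w = indicator \<Omega>"
  have w1: "w x = 1" if "x \<in> \<Omega>" for x
    using that by (simp add: w_def)
  have cw: "continuous_on \<Omega> w"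
    by (rule continuous_on_eq[OF continuous_on_const[of _ 1]]) (simp add: w1)
  have "w \<in> borel_measurable (lebesgue_on \<Omega>)"
    by (rule borel_measurable_lebesgue_on_continuous[OF \<Omega>(2) cw])
  moreover have "AE x in lebesgue_on \<Omega>. norm (w x) \<le> 1"
    by (simp add: w_def indicator_def)
  ultimately have w: "w \<in> continuous_Linf \<Omega>"
    using cw unfolding continuous_Linf_def Linf_def by (auto simp: w_def)
  have lip: "lipschitz_on_segments \<Omega> 0 w"
    unfolding lipschitz_on_segments_def
  proof (intro allI impI)
    fix x y assume "closed_segment x y \<subseteq> \<Omega>"
    then have "x \<in> \<Omega>" "y \<in> \<Omega>"
      by auto
    then show "\<bar>w x - w y\<bar> \<le> 0 * norm (x - y)"
      by (simp add: w1)
  qed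
  obtain S where S: "compact S" "S \<subseteq> \<Omega>" "\<And>x. x \<notin> S \<Longrightarrow> \<phi> x = 0"
    using \<phi> by (metis test_functionsE)
  obtain \<delta> where \<delta>0: "0 < \<delta>" and "(\<Union>x\<in>S. cball x \<delta>) \<subseteq> \<Omega>"
    by (rule compact_subset_open_imp_cball_epsilon_subset[OF S(1) \<Omega>(2) S(2)])
  then have \<delta>: "cball x \<delta> \<subseteq> \<Omega>" if "x \<in> S" for x
    using that unfolding UN_subset_iff by blast
  define X where "X n = \<delta> * inverse (real (Suc n))" for n
  have X0: "X \<longlonglongrightarrow> 0"
    unfolding X_def using tendsto_mult[OF tendsto_const[of \<delta>] LIMSEQ_inverse_real_of_nat] by simp
  have X: "\<bar>X n\<bar> \<le> \<delta>" "X n \<noteq> 0" for n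
    using \<delta>0 by (auto simp: X_def field_simps)
  have "difference_ratio i (X n) w x * \<phi> x = 0" for n x
    using lipschitz_difference_ratio_le[OF lip \<delta> X(1,2), of x i n] S(3)[of x] by (cases "x \<in> S") auto
  then have "(LINT x|lebesgue_on \<Omega>. difference_ratio i (X n) w x * \<phi> x) = 0" for n
    by (simp only: Bochner_Integration.integral_zero)
  then have "(\<lambda>n. 0) \<longlonglongrightarrow> - (LINT x|lebesgue_on \<Omega>. w x * partial_deriv i \<phi> x)"
    using integral_difference_ratio_tendsto[OF \<Omega> w \<phi> X0 X(2), of i] by simp
  then have "(LINT x|lebesgue_on \<Omega>. w x * partial_deriv i \<phi> x) = 0"
    using LIMSEQ_unique[OF tendsto_const] by fastforce
  moreover have "(LINT x|lebesgue_on \<Omega>. w x * partial_deriv i \<phi> x) = (LINT x|lebesgue_on \<Omega>. partial_deriv i \<phi> x)"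
    by (rule Bochner_Integration.integral_cong) (auto simp: space_restrict_space w1)
  ultimately show ?thesis
    by simp
qed

text \<open>Elements of \<open>W1inf\<close> vanish outside the domain, so a constant may be added
  only inside.\<close>

definition shift :: "'a set \<Rightarrow> real \<Rightarrow> ('a \<Rightarrow> real) \<Rightarrow> 'a \<Rightarrow> real" where
  "shift \<Omega> c u x = (if x \<in> \<Omega> then u x + c else 0)"

lemma has_Linf_weak_gradient_shift:
  fixes u :: "real ^ 'n \<Rightarrow> real"
  assumes \<Omega>: "bounded \<Omega>" "open \<Omega>" and u: "u \<in> continuous_Linf \<Omega>"
  shows "has_Linf_weak_gradient \<Omega> (shift \<Omega> c u) g \<longleftrightarrow> has_Linf_weak_gradient \<Omega> u g"
proof -
  have "(LINT x|lebesgue_on \<Omega>. shift \<Omega> c u x * partial_deriv i \<phi> x) = (LINT x|lebesgue_on \<Omega>. u x * partial_deriv i \<phi> x)"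
    if \<phi>: "\<phi> \<in> test_functions \<Omega>" for \<phi> i
  proof -
    obtain D where "u \<in> borel_measurable (lebesgue_on \<Omega>)" "AE x in lebesgue_on \<Omega>. \<bar>u x\<bar> \<le> D"
      using u by (auto simp: continuous_Linf_def Linf_def)
    then have int: "integrable (lebesgue_on \<Omega>) (\<lambda>x. u x * partial_deriv i \<phi> x)"
      by (rule integrable_mult_AE_bounded[OF _ _ integrable_partial_deriv[OF \<Omega> \<phi>]])
    have "(LINT x|lebesgue_on \<Omega>. shift \<Omega> c u x * partial_deriv i \<phi> x)
        = (LINT x|lebesgue_on \<Omega>. u x * partial_deriv i \<phi> x + c * partial_deriv i \<phi> x)"
      by (rule Bochner_Integration.integral_cong) (auto simp: shift_def space_restrict_space distrib_right)
    also have "\<dots> = (LINT x|lebesgue_on \<Omega>. u x * partial_deriv i \<phi> x)"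
      using int integrable_partial_deriv[OF \<Omega> \<phi>, of i] integral_partial_deriv_test_function[OF \<Omega> \<phi>, of i] by simp
    finally show ?thesis .
  qed
  then show ?thesis
    by (simp add: has_Linf_weak_gradient_def)
qed

lemma continuous_Linf_shift:
  assumes "open \<Omega>" "u \<in> continuous_Linf \<Omega>"
  shows "shift \<Omega> c u \<in> continuous_Linf \<Omega>"
proof -
  obtain D where "AE x in lebesgue_on \<Omega>. \<bar>u x\<bar> \<le> D"
    using assms by (auto simp: continuous_Linf_def Linf_def)
  then have "AE x in lebesgue_on \<Omega>. norm (shift \<Omega> c u x) \<le> \<bar>D\<bar> + \<bar>c\<bar>"
    by eventually_elim (auto simp: shift_def)
  moreover have "continuous_on \<Omega> (\<lambda>x. u x + c)"
    using assms by (auto simp: continuous_Linf_def intro!: continuous_intros)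
  then have "continuous_on \<Omega> (shift \<Omega> c u)"
    by (rule continuous_on_eq) (simp add: shift_def)
  moreover from this have "shift \<Omega> c u \<in> borel_measurable (lebesgue_on \<Omega>)"
    by (rule borel_measurable_lebesgue_on_continuous[OF assms(1)])
  moreover have "shift \<Omega> c u x = 0" if "x \<notin> \<Omega>" for x
    using that by (simp add: shift_def)
  ultimately show ?thesis
    unfolding continuous_Linf_def Linf_def by blast
qed

text \<open>The gradient predicates of \<open>u\<close> and of its shift are equal, so the choice
  operator returns the very same representative and \<open>F\<close> is unchanged exactly.\<close>

lemma W1inf_shift:
  assumes "bounded \<Omega>" "open \<Omega>" "u \<in> W1inf \<Omega>"
  shows "shift \<Omega> c u \<in> W1inf \<Omega>" "weak_gradient \<Omega> (shift \<Omega> c u) = weak_gradient \<Omega> u"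
proof -
  have u: "u \<in> continuous_Linf \<Omega>"
    using assms(3) by (simp add: W1inf_iff)
  have "has_Linf_weak_gradient \<Omega> (shift \<Omega> c u) = has_Linf_weak_gradient \<Omega> u"
    using has_Linf_weak_gradient_shift[OF assms(1,2) u] by blast
  then show "shift \<Omega> c u \<in> W1inf \<Omega>" "weak_gradient \<Omega> (shift \<Omega> c u) = weak_gradient \<Omega> u"
    using assms(3) continuous_Linf_shift[OF assms(2) u] by (simp_all add: weak_gradient_def W1inf_iff)
qed

lemma borel_measurable_supremand:
  fixes f :: "(real ^ 'n) \<times> (real ^ 'n) \<Rightarrow> ereal"
  assumes "f \<in> borel_measurable (restrict_space borel (\<Omega> \<times> UNIV))" "u \<in> W1inf \<Omega>"
  shows "(\<lambda>x. f (x, weak_gradient \<Omega> u x)) \<in> borel_measurable (lebesgue_on \<Omega>)"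
proof (rule measurable_compose[OF _ assms(1)], rule measurable_restrict_space2)
  show "(\<lambda>x. (x, weak_gradient \<Omega> u x)) \<in> space (lebesgue_on \<Omega>) \<rightarrow> \<Omega> \<times> UNIV"
    by (auto simp: space_restrict_space)
  have "(\<lambda>x. x) \<in> borel_measurable (lebesgue_on \<Omega>)"
    by (intro borel_measurable_lebesgue_on) simp
  then show "(\<lambda>x. (x, weak_gradient \<Omega> u x)) \<in> borel_measurable (lebesgue_on \<Omega>)"
    using weak_gradient_in_Linf[OF assms(2)] by (intro borel_measurable_Pair) (auto simp: Linf_def)
qed

locale homogeneous_supremal =
  fixes \<Omega> :: "(real ^ 'n) set"
    and f :: "(real ^ 'n) \<times> (real ^ 'n) \<Rightarrow> ereal"
    and F :: "(real ^ 'n \<Rightarrow> real) \<Rightarrow> ereal"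
    and \<alpha> \<beta> :: real
  assumes bounded: "bounded \<Omega>" and conn: "connected \<Omega>" and opn: "open \<Omega>"
    and lipbd: "lipschitz_boundary \<Omega>" and ne: "\<Omega> \<noteq> {}"
    and f_meas: "f \<in> borel_measurable (restrict_space borel (\<Omega> \<times> UNIV))"
    and F_eq: "\<And>u. u \<in> W1inf \<Omega> \<Longrightarrow> F u = supremal_functional \<Omega> f u"
    and F_hom: "\<And>l u. l > 0 \<Longrightarrow> u \<in> W1inf \<Omega> \<Longrightarrow> F (\<lambda>x. l * u x) = ereal l * F u"
    and \<alpha>: "\<alpha> > 0" and \<beta>: "\<beta> > 0"
    and d_lower: "\<And>x y. x \<in> \<Omega> \<Longrightarrow> y \<in> \<Omega> \<Longrightarrow> ereal (\<alpha> * norm (x - y)) \<le> d1 \<Omega> F x y"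
    and d_upper: "\<And>x y. x \<in> \<Omega> \<Longrightarrow> y \<in> \<Omega> \<Longrightarrow> d1 \<Omega> F x y \<le> ereal \<beta> * geodetic_dist \<Omega> x y"
begin

section \<open>The unit sublevel and its pseudo-distance\<close>

definition K :: "(real ^ 'n \<Rightarrow> real) set" where
  "K = {u \<in> W1inf \<Omega>. F u \<le> 1}"

text \<open>Faithful only for points of the domain, where \<open>d1_eq\<close> shows
  \<open>d1\<close> to be finite.\<close>

definition d :: "real ^ 'n \<Rightarrow> real ^ 'n \<Rightarrow> real" where
  "d x y = real_of_ereal (d1 \<Omega> F x y)"

lemma d1_segment_le:
  assumes "closed_segment x y \<subseteq> \<Omega>"
  shows "d1 \<Omega> F x y \<le> ereal (\<beta> * norm (x - y))"
proof -
  have "x \<in> \<Omega>" "y \<in> \<Omega>"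
    using assms by auto
  then have "d1 \<Omega> F x y \<le> ereal \<beta> * geodetic_dist \<Omega> x y"
    by (rule d_upper)
  also have "\<dots> \<le> ereal \<beta> * ereal (norm (x - y))"
    using \<beta> by (intro ereal_mult_left_mono geodetic_dist_le_segment[OF assms]) auto
  finally show ?thesis
    by simp
qed

lemma K_diff_le: "v \<in> K \<Longrightarrow> ereal (v x - v y) \<le> d1 \<Omega> F x y"
  unfolding d1_def K_def by (intro SUP_upper) auto

text \<open>Phrased with the extended real \<open>d1\<close>, because the finiteness of
  \<open>d1\<close> is itself derived from it by way of \<open>K_lipschitz\<close>.\<close>

lemma segment_lipschitz_if_le_d1:
  assumes "\<And>x y. x \<in> \<Omega> \<Longrightarrow> y \<in> \<Omega> \<Longrightarrow> ereal (v x - v y) \<le> ereal l * d1 \<Omega> F x y" "0 \<le> l"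
  shows "lipschitz_on_segments \<Omega> (l * \<beta>) v"
  unfolding lipschitz_on_segments_def
proof (intro allI impI)
  have *: "v x - v y \<le> l * \<beta> * norm (x - y)" if s: "closed_segment x y \<subseteq> \<Omega>" for x y
  proof -
    have "x \<in> \<Omega>" "y \<in> \<Omega>"
      using s by auto
    then have "ereal (v x - v y) \<le> ereal l * d1 \<Omega> F x y"
      by (rule assms(1))
    also have "\<dots> \<le> ereal l * ereal (\<beta> * norm (x - y))"
      using assms(2) by (intro ereal_mult_left_mono d1_segment_le[OF s]) auto
    finally show ?thesis
      by (simp add: mult.assoc)
  qed
  fix x y assume "closed_segment x y \<subseteq> \<Omega>"
  then show "\<bar>v x - v y\<bar> \<le> l * \<beta> * norm (x - y)"
    using *[of x y] *[of y x] by (simp add: closed_segment_commute norm_minus_commute abs_le_iff)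
qed

lemma K_lipschitz: "v \<in> K \<Longrightarrow> lipschitz_on_segments \<Omega> \<beta> v"
  using segment_lipschitz_if_le_d1[of v 1] K_diff_le by (simp add: one_ereal_def[symmetric])

text \<open>Members of \<open>K\<close> share the constant \<beta> on segments, so the bound
  obtained from connectedness applies to the whole supremum; \<alpha> excludes the value
  -\<infinity>.\<close>

lemma d1_eq:
  assumes "x \<in> \<Omega>" "y \<in> \<Omega>"
  shows "d1 \<Omega> F x y = ereal (d x y)" "\<alpha> * norm (x - y) \<le> d x y"
proof -
  obtain M where "\<And>v. lipschitz_on_segments \<Omega> \<beta> v \<Longrightarrow> \<bar>v x - v y\<bar> \<le> M"
    using segment_lipschitz_connected_bound[OF opn conn assms] by blast
  then have "v x - v y \<le> M" if "v \<in> K" for v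
    using K_lipschitz[OF that] by fastforce
  then have "d1 \<Omega> F x y \<le> ereal M"
    unfolding d1_def by (intro SUP_least) (auto simp: K_def)
  moreover have "ereal (\<alpha> * norm (x - y)) \<le> d1 \<Omega> F x y"
    by (rule d_lower[OF assms])
  ultimately show "d1 \<Omega> F x y = ereal (d x y)" "\<alpha> * norm (x - y) \<le> d x y"
    unfolding d_def by (cases "d1 \<Omega> F x y"; auto)+
qed

lemma d_nonneg: "x \<in> \<Omega> \<Longrightarrow> y \<in> \<Omega> \<Longrightarrow> 0 \<le> d x y"
  using d1_eq(2)[of x y] \<alpha> by (meson less_imp_le mult_nonneg_nonneg norm_ge_zero order_trans)

lemma K_diff_le_d: "v \<in> K \<Longrightarrow> x \<in> \<Omega> \<Longrightarrow> y \<in> \<Omega> \<Longrightarrow> v x - v y \<le> d x y"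
  using K_diff_le[of v x y] d1_eq(1)[of x y] by simp

lemma segment_lipschitz_if_le_d:
  assumes "\<And>x y. x \<in> \<Omega> \<Longrightarrow> y \<in> \<Omega> \<Longrightarrow> v x - v y \<le> l * d x y" "0 \<le> l"
  shows "lipschitz_on_segments \<Omega> (l * \<beta>) v"
  by (rule segment_lipschitz_if_le_d1) (use assms d1_eq in auto)

lemma F_shift: "u \<in> W1inf \<Omega> \<Longrightarrow> F (shift \<Omega> c u) = F u"
  using W1inf_shift[OF bounded opn] by (simp add: F_eq supremal_functional_def)

lemma K_shift: "v \<in> K \<Longrightarrow> shift \<Omega> c v \<in> K"
  using W1inf_shift(1)[OF bounded opn] F_shift by (auto simp: K_def)

text \<open>The decisive property of supremal functionals: \<open>F u \<le> c\<close> says that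
  \<open>f\<close> is at most \<open>c\<close> along the gradient almost everywhere, so any
  pointwise selection between two admissible gradients is admissible if it is a gradient at
  all.\<close>

lemma F_le_if_gradient_in:
  assumes w: "w \<in> W1inf \<Omega>" "has_Linf_weak_gradient \<Omega> w G"
    and uv: "u \<in> W1inf \<Omega>" "F u \<le> c" "v \<in> W1inf \<Omega>" "F v \<le> c"
    and G: "\<And>x. G x = weak_gradient \<Omega> u x \<or> G x = weak_gradient \<Omega> v x"
  shows "F w \<le> c"
proof -
  have le: "AE x in lebesgue_on \<Omega>. f (x, weak_gradient \<Omega> z x) \<le> c" if "z \<in> W1inf \<Omega>" "F z \<le> c" for z
  proof -
    have "AE x in lebesgue_on \<Omega>. f (x, weak_gradient \<Omega> z x) \<le> F z"
      using esssup_AE[of "\<lambda>x. f (x, weak_gradient \<Omega> z x)" "lebesgue_on \<Omega>"] that(1)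
      by (simp add: F_eq supremal_functional_def)
    then show ?thesis
      by eventually_elim (use that(2) in auto)
  qed
  have "AE x in lebesgue_on \<Omega>. weak_gradient \<Omega> w x = G x"
    by (rule has_Linf_weak_gradient_unique[OF bounded opn weak_gradient_works[OF w(1)] w(2)])
  then have "AE x in lebesgue_on \<Omega>. f (x, weak_gradient \<Omega> w x) \<le> c"
    using le[OF uv(1,2)] le[OF uv(3,4)]
  proof eventually_elim
    case (elim x)
    then show ?case
      using G[of x] by auto
  qed
  then show ?thesis
    using borel_measurable_supremand[OF f_meas w(1)]
    by (simp add: F_eq[OF w(1)] supremal_functional_def esssup_I)
qed

lemma K_max_min:
  assumes "u \<in> K" "v \<in> K"
  shows "(\<lambda>x. max (u x) (v x)) \<in> K" "(\<lambda>x. min (u x) (v x)) \<in> K"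
proof -
  have W: "u \<in> W1inf \<Omega>" "v \<in> W1inf \<Omega>" and F1: "F u \<le> 1" "F v \<le> 1"
    using assms by (auto simp: K_def)
  have c: "u \<in> continuous_Linf \<Omega>" "v \<in> continuous_Linf \<Omega>"
    using W by (auto simp: W1inf_iff)
  let ?m = "\<lambda>x. max (u x) (v x)"
  let ?G = "\<lambda>x. if u x \<ge> v x then weak_gradient \<Omega> u x else weak_gradient \<Omega> v x"
  note g = weak_gradient_works[OF W(1)] weak_gradient_works[OF W(2)]
  have cm: "?m \<in> continuous_Linf \<Omega>"
    by (rule continuous_Linf_max[OF opn c])
  have gm: "has_Linf_weak_gradient \<Omega> ?m ?G"
    by (rule has_Linf_weak_gradient_max[OF bounded opn c K_lipschitz[OF assms(1)] K_lipschitz[OF assms(2)] g])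
  have m: "?m \<in> W1inf \<Omega>"
    using cm gm unfolding W1inf_iff by blast
  moreover have "F ?m \<le> 1"
    by (rule F_le_if_gradient_in[OF m gm W(1) F1(1) W(2) F1(2)]) simp
  ultimately show "?m \<in> K"
    by (simp add: K_def)
  let ?n = "\<lambda>x. min (u x) (v x)"
  let ?H = "\<lambda>x. if u x \<ge> v x then weak_gradient \<Omega> v x else weak_gradient \<Omega> u x"
  define s where "s = (\<lambda>x. 1 * u x + 1 * v x)"
  \<comment> \<open>Writing the minimum as \<open>u + v\<close> minus the maximum turns its gradient
    into the complementary selection \<open>?H\<close>.\<close>
  have n: "?n = (\<lambda>x. 1 * s x + (-1) * ?m x)"
    by (auto simp: s_def min_def max_def)
  have cs: "s \<in> continuous_Linf \<Omega>"
    unfolding s_def by (rule continuous_Linf_lincomb[OF c])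
  have "has_Linf_weak_gradient \<Omega> s (\<lambda>x. 1 *\<^sub>R weak_gradient \<Omega> u x + 1 *\<^sub>R weak_gradient \<Omega> v x)"
    unfolding s_def by (rule has_Linf_weak_gradient_lincomb[OF bounded opn c g])
  from has_Linf_weak_gradient_lincomb[OF bounded opn cs cm this gm, of 1 "-1"]
  have "has_Linf_weak_gradient \<Omega> ?n (\<lambda>x. 1 *\<^sub>R (1 *\<^sub>R weak_gradient \<Omega> u x + 1 *\<^sub>R weak_gradient \<Omega> v x) + (-1) *\<^sub>R ?G x)"
    unfolding n .
  moreover have "(\<lambda>x. 1 *\<^sub>R (1 *\<^sub>R weak_gradient \<Omega> u x + 1 *\<^sub>R weak_gradient \<Omega> v x) + (-1) *\<^sub>R ?G x) = ?H"
    by auto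
  ultimately have gn: "has_Linf_weak_gradient \<Omega> ?n ?H"
    by (simp only:)
  have "?n \<in> continuous_Linf \<Omega>"
    unfolding n by (rule continuous_Linf_lincomb[OF cs cm])
  then have nW: "?n \<in> W1inf \<Omega>"
    using gn unfolding W1inf_iff by blast
  moreover have "F ?n \<le> 1"
    by (rule F_le_if_gradient_in[OF nW gn W(1) F1(1) W(2) F1(2)]) simp
  ultimately show "?n \<in> K"
    by (simp add: K_def)
qed

text \<open>\<open>d p q\<close> is a supremum over \<open>K\<close>, and an added constant fixes
  the value at \<open>p\<close>. The supremum need not be attained, hence the slack \<open>e\<close>
  at \<open>q\<close>.\<close>

lemma K_interpolation:
  assumes u: "\<And>x y. x \<in> \<Omega> \<Longrightarrow> y \<in> \<Omega> \<Longrightarrow> u x - u y \<le> d x y" and pq: "p \<in> \<Omega>" "q \<in> \<Omega>" and "0 < e"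
  shows "\<exists>w\<in>K. w p = u p \<and> w q \<le> u q + e"
proof -
  have "ereal (u p - u q - e) < d1 \<Omega> F p q"
    using u[OF pq] d1_eq(1)[OF pq] \<open>0 < e\<close> by simp
  then obtain w where w: "w \<in> K" "u p - u q - e < w p - w q"
    unfolding d1_def K_def less_SUP_iff by auto
  then show ?thesis
    using pq by (intro bexI[OF _ K_shift[OF w(1), of "u p - w p"]]) (auto simp: shift_def)
qed

text \<open>The lattice form of the Stone--Weierstrass argument, on a finite net instead of a compact space.\<close>

lemma K_dense:
  assumes u: "\<And>x y. x \<in> \<Omega> \<Longrightarrow> y \<in> \<Omega> \<Longrightarrow> u x - u y \<le> d x y" and e: "0 < e"
  shows "\<exists>v\<in>K. \<forall>x\<in>\<Omega>. \<bar>v x - u x\<bar> \<le> 3 * e"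
proof -
  obtain P where P: "P \<subseteq> \<Omega>" "finite P"
    and net: "\<And>x. x \<in> \<Omega> \<Longrightarrow> \<exists>p\<in>P. \<forall>v. lipschitz_on_segments \<Omega> \<beta> v \<longrightarrow> \<bar>v x - v p\<bar> \<le> e"
    using segment_lipschitz_finite_net[OF bounded opn lipbd e, of \<beta>] by blast
  obtain x0 where x0: "x0 \<in> \<Omega>"
    using ne by blast
  \<comment> \<open>Minima over the points \<open>q\<close> keep the exact value at
    \<open>p\<close>, since all competitors agree with \<open>u\<close> there.\<close>
  have inner: "\<exists>w\<in>K. w p = u p \<and> (\<forall>q\<in>Q. w q \<le> u q + e)" if p: "p \<in> \<Omega>" and Q: "finite Q" "Q \<subseteq> \<Omega>" for p Q
    using Q
  proof (induction Q rule: finite_induct)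
    case empty
    then show ?case
      using K_interpolation[OF u p p e] by auto
  next
    case (insert q Q)
    then obtain w where w: "w \<in> K" "w p = u p" "\<And>q. q \<in> Q \<Longrightarrow> w q \<le> u q + e"
      by auto
    obtain z where z: "z \<in> K" "z p = u p" "z q \<le> u q + e"
      using K_interpolation[OF u p _ e, of q] insert.prems by auto
    show ?case
      by (rule bexI[OF _ K_max_min(2)[OF w(1) z(1)]]) (use w z in \<open>auto simp: min_le_iff_disj\<close>)
  qed
  \<comment> \<open>Maxima over the points \<open>p\<close> lift the function above \<open>u\<close>
    on \<open>Q\<close>, while the upper bound on the net, common to all competitors, is
    preserved.\<close>
  have "\<exists>v\<in>K. (\<forall>p\<in>Q. u p \<le> v p) \<and> (\<forall>q\<in>P. v q \<le> u q + e)" if "finite Q" "Q \<subseteq> \<Omega>" for Q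
    using that
  proof (induction Q rule: finite_induct)
    case empty
    then show ?case
      using inner[OF x0 P(2,1)] by auto
  next
    case (insert p Q)
    then obtain v where v: "v \<in> K" "\<And>p. p \<in> Q \<Longrightarrow> u p \<le> v p" "\<And>q. q \<in> P \<Longrightarrow> v q \<le> u q + e"
      by auto
    obtain z where z: "z \<in> K" "z p = u p" "\<And>q. q \<in> P \<Longrightarrow> z q \<le> u q + e"
      using inner[OF _ P(2,1), of p] insert.prems by auto
    show ?case
      by (rule bexI[OF _ K_max_min(1)[OF v(1) z(1)]]) (use v z in \<open>auto simp: le_max_iff_disj\<close>)
  qed
  then obtain v where v: "v \<in> K" "\<And>p. p \<in> P \<Longrightarrow> u p \<le> v p" "\<And>q. q \<in> P \<Longrightarrow> v q \<le> u q + e"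
    using P by meson
  \<comment> \<open>The net controls \<open>u\<close> as well as \<open>v\<close>: one
    \<open>e\<close> for each when moving to a net point, and one for their difference
    there.\<close>
  have lu: "lipschitz_on_segments \<Omega> \<beta> u"
    using segment_lipschitz_if_le_d[of u 1] u by simp
  have "\<bar>v x - u x\<bar> \<le> 3 * e" if x: "x \<in> \<Omega>" for x
  proof -
    obtain p where p: "p \<in> P" "\<And>v. lipschitz_on_segments \<Omega> \<beta> v \<Longrightarrow> \<bar>v x - v p\<bar> \<le> e"
      using net[OF x] by blast
    show ?thesis
      using p(2)[OF lu] p(2)[OF K_lipschitz[OF v(1)]] v(2,3)[OF p(1)] by linarith
  qed
  then show ?thesis
    using v(1) by blast
qed

section \<open>Comparison of the difference quotient with \<open>F\<close>\<close>

abbreviation R :: "(real ^ 'n \<Rightarrow> real) \<Rightarrow> ereal" where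
  "R \<equiv> difference_quotient \<Omega> (d1 \<Omega> F)"

text \<open>Division clears because \<open>d\<close> is finite and nonnegative. The pairs left out
  of the supremum are diagonal, by the lower bound with \<alpha>, and satisfy the inequality
  trivially.\<close>

lemma R_le_iff:
  assumes "0 \<le> r"
  shows "R u \<le> ereal r \<longleftrightarrow> (\<forall>x\<in>\<Omega>. \<forall>y\<in>\<Omega>. u x - u y \<le> r * d x y)"
proof -
  have *: "ereal (u x - u y) / d1 \<Omega> F x y \<le> ereal r \<longleftrightarrow> u x - u y \<le> r * d x y"
    if "x \<in> \<Omega>" "y \<in> \<Omega>" "d1 \<Omega> F x y \<noteq> 0" for x y
    using that d_nonneg[OF that(1,2)] by (simp add: d1_eq divide_le_eq zero_ereal_def)
  have eq: "x = y" if "x \<in> \<Omega>" "y \<in> \<Omega>" "d1 \<Omega> F x y = 0" for x y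
  proof -
    have "\<alpha> * norm (x - y) \<le> 0"
      using d1_eq[OF that(1,2)] that(3) by (simp add: zero_ereal_def)
    then show ?thesis
      using \<alpha> by (simp add: mult_le_0_iff)
  qed
  have "R u \<le> ereal r \<longleftrightarrow> (\<forall>x\<in>\<Omega>. \<forall>y\<in>\<Omega>. d1 \<Omega> F x y \<noteq> 0 \<longrightarrow> ereal (u x - u y) / d1 \<Omega> F x y \<le> ereal r)"
    unfolding difference_quotient_def SUP_le_iff by auto
  also have "\<dots> \<longleftrightarrow> (\<forall>x\<in>\<Omega>. \<forall>y\<in>\<Omega>. u x - u y \<le> r * d x y)"
    using * eq assms d_nonneg by (metis diff_self mult_nonneg_nonneg)
  finally show ?thesis .
qed

text \<open>Of the two orderings of a pair of distinct points, one has a nonnegative numerator. The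
  pseudo-distance may be asymmetric, but \<alpha> makes it positive in both directions.\<close>

lemma R_nonneg: "0 \<le> R u"
proof -
  obtain x e where x: "x \<in> \<Omega>" and e: "0 < e" "cball x e \<subseteq> \<Omega>"
    using ne opn by (metis all_not_in_conv open_contains_cball)
  define y where "y = x + e *\<^sub>R axis undefined 1"
  have y: "y \<in> \<Omega>" "x \<noteq> y"
    using e by (auto simp: y_def dist_norm axis_eq_0_iff intro!: subsetD[OF e(2)])
  have dpos: "0 < d x y" "0 < d y x"
    using d1_eq(2)[OF x y(1)] d1_eq(2)[OF y(1) x] y(2) \<alpha>
    by (auto intro: less_le_trans[rotated] simp: mult_pos_pos)
  have le: "ereal (u p - u q) / d1 \<Omega> F p q \<le> R u" if "p \<in> \<Omega>" "q \<in> \<Omega>" "0 < d p q" for p q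
    unfolding difference_quotient_def
    by (rule SUP_upper2[of "(p, q)"]) (use that d1_eq in \<open>auto simp: zero_ereal_def\<close>)
  show ?thesis
  proof (cases "u y \<le> u x")
    case True
    then have "0 \<le> ereal (u x - u y) / d1 \<Omega> F x y"
      using dpos(1) by (simp add: d1_eq[OF x y(1)] zero_ereal_def)
    then show ?thesis
      using le[OF x y(1) dpos(1)] by (rule order_trans)
  next
    case False
    then have "0 \<le> ereal (u y - u x) / d1 \<Omega> F y x"
      using dpos(2) by (simp add: d1_eq[OF y(1) x] zero_ereal_def)
    then show ?thesis
      using le[OF y(1) x dpos(2)] by (rule order_trans)
  qed
qed

lemma constant_if_R_le_0: "R u \<le> 0 \<Longrightarrow> u constant_on \<Omega>"
  using R_le_iff[of 0 u] unfolding constant_on_def zero_ereal_def by (metis antisym diff_le_0_iff_le mult_zero_left order_refl)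

lemma R_le_0_if_constant: "u constant_on \<Omega> \<Longrightarrow> R u \<le> 0"
  using R_le_iff[of 0 u] unfolding constant_on_def zero_ereal_def by force

lemma W1inf_scale: "v \<in> W1inf \<Omega> \<Longrightarrow> (\<lambda>x. l * v x) \<in> W1inf \<Omega>"
  using W1inf_lincomb[OF bounded opn, of v v l 0] by simp

lemma R_le_if_F_le:
  assumes v: "v \<in> W1inf \<Omega>" and F: "F v \<le> ereal l" and l: "0 < l"
  shows "R v \<le> ereal l"
proof -
  have "F (\<lambda>x. (1 / l) * v x) = ereal (1 / l) * F v"
    using l by (intro F_hom v) simp
  also have "\<dots> \<le> ereal (1 / l) * ereal l"
    using l F by (intro ereal_mult_left_mono) auto
  also have "\<dots> = 1"
    using l by (simp add: one_ereal_def)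
  finally have k: "(\<lambda>x. (1 / l) * v x) \<in> K"
    using W1inf_scale[OF v, of "1 / l"] by (simp add: K_def)
  have "v x - v y \<le> l * d x y" if "x \<in> \<Omega>" "y \<in> \<Omega>" for x y
    using K_diff_le_d[OF k that] l by (simp add: field_simps)
  then show ?thesis
    using l by (simp add: R_le_iff)
qed

lemma F_constant:
  assumes v: "v \<in> W1inf \<Omega>" "v constant_on \<Omega>"
  shows "F v = F (\<lambda>x. 0)" "(\<lambda>x. 0) \<in> W1inf \<Omega>"
proof -
  obtain c where c: "\<And>x. x \<in> \<Omega> \<Longrightarrow> v x = c"
    using v(2) by (auto simp: constant_on_def)
  show z: "(\<lambda>x. 0) \<in> W1inf \<Omega>"
    using W1inf_scale[OF v(1), of 0] by simp
  have "v = shift \<Omega> c (\<lambda>x. 0)"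
    using v(1) c by (auto simp: shift_def W1inf_def)
  then show "F v = F (\<lambda>x. 0)"
    using F_shift[OF z] by metis
qed

text \<open>The delicate case is \<open>F v \<le> 0\<close>, where scaling into \<open>K\<close>
  works only with levels \<open>l > 0\<close>. Letting \<open>l\<close> decrease to 0 shows that
  \<open>v\<close> is constant, so \<open>F v = F (\<lambda>x. 0)\<close>, and homogeneity with
  factor 2 leaves only 0 or the excluded value -\<infinity>.\<close>

lemma R_le_F:
  assumes v: "v \<in> W1inf \<Omega>" and nc: "\<not> (F (\<lambda>x. 0) = - \<infinity> \<and> v constant_on \<Omega>)"
  shows "R v \<le> F v"
proof -
  consider (inf) "F v = \<infinity>" | (pos) r where "F v = ereal r" "0 < r" | (neg) "F v \<le> 0"
    by (cases "F v") (force simp: zero_ereal_def)+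
  then show ?thesis
  proof cases
    case inf
    then show ?thesis
      by simp
  next
    case pos
    then show ?thesis
      using R_le_if_F_le[OF v] by simp
  next
    case neg
    have "R v \<le> ereal l" if "0 < l" for l
      using neg that by (intro R_le_if_F_le[OF v]) (auto simp: zero_ereal_def intro: order_trans)
    then have R0: "R v \<le> 0"
      using ereal_le_epsilon2[of "R v" 0] by simp
    then have const: "v constant_on \<Omega>"
      by (rule constant_if_R_le_0)
    note F0 = F_constant[OF v const]
    have "F (\<lambda>x. 0) = ereal 2 * F (\<lambda>x. 0)"
      using F_hom[OF _ F0(2), of 2] by simp
    then have "F (\<lambda>x. 0) = 0"
      using neg nc const F0(1) by (cases "F (\<lambda>x. 0)") auto
    then show ?thesis
      using R0 F0(1) by simp
  qed
qed

text \<open>Each \<open>R u \<le> l\<close> with \<open>l > 0\<close> puts \<open>u / l\<close>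
  within reach of \<open>K_dense\<close>. Scaled back by \<open>l\<close>, the approximants have
  \<open>F\<close> at most \<open>l\<close> and constant \<open>l * \<beta>\<close> on segments, so
  the closed sublevel of \<open>G\<close> contains their limit \<open>u\<close>.\<close>

lemma envelope_le:
  assumes \<tau>: "\<tau> \<in> {tau_inf \<Omega>, weak_star_W \<Omega>, seq_topology (weak_star_W \<Omega>)}"
    and u: "u \<in> W1inf \<Omega>" and G: "lsc \<tau> G" "\<And>v. v \<in> topspace \<tau> \<Longrightarrow> G v \<le> F v"
  shows "G u \<le> R u"
proof -
  have top: "topspace \<tau> = W1inf \<Omega>"
    using \<tau> by (auto simp: topspace_tau_inf topspace_weak_star_W topspace_seq_topology)
  have main: "G u \<le> ereal l" if l: "0 < l" and R: "R u \<le> ereal l" for l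
  proof -
    have ul: "u x - u y \<le> l * d x y" if "x \<in> \<Omega>" "y \<in> \<Omega>" for x y
      using R l that by (simp add: R_le_iff)
    then have "u x / l - u y / l \<le> d x y" if "x \<in> \<Omega>" "y \<in> \<Omega>" for x y
      using ul[OF that] l by (simp add: field_simps)
    then have "\<exists>v\<in>K. \<forall>x\<in>\<Omega>. \<bar>v x - u x / l\<bar> \<le> 3 * inverse (real (Suc n))" for n
      by (intro K_dense) auto
    then obtain v where v: "\<And>n. v n \<in> K" "\<And>n x. x \<in> \<Omega> \<Longrightarrow> \<bar>v n x - u x / l\<bar> \<le> 3 * inverse (real (Suc n))"
      by metis
    define w where "w n = (\<lambda>x. l * v n x)" for n
    have wW: "w n \<in> W1inf \<Omega>" for n
      using v(1)[of n] W1inf_scale by (simp add: w_def K_def)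
    have "F (w n) \<le> ereal l" for n
    proof -
      have "F (w n) = ereal l * F (v n)"
        unfolding w_def using v(1)[of n] l by (intro F_hom) (auto simp: K_def)
      also have "\<dots> \<le> ereal l * 1"
        using v(1)[of n] l by (intro ereal_mult_left_mono) (auto simp: K_def)
      finally show ?thesis
        by simp
    qed
    then have wD: "w n \<in> {v \<in> topspace \<tau>. G v \<le> ereal l}" for n
      using G(2)[of "w n"] wW[of n] by (auto simp: top intro: order_trans)
    have wl: "lipschitz_on_segments \<Omega> (l * \<beta>) (w n)" for n
    proof (rule segment_lipschitz_if_le_d)
      show "w n x - w n y \<le> l * d x y" if "x \<in> \<Omega>" "y \<in> \<Omega>" for x y
        using mult_left_mono[OF K_diff_le_d[OF v(1)[of n] that], of l] l by (simp add: w_def right_diff_distrib)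
    qed (use l in simp)
    have unif: "uniform_limit \<Omega> w u sequentially"
    proof (rule uniform_limitI)
      fix e :: real assume "0 < e"
      have "(\<lambda>n. l * (3 * inverse (real (Suc n)))) \<longlonglongrightarrow> l * (3 * 0)"
        by (intro tendsto_mult tendsto_const LIMSEQ_inverse_real_of_nat)
      then have "\<forall>\<^sub>F n in sequentially. l * (3 * inverse (real (Suc n))) < e"
        using \<open>0 < e\<close> by (intro order_tendstoD(2)) simp_all
      then show "\<forall>\<^sub>F n in sequentially. \<forall>x\<in>\<Omega>. dist (w n x) (u x) < e"
      proof eventually_elim
        case (elim n)
        show ?case
        proof
          fix x assume x: "x \<in> \<Omega>"
          have "w n x - u x = l * (v n x - u x / l)"
            using l by (simp add: w_def field_simps)
          then have "dist (w n x) (u x) = l * \<bar>v n x - u x / l\<bar>"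
            using l by (simp add: dist_real_def abs_mult)
          also have "\<dots> \<le> l * (3 * inverse (real (Suc n)))"
            using v(2)[OF x] l by (intro mult_left_mono) auto
          finally show "dist (w n x) (u x) < e"
            using elim by simp
        qed
      qed
    qed
    have "closedin \<tau> {v \<in> topspace \<tau>. G v \<le> ereal l}"
      using G(1) by (simp add: lsc_def)
    then have "u \<in> {v \<in> topspace \<tau>. G v \<le> ereal l}"
      by (rule closedin_uniform_limit[OF bounded opn \<tau> _ wD wW u wl _ unif])
        (use ul l in \<open>auto intro: segment_lipschitz_if_le_d\<close>)
    then show ?thesis
      by simp
  qed
  \<comment> \<open>\<open>R u\<close> may be 0, where dividing by the level is impossible; positive
    levels above it suffice.\<close>
  show ?thesis
  proof (rule ereal_le_real)
    fix z assume z: "R u \<le> ereal z"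
    then have z0: "0 \<le> z"
      using order_trans[OF R_nonneg z] by simp
    show "G u \<le> ereal z"
    proof (rule ereal_le_epsilon2)
      fix e :: real assume "0 < e"
      have "R u \<le> ereal (z + e)"
        using z \<open>0 < e\<close> by (auto intro: order_trans)
      then show "G u \<le> ereal z + ereal e"
        using main[of "z + e"] z0 \<open>0 < e\<close> by simp
    qed
  qed
qed

text \<open>If \<open>F (\<lambda>x. 0)\<close> is -\<infinity>, then \<open>R\<close> exceeds
  \<open>F\<close> at constants, so the minorant \<open>G\<close> lowers \<open>R\<close> to
  -\<infinity> exactly there. It stays lower semicontinuous: in that case its sublevels at negative
  \<open>r\<close> are the set of constants, which is the closed set
  \<open>R v \<le> 0\<close>.\<close>

lemma R_le_envelope:
  assumes \<tau>: "\<tau> \<in> {tau_inf \<Omega>, weak_star_W \<Omega>, seq_topology (weak_star_W \<Omega>)}"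
    and u: "u \<in> W1inf \<Omega>" and nc: "\<not> (F (\<lambda>x. 0) = - \<infinity> \<and> u constant_on \<Omega>)"
  shows "R u \<le> lsc_envelope \<tau> F u"
proof -
  have top: "topspace \<tau> = W1inf \<Omega>"
    using \<tau> by (auto simp: topspace_tau_inf topspace_weak_star_W topspace_seq_topology)
  define G where "G v = (if F (\<lambda>x. 0) = - \<infinity> \<and> v constant_on \<Omega> then - \<infinity> else R v)" for v
  have sub: "closedin \<tau> {v \<in> W1inf \<Omega>. R v \<le> ereal r}" if "0 \<le> r" for r
    unfolding R_le_iff[OF that]
    by (rule closedin_difference_sublevel[OF bounded opn \<tau>]) (rule segment_lipschitz_if_le_d[OF _ that])
  have "closedin \<tau> {v \<in> topspace \<tau>. G v \<le> ereal r}" for r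
  proof (cases "0 \<le> r")
    case True
    have "G v \<le> ereal r \<longleftrightarrow> R v \<le> ereal r" for v
      using R_le_0_if_constant[of v] True by (auto simp: G_def zero_ereal_def intro: order_trans)
    then show ?thesis
      using sub[OF True] by (simp add: top)
  next
    case False
    then have neg: "\<not> R v \<le> ereal r" for v
      using R_nonneg[of v] by (meson ereal_less_eq(5) order_trans)
    show ?thesis
    proof (cases "F (\<lambda>x. 0) = - \<infinity>")
      case True
      then have "G v \<le> ereal r \<longleftrightarrow> R v \<le> ereal 0" for v
        using neg R_le_0_if_constant constant_if_R_le_0 by (auto simp: G_def zero_ereal_def)
      then show ?thesis
        using sub[of 0] by (simp add: top)
    next
      case False
      then show ?thesis
        using neg by (simp add: G_def)
    qed
  qed
  then have "lsc \<tau> G"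
    by (simp add: lsc_def)
  moreover have "\<forall>v \<in> topspace \<tau>. G v \<le> F v"
    using R_le_F by (auto simp: G_def top)
  ultimately have "G u \<le> lsc_envelope \<tau> F u"
    unfolding lsc_envelope_def by (intro SUP_upper) blast
  then show ?thesis
    using nc by (auto simp: G_def split: if_splits)
qed

end

theorem theorem3p2:
  fixes \<Omega> :: "(real ^ 'n) set"
    and f :: "(real ^ 'n) \<times> (real ^ 'n) \<Rightarrow> ereal"
    and F :: "(real ^ 'n \<Rightarrow> real) \<Rightarrow> ereal"
  assumes "bounded \<Omega>" and "connected \<Omega>" and "open \<Omega>" and "lipschitz_boundary \<Omega>"
    and "f \<in> borel_measurable (restrict_space borel (\<Omega> \<times> UNIV))"
    and "\<forall>u \<in> W1inf \<Omega>. F u = supremal_functional \<Omega> f u"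
    and "\<forall>l > 0. \<forall>u \<in> W1inf \<Omega>. F (\<lambda>x. l * u x) = ereal l * F u"
    and "\<exists>\<alpha> > 0. \<exists>\<beta> > 0. \<forall>x \<in> \<Omega>. \<forall>y \<in> \<Omega>.
      ereal (\<alpha> * norm (x - y)) \<le> d1 \<Omega> F x y \<and> d1 \<Omega> F x y \<le> ereal \<beta> * geodetic_dist \<Omega> x y"
  shows "\<forall>\<tau> \<in> {tau_inf \<Omega>, weak_star_W \<Omega>, seq_topology (weak_star_W \<Omega>)}.
    \<forall>u \<in> W1inf \<Omega>. \<not> (F (\<lambda>x. 0) = -\<infinity> \<and> u constant_on \<Omega>) \<longrightarrow>
      lsc_envelope \<tau> F u = difference_quotient \<Omega> (d1 \<Omega> F) u"
proof (intro ballI impI)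
  fix \<tau> u
  assume \<tau>: "\<tau> \<in> {tau_inf \<Omega>, weak_star_W \<Omega>, seq_topology (weak_star_W \<Omega>)}"
    and u: "u \<in> W1inf \<Omega>" and nc: "\<not> (F (\<lambda>x. 0) = - \<infinity> \<and> u constant_on \<Omega>)"
  \<comment> \<open>On the empty domain the essential supremum is -\<infinity> and the only element
    of the space is the constant 0, so this falls under the exception.\<close>
  have ne: "\<Omega> \<noteq> {}"
  proof
    assume empty: "\<Omega> = {}"
    then have u0: "u = (\<lambda>x. 0)"
      using u by (auto simp: W1inf_def)
    have "esssup (lebesgue_on \<Omega>) (\<lambda>x. f (x, weak_gradient \<Omega> u x)) \<le> - \<infinity>"
      by (rule esssup_I[OF borel_measurable_supremand[OF assms(5) u]])
        (auto simp: empty space_restrict_space intro: AE_I2)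
    then have "F u = - \<infinity>"
      using assms(6) u by (simp add: supremal_functional_def)
    then show False
      using nc u0 empty by (simp add: constant_on_def)
  qed
  obtain \<alpha> \<beta> where ab: "0 < \<alpha>" "0 < \<beta>" "\<And>x y. x \<in> \<Omega> \<Longrightarrow> y \<in> \<Omega> \<Longrightarrow>
      ereal (\<alpha> * norm (x - y)) \<le> d1 \<Omega> F x y \<and> d1 \<Omega> F x y \<le> ereal \<beta> * geodetic_dist \<Omega> x y"
    using assms(8) by blast
  interpret homogeneous_supremal \<Omega> f F \<alpha> \<beta>
    by unfold_locales (use assms(1-7) ne ab in auto)
  show "lsc_envelope \<tau> F u = difference_quotient \<Omega> (d1 \<Omega> F) u"
  proof (rule antisym)
    show "lsc_envelope \<tau> F u \<le> difference_quotient \<Omega> (d1 \<Omega> F) u"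
      unfolding lsc_envelope_def by (rule SUP_least) (auto intro: envelope_le[OF \<tau> u])
    show "difference_quotient \<Omega> (d1 \<Omega> F) u \<le> lsc_envelope \<tau> F u"
      by (rule R_le_envelope[OF \<tau> u nc])
  qed
qed

end
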